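(* For every complex number $z$ with $|\mathrm{Re}(z)|<\pi$, \[ \sum_{\gamma>0} \frac{\sinh z \alpha}{\sinh \pi \alpha} - \sum_{n=1}^{\infty} \frac{\Lambda(n)}{2\pi \sqrt{n}} \left(\frac{i e^{iz}}{e^{iz}+n}-\frac{i e^{-iz}}{e^{-iz}+n} \right) = f(z), \] where \[ f(z)=\sin \frac{z}{2} - \frac{1}{8}\tan \frac{z}{4} -\frac{C+\log 8\pi}{4\pi}\tan \frac{z}{2} - \frac{1}{4\pi \cos \frac{z}{2}} \log \frac{1-\tan \frac{z}{4}}{1+\tan \frac{z}{4}}. \]
   Context: $\Lambda$ is the von Mangoldt function and $C$ is the Euler–Mascheroni constant. $\rho=\beta+i\gamma$ runs over the non-trivial zeros of the Riemann zeta function (counted with multiplicity), and for each zero $\alpha=-i(\rho-\tfrac12)$. The sum $\sum_{\gamma>0}$ is over the non-trivial zeros with positive imaginary part. $\log$ denotes the principal branch of the logarithm. *)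

theory Defs
  imports "HOL-Complex_Analysis.Complex_Analysis" "HOL-Number_Theory.Number_Theory"
begin

text \<open>The Riemann zeta function: the unique holomorphic function on the complex
  plane minus the pole 1 given by the Dirichlet series for Re s > 1.
  Its value at the pole 1 is irrelevant; we normalise it to 0 only to make the
  description unique (1 is not in the critical strip).\<close>
definition riemann_zeta :: "complex \<Rightarrow> complex" where
  "riemann_zeta = (THE f. f holomorphic_on (- {1}) \<and>
      (\<forall>s. 1 < Re s \<longrightarrow> (\<lambda>n. 1 / (of_nat (Suc n)) powr s) sums f s) \<and> f 1 = 0)"

definition nontrivial_zeta_zero :: "complex \<Rightarrow> bool" where
  "nontrivial_zeta_zero \<rho> \<longleftrightarrow> riemann_zeta \<rho> = 0 \<and> 0 < Re \<rho> \<and> Re \<rho> < 1"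

definition zeta_zero_mult :: "complex \<Rightarrow> nat" where
  "zeta_zero_mult \<rho> = nat (zorder riemann_zeta \<rho>)"

definition zero_alpha :: "complex \<Rightarrow> complex" where
  "zero_alpha \<rho> = - \<i> * (\<rho> - 1/2)"

definition f_rhs :: "complex \<Rightarrow> complex" where
  "f_rhs z = sin (z/2) - (1/8) * tan (z/4)
     - (euler_mascheroni + of_real (ln (8*pi))) / (4 * of_real pi) * tan (z/2)
     - 1 / (4 * of_real pi * cos (z/2)) * Ln ((1 - tan (z/4)) / (1 + tan (z/4)))"

end

theory Submission
  imports Defs "HOL-Real_Asymp.Real_Asymp"
begin

text \<open>
  Put \<open>s = 1/2 + v\<close> and \<open>g(v) = sin (z v) / sin (\<pi> v)\<close>, so that the summand at a zero
  \<open>\<rho> = 1/2 + w\<close> is \<open>g(w)\<close>. As \<open>\<bar>Re z\<bar> < \<pi>\<close>, \<open>g\<close> is even and decays exponentially in vertical strips,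
  and by the residue theorem \<open>g(w)\<close> is the integral of \<open>g(v) (1/(v - w) + 1/(v + w))\<close> over
  \<open>Re v = 3/4\<close>. Summing over the zeros, the Hadamard product of \<open>X(w) = xi(1/2 + w)\<close> turns the left
  sum into the integral of \<open>g X'/X\<close>. On this line \<open>X'/X\<close> is an explicit archimedean term minus
  the Dirichlet series of \<open>\<Lambda>\<close>. The series integrates term by term to the sum over \<open>n\<close>, because
  \<open>n powr - v\<close> only shifts \<open>z\<close> by \<open>\<i> ln n\<close>; the archimedean term integrates to \<open>f z\<close> by
  shifting contours by integers.
\<close>

section \<open>Even entire functions of order below two\<close>

text \<open>Zeta inside the critical strip is given only by a uniqueness description, so its
  continuation, functional equation and the location of its zeros are produced on the way. Two facts
  on zeros matter: none has real part 1, so the zeros of xi are exactly the nontrivial ones, and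
  none is real, so those with positive imaginary part represent each pair \<open>w\<close>,
  \<open>- w\<close> once. Evenness and order below 2 remove the exponential factors from the
  Hadamard product. The abscissa 3/4 lies between 1/2, right of which the Dirichlet series at
  \<open>1/2 + v\<close> converges absolutely, and 1, the next pole of
  \<open>1 / sin (\<pi> v)\<close>. The zeros need the even kernel \<open>g\<close>, but explicit
  integrals are computed for \<open>exp (\<i> z v) / sin (\<pi> v)\<close>, which is merely
  multiplied by a constant when \<open>v\<close> moves by 1; \<open>g\<close> is the difference of
  the cases \<open>z\<close> and \<open>- z\<close>, divided by \<open>2 \<i>\<close>. For the
  digamma term the shift gives the integral times \<open>exp (2 \<i> z) - 1\<close>, so
  \<open>z = 0\<close>, where both sides vanish, is treated apart.\<close>

lemma entire_factor_zero:
  fixes f :: "complex \<Rightarrow> complex"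
  assumes "f holomorphic_on UNIV" "f c \<noteq> 0"
  obtains h k where "h holomorphic_on UNIV" "h a \<noteq> 0" "\<And>u. f u = h u * (u - a) ^ k"
proof -
  have ex: "\<exists>r>0. zor_poly f a holomorphic_on cball a r \<and>
      (\<forall>w\<in>cball a r. f w = zor_poly f a w * (w - a) ^ nat (zorder f a) \<and> zor_poly f a w \<noteq> 0)"
    using zorder_exist_zero[of f UNIV a] assms by auto
  then obtain r where r: "r > 0" "zor_poly f a holomorphic_on cball a r"
    and fac: "\<And>w. w \<in> cball a r \<Longrightarrow> f w = zor_poly f a w * (w - a) ^ nat (zorder f a)"
    and nz: "\<And>w. w \<in> cball a r \<Longrightarrow> zor_poly f a w \<noteq> 0" by blast
  define g where "g = zor_poly f a"
  define k where "k = nat (zorder f a)"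
  \<comment> \<open>Removable singularity: near \<open>a\<close> this is the local cofactor
    \<open>g\<close>, elsewhere the quotient, and the two descriptions overlap.\<close>
  define h where "h = (\<lambda>u. if u = a then g a else f u / (u - a) ^ k)"
  have h_eq: "h u = g u" if "u \<in> ball a r" for u
    using that fac[of u] by (auto simp: h_def g_def k_def)
  have "g holomorphic_on ball a r"
    using r(2) unfolding g_def by (rule holomorphic_on_subset) auto
  then have 1: "h holomorphic_on ball a r"
    using h_eq by (metis (no_types, lifting) holomorphic_cong)
  have "(\<lambda>u. f u / (u - a) ^ k) holomorphic_on - {a}"
    by (intro holomorphic_intros holomorphic_on_subset[OF assms(1)]) auto
  then have 2: "h holomorphic_on - {a}"
    by (rule holomorphic_transform) (auto simp: h_def)
  have "h holomorphic_on (ball a r \<union> - {a})"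
    using 1 2 by (intro holomorphic_on_Un) auto
  moreover have "ball a r \<union> - {a} = UNIV" using r by auto
  ultimately have "h holomorphic_on UNIV" by simp
  moreover have "h a \<noteq> 0" using nz[of a] r by (simp add: h_def g_def)
  moreover have "f u = h u * (u - a) ^ k" for u
    using fac[of a] r by (cases "u = a") (auto simp: h_def g_def k_def)
  ultimately show ?thesis using that by blast
qed

lemma entire_factor_zeros:
  fixes f :: "complex \<Rightarrow> complex"
  assumes "finite A" "f holomorphic_on UNIV" "f c \<noteq> 0"
  shows "\<exists>h k. h holomorphic_on UNIV \<and> (\<forall>a\<in>A. h a \<noteq> 0) \<and>
           (\<forall>u. f u = h u * (\<Prod>a\<in>A. (u - a) ^ k a))"
  using assms(1)
proof (induction A rule: finite_induct)
  case empty
  then show ?case using assms by (intro exI[of _ f]) auto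
next
  case (insert a A)
  then obtain h k where h: "h holomorphic_on UNIV" "\<forall>a\<in>A. h a \<noteq> 0"
    "\<forall>u. f u = h u * (\<Prod>a\<in>A. (u - a) ^ k a)" by blast
  have "h c \<noteq> 0" using h(3) assms(3) by auto
  from entire_factor_zero[OF h(1) this, of a] obtain h' n where
    h': "h' holomorphic_on UNIV" "h' a \<noteq> 0" "\<And>u. h u = h' u * (u - a) ^ n" by blast
  have "(\<Prod>b\<in>A. (u - b) ^ (k(a := n)) b) = (\<Prod>b\<in>A. (u - b) ^ k b)" for u
    using insert by (intro prod.cong) auto
  then show ?case
    using h h' insert
    by (intro exI[of _ h'] exI[of _ "k(a := n)"]) (auto simp: mult_ac)
qed

lemma zorder_factor_prod:
  fixes f :: "complex \<Rightarrow> complex"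
  assumes "finite A" "a \<in> A" "h holomorphic_on UNIV" "h a \<noteq> 0"
    "\<And>u. f u = h u * (\<Prod>a\<in>A. (u - a) ^ k a)"
  shows "zorder f a = int (k a)"
proof (rule zorder_eqI[where S = UNIV and g = "\<lambda>u. h u * (\<Prod>b\<in>A-{a}. (u - b) ^ k b)"])
  show "(\<lambda>u. h u * (\<Prod>b\<in>A - {a}. (u - b) ^ k b)) holomorphic_on UNIV"
    by (intro holomorphic_intros assms)
  show "h a * (\<Prod>b\<in>A - {a}. (a - b) ^ k b) \<noteq> 0"
    using assms by (auto simp: prod_zero_iff)
  fix w assume "w \<in> UNIV" "w \<noteq> a"
  show "f w = h w * (\<Prod>b\<in>A - {a}. (w - b) ^ k b) * (w - a) powi int (k a)"
    unfolding assms(5) using assms(1,2)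
    by (subst prod.remove[of A a]) (auto simp: mult_ac)
qed auto

lemma logderiv_factor_prod:
  fixes h :: "complex \<Rightarrow> complex"
  assumes "finite A" "h holomorphic_on UNIV" "h u \<noteq> 0" "u \<notin> A"
  shows "((\<lambda>u. h u * (\<Prod>a\<in>A. (u - a) ^ k a)) has_field_derivative
           h u * (\<Prod>a\<in>A. (u - a) ^ k a) * (deriv h u / h u + (\<Sum>a\<in>A. of_nat (k a) / (u - a)))) (at u)"
  using assms(1,4)
proof (induction A rule: finite_induct)
  case empty
  then show ?case using assms(2,3)
    by (auto intro!: derivative_eq_intros holomorphic_derivI[of h UNIV])
next
  case (insert a A)
  let ?P = "\<lambda>u. h u * (\<Prod>a\<in>A. (u - a) ^ k a)"
  have ua: "u - a \<noteq> 0" using insert by auto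
  have "((\<lambda>u. ?P u * (u - a) ^ k a) has_field_derivative
     ?P u * (deriv h u / h u + (\<Sum>a\<in>A. of_nat (k a) / (u - a))) * (u - a) ^ k a
     + ?P u * (of_nat (k a) * (u - a) ^ (k a - 1))) (at u)"
    by (rule DERIV_cong[OF DERIV_mult[OF insert.IH[OF _] DERIV_power[OF DERIV_diff[OF DERIV_ident DERIV_const]]]])
       (use insert in auto)
  moreover have "(\<lambda>u. ?P u * (u - a) ^ k a) = (\<lambda>u. h u * (\<Prod>a\<in>insert a A. (u - a) ^ k a))"
    using insert by (simp add: mult_ac)
  moreover have e: "of_nat (k a) * (u - a) ^ (k a - 1) = (u - a) ^ k a * (of_nat (k a) / (u - a))"
    using ua by (cases "k a") (auto simp: field_simps)
  have "?P u * (deriv h u / h u + (\<Sum>a\<in>A. of_nat (k a) / (u - a))) * (u - a) ^ k a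
     + ?P u * (of_nat (k a) * (u - a) ^ (k a - 1)) =
     h u * (\<Prod>a\<in>insert a A. (u - a) ^ k a) * (deriv h u / h u + (\<Sum>a\<in>insert a A. of_nat (k a) / (u - a)))"
    unfolding e sum.insert[OF insert(1,2)] prod.insert[OF insert(1,2)] by (simp only: ring_distribs mult_ac add_ac)
  ultimately show ?case by simp
qed

lemma norm_le_on_ball_by_sphere:
  fixes f :: "complex \<Rightarrow> complex"
  assumes "f holomorphic_on UNIV" "r > 0" "\<And>u. norm u = r \<Longrightarrow> norm (f u) \<le> B" "norm u \<le> r"
  shows "norm (f u) \<le> B"
proof (rule maximum_modulus_frontier[of f "cball 0 r"])
  show "f holomorphic_on interior (cball 0 r)" using assms(1) holomorphic_on_subset by blast
  show "continuous_on (closure (cball 0 r)) f"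
    using assms(1) holomorphic_on_imp_continuous_on continuous_on_subset by blast
qed (use assms in \<open>auto simp: frontier_cball\<close>)

text \<open>The map \<open>z / (2 B - z)\<close> sends the half plane \<open>Re z < B\<close> into
  the unit disc and fixes 0, so Schwarz's lemma applies to its composition with \<open>h\<close>. At
  half the radius it gives \<open>norm (h u) \<le> 1/2 * norm (2 B - h u)\<close>, which is solved
  for \<open>norm (h u)\<close>.\<close>

lemma Borel_Caratheodory_half:
  fixes h :: "complex \<Rightarrow> complex"
  assumes holo: "h holomorphic_on ball 0 R" and h0: "h 0 = 0" and R: "R > 0" and B: "B > 0"
    and Re: "\<And>u. norm u < R \<Longrightarrow> Re (h u) < B" and u: "norm u \<le> R / 2"
  shows "norm (h u) \<le> 2 * B"
proof -
  define \<phi> where "\<phi> = (\<lambda>w. h (of_real R * w) / (2 * of_real B - h (of_real R * w)))"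
  have in_ball: "of_real R * w \<in> ball 0 R" if "norm w < 1" for w :: complex
    using that R by (simp add: norm_mult)
  have ne: "2 * of_real B - h (of_real R * w) \<noteq> 0" if "norm w < 1" for w
  proof
    assume "2 * of_real B - h (of_real R * w) = 0"
    then have "Re (h (of_real R * w)) = 2 * B" by (simp add: complex_eq_iff)
    then show False using Re[of "of_real R * w"] in_ball[OF that] B by auto
  qed
  have "(h \<circ> (\<lambda>w. of_real R * w)) holomorphic_on ball 0 1"
    by (rule holomorphic_on_compose_gen[OF _ holo]) (use in_ball in \<open>auto intro!: holomorphic_intros\<close>)
  then have "(\<lambda>w. h (of_real R * w)) holomorphic_on ball 0 1" by (simp only: o_def)
  then have "\<phi> holomorphic_on ball 0 1"
    unfolding \<phi>_def using ne by (intro holomorphic_intros) auto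
  moreover have "\<phi> 0 = 0" by (simp add: \<phi>_def h0)
  moreover have "norm (\<phi> w) < 1" if w: "norm w < 1" for w
  proof -
    define z where "z = h (of_real R * w)"
    have "Re z < B" using Re[of "of_real R * w"] in_ball[OF w] by (simp add: z_def)
    then have "0 < 4 * (B * (B - Re z))" using B by simp
    also have "4 * (B * (B - Re z)) = norm (2 * of_real B - z) ^ 2 - norm z ^ 2"
      unfolding cmod_power2 by (simp add: power2_eq_square algebra_simps)
    finally have "norm z ^ 2 < norm (2 * of_real B - z) ^ 2" by simp
    then have "norm z < norm (2 * of_real B - z)"
      by (rule power_less_imp_less_base) simp
    then show ?thesis using ne[OF w] by (simp add: \<phi>_def norm_divide z_def)
  qed
  moreover define w where "w = u / of_real R"
  moreover have w1: "norm w \<le> 1/2" using u R by (simp add: w_def norm_divide field_simps)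
  ultimately have "norm (\<phi> w) \<le> 1/2"
    using Schwarz_Lemma(1)[of \<phi> w] by fastforce
  moreover have "of_real R * w = u" using R by (simp add: w_def)
  ultimately have "norm (h u) \<le> 1/2 * norm (2 * of_real B - h u)"
    using ne[of w] w1 by (simp add: \<phi>_def norm_divide field_simps)
  moreover have "norm (2 * of_real B - h u) \<le> norm (2 * of_real B :: complex) + norm (h u)"
    by (rule norm_triangle_ineq4)
  moreover have "norm (2 * of_real B :: complex) = 2 * B" using B by (simp add: norm_mult)
  ultimately show ?thesis by linarith
qed

text \<open>Cauchy's estimate for the second derivative on discs of radius \<open>R / 8\<close>,
  which stay where the bound \<open>B\<close> holds; 128 is \<open>2 * 8 ^ 2\<close>.\<close>

lemma norm_diff_le_of_deriv_bound:
  fixes h :: "complex \<Rightarrow> complex"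
  assumes "h holomorphic_on ball 0 R" "R > 0" "\<And>u. norm u \<le> R / 2 \<Longrightarrow> norm (h u) \<le> B" "norm u \<le> R / 8"
  shows "norm (deriv h u - deriv h 0) \<le> 128 * B / R^2 * norm u"
proof -
  have B: "B \<ge> 0" using order_trans[OF norm_ge_zero assms(3)[of 0]] assms(2) by simp
  have hd: "deriv h holomorphic_on ball 0 R"
    by (rule holomorphic_deriv[OF assms(1) open_ball])
  have "norm (deriv (deriv h) x) \<le> 128 * B / R^2" if "x \<in> cball 0 (R/8)" for x
  proof -
    have x: "norm x \<le> R/8" using that by simp
    have sub: "cball x (R/8) \<subseteq> ball 0 R"
    proof
      fix y assume "y \<in> cball x (R/8)"
      then have "norm (y - x) \<le> R/8" by (metis mem_cball dist_norm dist_commute)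
      then have "norm y < R" using x assms(2) norm_triangle_sub[of y x] by linarith
      then show "y \<in> ball 0 R" by simp
    qed
    have "norm ((deriv ^^ 2) h x) \<le> fact 2 * B / (R/8)^2"
    proof (rule Cauchy_inequality)
      show "h holomorphic_on ball x (R/8)"
        using assms(1) sub by (meson ball_subset_cball holomorphic_on_subset order_trans)
      show "continuous_on (cball x (R/8)) h"
        using assms(1) sub by (meson holomorphic_on_imp_continuous_on holomorphic_on_subset)
      show "0 < R/8" using assms by simp
      fix y assume "norm (x - y) = R/8"
      then have "norm y \<le> R/2"
        using x assms(2) norm_triangle_sub[of y x] by (simp add: norm_minus_commute)
      then show "norm (h y) \<le> B" by (rule assms(3))
    qed
    then show ?thesis by (simp add: numeral_2_eq_2 field_simps)
  qed
  then show ?thesis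
    using field_differentiable_bound[of "cball 0 (R/8)" "deriv h" "deriv (deriv h)" "128 * B / R^2" u 0]
      assms holomorphic_derivI[OF hd] by (auto intro: has_field_derivative_at_within)
qed


text \<open>The exponent 3/2 lies strictly between 1 and 2: above 1 it absorbs the logarithm in the
  growth \<open>exp (c * norm w * ln (norm w))\<close> of xi, and below 2 it makes the error in
  \<open>logderiv_error\<close> tend to 0.\<close>

locale even_entire =
  fixes X :: "complex \<Rightarrow> complex" and C :: real
  assumes holo: "X holomorphic_on UNIV"
    and even: "\<And>w. X (- w) = X w"
    and X0: "X 0 \<noteq> 0"
    and C_pos: "C > 0"
    and growth: "\<And>w. norm (X w) \<le> exp (C * (1 + norm w) powr (3/2))"
begin

definition "Z = {w. X w = 0}"
definition mult :: "complex \<Rightarrow> nat" where "mult w = nat (zorder X w)"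

lemma finite_zeros: "finite (Z \<inter> cball 0 r)"
proof -
  have "finite {z \<in> cball 0 r. X z = 0}"
  proof (cases "X constant_on UNIV")
    case True
    then have "X z \<noteq> 0" for z using X0 by (metis UNIV_I constant_on_def)
    then show ?thesis by simp
  next
    case False
    show ?thesis by (rule holomorphic_compact_finite_zeros[OF holo]) (use False in auto)
  qed
  moreover have "Z \<inter> cball 0 r = {z \<in> cball 0 r. X z = 0}" by (auto simp: Z_def)
  ultimately show ?thesis by simp
qed

definition N :: "real \<Rightarrow> nat" where "N r = (\<Sum>w\<in>Z \<inter> cball 0 r. mult w)"

lemma factorization:
  obtains h where "h holomorphic_on UNIV" "\<And>a. a \<in> Z \<inter> cball 0 r \<Longrightarrow> h a \<noteq> 0"
    "\<And>u. X u = h u * (\<Prod>a\<in>Z \<inter> cball 0 r. (u - a) ^ mult a)"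
proof -
  obtain h k where h: "h holomorphic_on UNIV" "\<forall>a\<in>Z \<inter> cball 0 r. h a \<noteq> 0"
    "\<forall>u. X u = h u * (\<Prod>a\<in>Z \<inter> cball 0 r. (u - a) ^ k a)"
    using entire_factor_zeros[OF finite_zeros holo X0] by blast
  have "k a = mult a" if "a \<in> Z \<inter> cball 0 r" for a
    using zorder_factor_prod[OF finite_zeros that h(1), of X k] h that by (simp add: mult_def)
  then have "(\<Prod>a\<in>Z \<inter> cball 0 r. (u - a) ^ k a) = (\<Prod>a\<in>Z \<inter> cball 0 r. (u - a) ^ mult a)" for u
    by (intro prod.cong) auto
  then show ?thesis using h that by auto
qed

text \<open>Substituting \<open>- u\<close> into the local factorization at \<open>w\<close> costs
  only the sign \<open>(-1) ^ nat (zorder X w)\<close>, which goes into the cofactor.\<close>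

lemma mult_uminus: "mult (- w) = mult w"
proof -
  have all: "(if X w = 0 then zorder X w > 0 else zorder X w = 0) \<and>
      (\<exists>r>0. cball w r \<subseteq> UNIV \<and> zor_poly X w holomorphic_on cball w r \<and>
      (\<forall>u\<in>cball w r. X u = zor_poly X w u * (u - w) ^ nat (zorder X w) \<and> zor_poly X w u \<noteq> 0))"
    by (rule zorder_exist_zero[OF holo]) (use X0 in auto)
  then have nn: "zorder X w \<ge> 0" by (auto split: if_splits)
  from all obtain r where r: "r > 0" "zor_poly X w holomorphic_on cball w r"
    and fac: "\<And>u. u \<in> cball w r \<Longrightarrow> X u = zor_poly X w u * (u - w) ^ nat (zorder X w)"
    and nz: "\<And>u. u \<in> cball w r \<Longrightarrow> zor_poly X w u \<noteq> 0" by blast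
  have "zorder X (- w) = zorder X w"
  proof (rule zorder_eqI[where S = "ball (-w) r"
        and g = "\<lambda>u. zor_poly X w (- u) * (-1) ^ nat (zorder X w)"])
    have neg: "- u \<in> cball w r" if "u \<in> ball (-w) r" for u
      using that by (simp add: dist_norm) (metis add.commute less_eq_real_def norm_minus_cancel minus_add_distrib minus_minus diff_conv_add_uminus)
    have "(zor_poly X w \<circ> uminus) holomorphic_on ball (-w) r"
      by (rule holomorphic_on_compose_gen[OF _ r(2)]) (use neg in \<open>auto intro!: holomorphic_intros\<close>)
    then have "(\<lambda>u. zor_poly X w (- u)) holomorphic_on ball (-w) r" by (simp only: o_def)
    then show "(\<lambda>u. zor_poly X w (- u) * (-1) ^ nat (zorder X w)) holomorphic_on ball (-w) r"
      by (intro holomorphic_intros)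
    show "zor_poly X w (- (- w)) * (-1) ^ nat (zorder X w) \<noteq> 0" using nz[of w] r by simp
    fix u assume u: "u \<in> ball (-w) r" "u \<noteq> - w"
    have "X u = zor_poly X w (- u) * (- u - w) ^ nat (zorder X w)"
      using fac[OF neg[OF u(1)]] even[of u] by simp
    also have "- u - w = (-1) * (u - - w)" by simp
    also have "((-1) * (u - - w)) ^ nat (zorder X w) = (-1) ^ nat (zorder X w) * (u - - w) ^ nat (zorder X w)"
      by (rule power_mult_distrib)
    also have "(u - - w) ^ nat (zorder X w) = (u - - w) powi zorder X w"
      using nn by (simp add: power_int_def)
    finally show "X u = zor_poly X w (- u) * (-1) ^ nat (zorder X w) * (u - - w) powi zorder X w"
      by (simp only: mult.assoc)
  qed (use r in auto)
  then show ?thesis by (simp add: mult_def)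
qed

lemma uminus_Z: "- w \<in> Z \<longleftrightarrow> w \<in> Z"
  using even by (simp add: Z_def)

text \<open>Dividing out the zeros in the disc of radius \<open>R\<close> keeps the bound of \<open>X\<close> on the circle of
  radius \<open>3 R\<close>, since every factor \<open>1 - u / a\<close> has modulus at least \<open>2\<close> there.\<close>
lemma quotient_bound:
  assumes R: "R > 0" and h: "h holomorphic_on UNIV"
    "\<And>u. X u = h u * (\<Prod>a\<in>Z \<inter> cball 0 R. (u - a) ^ mult a)"
    and u: "norm u \<le> 3 * R"
  shows "norm (h u) * (2 * R) ^ N R \<le> exp (C * (1 + 3 * R) powr (3/2))"
proof -
  define A where "A = Z \<inter> cball 0 R"
  have "norm (h u * (2 * R) ^ N R) \<le> exp (C * (1 + 3 * R) powr (3/2))"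
  proof (rule norm_le_on_ball_by_sphere[of "\<lambda>u. h u * (2 * R) ^ N R" "3 * R"])
    fix v :: complex assume v: "norm v = 3 * R"
    have "(2 * R) ^ N R = (\<Prod>a\<in>A. (2 * R) ^ mult a)"
      by (simp add: N_def A_def power_sum)
    also have "\<dots> \<le> (\<Prod>a\<in>A. norm ((v - a) ^ mult a))"
    proof (rule prod_mono)
      fix a assume "a \<in> A"
      then have "norm a \<le> R" by (simp add: A_def)
      then have "2 * R \<le> norm (v - a)" using v norm_triangle_ineq2[of v a] by linarith
      then have "(2 * R) ^ mult a \<le> norm (v - a) ^ mult a" using R by (intro power_mono) auto
      then show "0 \<le> (2 * R) ^ mult a \<and> (2 * R) ^ mult a \<le> norm ((v - a) ^ mult a)"
        using R by (simp only: norm_power) simp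
    qed
    finally have "norm (h v) * (2 * R) ^ N R \<le> norm (h v) * (\<Prod>a\<in>A. norm ((v - a) ^ mult a))"
      by (intro mult_left_mono) auto
    also have "\<dots> = norm (X v)"
      using arg_cong[OF h(2)[of v], of norm] by (simp only: norm_mult prod_norm A_def)
    also have "\<dots> \<le> exp (C * (1 + 3 * R) powr (3/2))" using growth[of v] v by simp
    finally show "norm (h v * (2 * R) ^ N R) \<le> exp (C * (1 + 3 * R) powr (3/2))"
      using R by (simp add: norm_mult norm_power)
  qed (use R u h in \<open>auto intro!: holomorphic_intros\<close>)
  then show ?thesis using R by (simp add: norm_mult norm_power)
qed

text \<open>Jensen's bound without an integral: the factor of a zero in the disc is at most
  \<open>R\<close> at 0 but at least \<open>2 * R\<close> on the circle of radius
  \<open>3 * R\<close>, so each zero gains a factor 2. Hence \<open>norm (X 0) * 2 ^ N R\<close> is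
  at most the growth bound on that circle.\<close>

lemma counting_bound:
  obtains D where "D > 0" "\<And>R. R \<ge> 1 \<Longrightarrow> real (N R) \<le> D * R powr (3/2)"
proof -
  \<comment> \<open>The 8 is \<open>4 powr (3/2)\<close>, from
    \<open>1 + 3 * R \<le> 4 * R\<close>.\<close>
  define D where "D = (C * 8 + \<bar>ln (norm (X 0))\<bar> + 1) / ln 2"
  have "real (N R) \<le> D * R powr (3/2)" if R: "R \<ge> 1" for R
  proof -
    obtain h where h: "h holomorphic_on UNIV"
      "\<And>u. X u = h u * (\<Prod>a\<in>Z \<inter> cball 0 R. (u - a) ^ mult a)"
      using factorization[of R] by metis
    have "norm (X 0) \<le> norm (h 0) * R ^ N R"
    proof -
      have "(\<Prod>a\<in>Z \<inter> cball 0 R. norm ((0 - a) ^ mult a)) \<le> (\<Prod>a\<in>Z \<inter> cball 0 R. R ^ mult a)"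
        by (rule prod_mono) (auto simp: norm_power intro!: power_mono)
      also have "\<dots> = R ^ N R" by (simp add: N_def power_sum)
      finally have "norm (h 0) * (\<Prod>a\<in>Z \<inter> cball 0 R. norm ((0 - a) ^ mult a)) \<le> norm (h 0) * R ^ N R"
        by (intro mult_left_mono) auto
      then show ?thesis
        using arg_cong[OF h(2)[of 0], of norm] by (simp only: norm_mult prod_norm)
    qed
    then have "norm (X 0) * 2 ^ N R \<le> norm (h 0) * (2 * R) ^ N R"
      by (simp add: power_mult_distrib mult_ac)
    also have "\<dots> \<le> exp (C * (1 + 3 * R) powr (3/2))"
      using quotient_bound[of R h 0] h R by simp
    finally have "ln (norm (X 0) * 2 ^ N R) \<le> ln (exp (C * (1 + 3 * R) powr (3/2)))"
      using X0 by (subst ln_le_cancel_iff) auto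
    then have "ln (norm (X 0) * 2 ^ N R) \<le> C * (1 + 3 * R) powr (3/2)" by simp
    then have 1: "real (N R) * ln 2 \<le> C * (1 + 3 * R) powr (3/2) + \<bar>ln (norm (X 0))\<bar>"
      using X0 by (simp add: ln_mult ln_realpow)
    have "(1 + 3 * R) powr (3/2) \<le> (4 * R) powr (3/2)" using R by (intro powr_mono2) auto
    also have "\<dots> = 4 powr (3/2) * R powr (3/2)" using R by (simp add: powr_mult)
    also have "(4::real) powr (3/2) = (2 powr 2) powr (3/2)" by simp
    also have "\<dots> = 8" by (subst powr_powr) (simp add: powr_numeral)
    finally have 2: "C * (1 + 3 * R) powr (3/2) \<le> C * (8 * R powr (3/2))"
      using C_pos by (intro mult_left_mono) auto
    have "1 \<le> R powr (3/2)" using R by (intro ge_one_powr_ge_zero) auto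
    then have "\<bar>ln (norm (X 0))\<bar> + 1 \<le> (\<bar>ln (norm (X 0))\<bar> + 1) * R powr (3/2)"
      by (intro mult_right_le_one_le[of _ "1 / R powr (3/2)", THEN order_trans] order_refl | simp add: mult_le_cancel_left1)+
    with 1 2 have "real (N R) * ln 2 \<le> (C * 8 + \<bar>ln (norm (X 0))\<bar> + 1) * R powr (3/2)"
      by (simp add: algebra_simps)
    then show ?thesis by (simp add: D_def field_simps)
  qed
  moreover have "D > 0" using C_pos by (simp add: D_def add_nonneg_pos)
  ultimately show ?thesis using that by blast
qed

text \<open>Dyadic summation: a zero of modulus about \<open>2 ^ j\<close> contributes about
  \<open>1 / 4 ^ j\<close>, and there are at most about \<open>2 powr (3 * j / 2)\<close> of them,
  so a geometric series of ratio \<open>2 powr (-1/2)\<close> dominates.\<close>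

lemma inverse_square_summable: "(\<lambda>w. real (mult w) / norm w ^ 2) summable_on Z"
proof -
  obtain D where D: "D > 0" "\<And>R. R \<ge> 1 \<Longrightarrow> real (N R) \<le> D * R powr (3/2)"
    using counting_bound by blast
  define g where "g = (\<lambda>j::nat. (2 powr (-1/2)) ^ j :: real)"
  have q: "(2::real) powr (-1/2) < 1" using powr_less_mono[of "-1/2" 0 2] by simp
  have g_sum: "sum g {..J} \<le> 1 / (1 - 2 powr (-1/2))" for J
  proof -
    have "sum g {..J} \<le> suminf g"
      using q by (intro sum_le_suminf) (auto simp: g_def)
    also have "\<dots> = 1 / (1 - 2 powr (-1/2))" using q by (simp add: g_def suminf_geometric)
    finally show ?thesis .
  qed
  \<comment> \<open>The finitely many zeros in the unit disc are put aside, because the dyadic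
    comparison uses \<open>norm w > 1\<close>.\<close>
  define Z1 where "Z1 = Z - cball 0 1"
  have bound: "(\<Sum>w\<in>F. real (mult w) / norm w ^ 2) \<le> 4 * D * (1 / (1 - 2 powr (-1/2)))"
    if F: "finite F" "F \<subseteq> Z1" for F
  proof -
    have "\<exists>J::nat. \<forall>w\<in>F. norm w \<le> 2 ^ J"
    proof -
      obtain B where B: "\<forall>w\<in>F. norm w \<le> B" using finite_imp_bounded[OF F(1)] bounded_iff by blast
      obtain J where "B < 2 ^ J" using real_arch_pow[of 2 B] by auto
      then show ?thesis using B by (intro exI[of _ J]) force
    qed
    then obtain J :: nat where J: "\<And>w. w \<in> F \<Longrightarrow> norm w \<le> 2 ^ J" by blast
    have "1 / norm w ^ 2 \<le> (\<Sum>j\<le>J. if norm w \<le> 2 ^ j then 4 * (1 / 4 ^ j) else 0)" if w: "w \<in> F" for w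
    proof -
      \<comment> \<open>For the least such \<open>j\<close> also
        \<open>2 ^ (j - 1) < norm w\<close>, so this single term of the sum already dominates
        \<open>1 / norm w ^ 2\<close>.\<close>
      define j where "j = (LEAST j. norm w \<le> 2 ^ j)"
      have j: "norm w \<le> 2 ^ j" "j \<le> J" unfolding j_def using J[OF w] by (auto intro: LeastI Least_le)
      have "norm w > 1" using w F by (auto simp: Z1_def)
      have "j \<noteq> 0"
      proof
        assume "j = 0"
        then show False using j(1) \<open>norm w > 1\<close> by simp
      qed
      then have "\<not> norm w \<le> 2 ^ (j - 1)" using not_less_Least[of "j - 1" "\<lambda>j. norm w \<le> 2 ^ j"]
        by (simp add: j_def)
      then have "(2 ^ (j - 1)) ^ 2 \<le> norm w ^ 2" by (intro power_mono) auto
      moreover have "(2 ^ (j - 1)) ^ 2 = (4 ^ j / 4 :: real)"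
        using \<open>j \<noteq> 0\<close> by (cases j) (auto simp: power2_eq_square power_mult_distrib[symmetric])
      ultimately have "4 ^ j / 4 \<le> norm w ^ 2" by metis
      then have "1 / norm w ^ 2 \<le> 1 / (4 ^ j / 4)"
        using \<open>norm w > 1\<close> by (intro divide_left_mono mult_pos_pos zero_less_power) auto
      then have "1 / norm w ^ 2 \<le> 4 * (1 / 4 ^ j)" by simp
      also have "\<dots> = (if norm w \<le> 2 ^ j then 4 * (1 / 4 ^ j) else 0)" using j by simp
      also have "\<dots> \<le> (\<Sum>j\<le>J. if norm w \<le> 2 ^ j then 4 * (1 / 4 ^ j) else 0)"
        using j by (intro member_le_sum) auto
      finally show ?thesis .
    qed
    then have "(\<Sum>w\<in>F. real (mult w) * (1 / norm w ^ 2)) \<le>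
        (\<Sum>w\<in>F. real (mult w) * (\<Sum>j\<le>J. if norm w \<le> 2 ^ j then 4 * (1 / 4 ^ j) else 0))"
      by (intro sum_mono mult_left_mono) auto
    also have "\<dots> = (\<Sum>j\<le>J. \<Sum>w\<in>F. real (mult w) * (if norm w \<le> 2 ^ j then 4 * (1 / 4 ^ j) else 0))"
      by (subst sum.swap) (simp add: sum_distrib_left)
    also have "\<dots> \<le> (\<Sum>j\<le>J. 4 * D * g j)"
    proof (rule sum_mono)
      fix j
      have "(\<Sum>w\<in>F. real (mult w) * (if norm w \<le> 2 ^ j then 4 * (1 / 4 ^ j) else 0)) =
            (\<Sum>w\<in>F \<inter> cball 0 (2 ^ j). real (mult w) * (4 * (1 / 4 ^ j)))"
        using F(1) by (subst sum.inter_restrict) (auto intro!: sum.cong)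
      also have "\<dots> \<le> (\<Sum>w\<in>Z \<inter> cball 0 (2 ^ j). real (mult w) * (4 * (1 / 4 ^ j)))"
        using F finite_zeros by (intro sum_mono2) (auto simp: Z1_def)
      also have "\<dots> = real (N (2 ^ j)) * (4 * (1 / 4 ^ j))"
        by (simp only: N_def of_nat_sum sum_distrib_right)
      also have "\<dots> \<le> (D * (2 ^ j) powr (3/2)) * (4 * (1 / 4 ^ j))"
        using D(2)[of "2 ^ j"] by (intro mult_right_mono) auto
      also have "(2 ^ j) powr (3/2) * (1 / 4 ^ j) = g j"
      proof -
        have "(2 ^ j) powr (3/2) * (1 / 4 ^ j) = 2 powr (real j * (3/2)) * 2 powr (- 2 * real j)"
          by (simp add: powr_powr powr_realpow[symmetric] powr_minus divide_simps flip: powr_powr[of 2 2])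
        also have "\<dots> = 2 powr (real j * (-1/2))" by (simp add: powr_add[symmetric])
        also have "\<dots> = g j" by (simp add: g_def powr_realpow[symmetric] powr_powr mult_ac)
        finally show ?thesis .
      qed
      then have "(D * (2 ^ j) powr (3/2)) * (4 * (1 / 4 ^ j)) = 4 * D * g j"
        by (metis mult.assoc mult.commute)
      finally show "(\<Sum>w\<in>F. real (mult w) * (if norm w \<le> 2 ^ j then 4 * (1 / 4 ^ j) else 0)) \<le> 4 * D * g j" .
    qed
    also have "\<dots> = 4 * D * sum g {..J}" by (simp add: sum_distrib_left)
    also have "\<dots> \<le> 4 * D * (1 / (1 - 2 powr (-1/2)))"
      using D(1) g_sum by (intro mult_left_mono) auto
    finally show ?thesis by simp
  qed
  have "(\<lambda>w. real (mult w) / norm w ^ 2) summable_on Z1"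
    using bound by (intro nonneg_bdd_above_summable_on) (auto intro!: bdd_aboveI)
  moreover have "(\<lambda>w. real (mult w) / norm w ^ 2) summable_on (Z \<inter> cball 0 1)"
    using finite_zeros by (intro summable_on_finite)
  ultimately have "(\<lambda>w. real (mult w) / norm w ^ 2) summable_on (Z1 \<union> (Z \<inter> cball 0 1))"
    by (intro summable_on_Un_disjoint) (auto simp: Z1_def)
  moreover have "Z1 \<union> (Z \<inter> cball 0 1) = Z" by (auto simp: Z1_def)
  ultimately show ?thesis by simp
qed


text \<open>Zeros come in pairs \<open>w\<close>, \<open>- w\<close> of equal multiplicity. Together
  with \<open>deriv_0\<close> this makes the logarithmic derivative of the zero-free cofactor vanish
  at 0, which is why no exponential factor survives.\<close>

lemma sum_reciprocal_zeros: "(\<Sum>w\<in>Z \<inter> cball 0 r. of_nat (mult w) / (0 - w)) = 0"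
proof -
  have "(\<Sum>w\<in>Z \<inter> cball 0 r. of_nat (mult w) / (0 - w)) =
        (\<Sum>w\<in>Z \<inter> cball 0 r. of_nat (mult (- w)) / (0 - (- w)))"
    by (rule sum.reindex_bij_witness[of _ uminus uminus]) (auto simp: uminus_Z)
  also have "\<dots> = (\<Sum>w\<in>Z \<inter> cball 0 r. - (of_nat (mult w) / (0 - w)))"
    by (simp add: mult_uminus)
  also have "\<dots> = - (\<Sum>w\<in>Z \<inter> cball 0 r. of_nat (mult w) / (0 - w))"
    by (rule sum_negf)
  finally show ?thesis by simp
qed

lemma deriv_0: "deriv X 0 = 0"
proof -
  have d: "(X has_field_derivative deriv X w) (at w)" for w
    using holo by (auto intro: holomorphic_derivI)
  have "((\<lambda>w. X (- w)) has_field_derivative deriv X 0 * (-1)) (at 0)"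
    by (rule DERIV_chain2[of X]) (use d[of 0] in \<open>auto intro!: derivative_eq_intros\<close>)
  then have "(X has_field_derivative - deriv X 0) (at 0)" by (simp add: even)
  with d[of 0] have "deriv X 0 = - deriv X 0" by (rule DERIV_unique)
  then show ?thesis by simp
qed

text \<open>The difference is the logarithmic derivative of the cofactor \<open>h\<close> left after
  dividing out the zeros in the disc. A logarithm of \<open>h\<close>, normalised to 0 at 0, has
  real part at most of order \<open>R powr (3/2)\<close>. Borel-Caratheodory and Cauchy then bound
  its second derivative by that over \<open>R^2\<close>, and its first derivative vanishes at
  0.\<close>

lemma logderiv_error:
  assumes R: "R \<ge> 1" "8 * norm v \<le> R" and v: "X v \<noteq> 0"
  shows "norm (deriv X v / X v - (\<Sum>w\<in>Z \<inter> cball 0 R. of_nat (mult w) / (v - w)))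
    \<le> 256 * (C * (1 + 3 * R) powr (3/2) + \<bar>ln (norm (X 0))\<bar> + 1) / R^2 * norm v"
proof -
  define A where "A = Z \<inter> cball 0 R"
  define B where "B = C * (1 + 3 * R) powr (3/2) + \<bar>ln (norm (X 0))\<bar> + 1"
  have B: "B > 0" using C_pos by (simp add: B_def add_nonneg_pos)
  obtain h where h: "h holomorphic_on UNIV" "\<And>a. a \<in> A \<Longrightarrow> h a \<noteq> 0"
      "\<And>u. X u = h u * (\<Prod>a\<in>A. (u - a) ^ mult a)"
    using factorization[of R] unfolding A_def by metis
  have hnz: "h u \<noteq> 0" if "u \<in> ball 0 R" for u
  proof (cases "u \<in> A")
    case False
    then have "X u \<noteq> 0" using that by (auto simp: A_def Z_def)
    then show ?thesis using h(3)[of u] by auto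
  qed (use h in auto)
  have ld: "deriv X u / X u = deriv h u / h u + (\<Sum>w\<in>A. of_nat (mult w) / (u - w))"
    if u: "X u \<noteq> 0" for u
  proof -
    have "h u \<noteq> 0" using h(3)[of u] u by auto
    moreover have "u \<notin> A" using u by (auto simp: A_def Z_def)
    moreover have "finite A" unfolding A_def by (rule finite_zeros)
    ultimately have "((\<lambda>u. h u * (\<Prod>a\<in>A. (u - a) ^ mult a)) has_field_derivative
        h u * (\<Prod>a\<in>A. (u - a) ^ mult a) * (deriv h u / h u + (\<Sum>w\<in>A. of_nat (mult w) / (u - w)))) (at u)"
      using h(1) by (intro logderiv_factor_prod)
    then have "(X has_field_derivative X u * (deriv h u / h u + (\<Sum>w\<in>A. of_nat (mult w) / (u - w)))) (at u)"
      by (simp only: h(3)[symmetric])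
    then have "deriv X u = X u * (deriv h u / h u + (\<Sum>w\<in>A. of_nat (mult w) / (u - w)))"
      by (rule DERIV_imp_deriv)
    then show ?thesis using u by simp
  qed
  have h0: "deriv h 0 = 0"
    using ld[of 0] X0 deriv_0 sum_reciprocal_zeros[of R] hnz[of 0] R by (simp add: A_def)
  obtain l where l: "l holomorphic_on ball 0 R" "\<And>u. u \<in> ball 0 R \<Longrightarrow> h u = exp (l u)"
  proof (rule holomorphic_logarithm_exists[of "ball 0 R" h 0])
    show "h holomorphic_on ball 0 R" using h(1) holomorphic_on_subset by blast
  qed (use hnz R in auto)
  have dl: "deriv l u = deriv h u / h u" if "u \<in> ball 0 R" for u
  proof -
    have "(l has_field_derivative deriv l u) (at u)"
      using l(1) that by (intro holomorphic_derivI) auto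
    then have "((\<lambda>u. exp (l u)) has_field_derivative exp (l u) * deriv l u) (at u)"
      by (auto intro!: derivative_eq_intros)
    then have "(h has_field_derivative exp (l u) * deriv l u) (at u)"
      by (rule has_field_derivative_transform_within_open[OF _ open_ball that]) (use l in auto)
    then have "deriv h u = exp (l u) * deriv l u" by (rule DERIV_imp_deriv)
    then show ?thesis using l(2)[OF that] by simp
  qed
  define q where "q = (\<lambda>u. l u - l 0)"
  have q: "q holomorphic_on ball 0 R" using l(1) by (auto simp: q_def intro!: holomorphic_intros)
  have dq: "deriv q u = deriv l u" if "u \<in> ball 0 R" for u
    unfolding q_def
    using l(1) that by (intro DERIV_imp_deriv) (auto intro!: derivative_eq_intros holomorphic_derivI)
  \<comment> \<open>With \<open>h u\<close> bounded above by the growth of \<open>X\<close> and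
    \<open>h 0\<close> bounded below by \<open>X 0\<close>, the powers \<open>R ^ N R\<close>
    cancel, so the number of zeros does not enter the bound.\<close>
  have Re_q: "Re (q u) < B" if u: "norm u < R" for u
  proof -
    have X0h: "norm (X 0) \<le> norm (h 0) * R ^ N R"
    proof -
      have "(\<Prod>a\<in>A. norm ((0 - a) ^ mult a)) \<le> (\<Prod>a\<in>A. R ^ mult a)"
        by (rule prod_mono) (auto simp: A_def norm_power intro!: power_mono)
      also have "\<dots> = R ^ N R" by (simp add: A_def N_def power_sum)
      finally have "norm (h 0) * (\<Prod>a\<in>A. norm ((0 - a) ^ mult a)) \<le> norm (h 0) * R ^ N R"
        by (intro mult_left_mono) auto
      then show ?thesis
        using arg_cong[OF h(3)[of 0], of norm] by (simp only: norm_mult prod_norm)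
    qed
    have "norm (h u) * norm (X 0) \<le> norm (h u) * (norm (h 0) * R ^ N R)"
      using X0h by (intro mult_left_mono) auto
    also have "\<dots> \<le> norm (h 0) * (norm (h u) * (2 * R) ^ N R)"
      using R by (auto simp: power_mult_distrib mult_ac intro!: mult_left_mono mult_right_mono)
    also have "\<dots> \<le> norm (h 0) * exp (C * (1 + 3 * R) powr (3/2))"
      using quotient_bound[of R h u] h u R by (intro mult_left_mono) (auto simp: A_def)
    finally have "exp (Re (l u)) * norm (X 0) \<le> exp (Re (l 0)) * exp (C * (1 + 3 * R) powr (3/2))"
      using l(2)[of u] l(2)[of 0] u R by simp
    then have "exp (Re (l u)) * exp (ln (norm (X 0))) \<le> exp (Re (l 0)) * exp (C * (1 + 3 * R) powr (3/2))"
      using X0 by simp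
    then have "Re (l u) + ln (norm (X 0)) \<le> Re (l 0) + C * (1 + 3 * R) powr (3/2)"
      by (simp add: exp_add[symmetric])
    then show ?thesis by (simp add: q_def B_def)
  qed
  have "norm (q u) \<le> 2 * B" if "norm u \<le> R / 2" for u
    using Borel_Caratheodory_half[OF q _ _ B Re_q that] R by (simp add: q_def)
  then have "norm (deriv q v - deriv q 0) \<le> 128 * (2 * B) / R^2 * norm v"
    using norm_diff_le_of_deriv_bound[OF q, of "2 * B" v] R by simp
  moreover have "v \<in> ball 0 R"
  proof -
    have "norm v < R" using R norm_ge_zero[of v] by linarith
    then show ?thesis by simp
  qed
  then have "deriv q v - deriv q 0 = deriv h v / h v" using R h0 by (simp add: dq dl)
  moreover have "deriv h v / h v = deriv X v / X v - (\<Sum>w\<in>A. of_nat (mult w) / (v - w))"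
    using ld[OF v] by simp
  ultimately show ?thesis by (simp add: A_def B_def)
qed

text \<open>The counting bound yields convergence of the sum of \<open>1 / norm w ^ 2\<close> only,
  so the sum of \<open>1 / (v - w)\<close> is taken along growing discs. The error has order
  \<open>n powr (3/2) / n^2\<close>.\<close>

lemma logderiv_limit:
  assumes v: "X v \<noteq> 0"
  shows "(\<lambda>n. \<Sum>w\<in>Z \<inter> cball 0 (real n). of_nat (mult w) / (v - w)) \<longlonglongrightarrow> deriv X v / X v"
proof (rule LIM_zero_cancel)
  define K where "K = \<bar>ln (norm (X 0))\<bar> + 1"
  let ?e = "\<lambda>n. 256 * (C * (1 + 3 * real n) powr (3/2) + K) / (real n)^2 * norm v"
  have "((\<lambda>x::real. 256 * (C * (1 + 3 * x) powr (3/2) + K) / x^2) \<longlongrightarrow> 0) at_top"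
    using C_pos by real_asymp
  then have "(\<lambda>n. 256 * (C * (1 + 3 * real n) powr (3/2) + K) / (real n)^2) \<longlonglongrightarrow> 0"
    by (rule filterlim_compose) (rule filterlim_real_sequentially)
  then have lim: "?e \<longlonglongrightarrow> 0" using tendsto_mult_left_zero by blast
  have "\<forall>\<^sub>F n in sequentially. norm ((\<Sum>w\<in>Z \<inter> cball 0 (real n). of_nat (mult w) / (v - w)) - deriv X v / X v) \<le> ?e n"
    using eventually_ge_at_top[of "nat \<lceil>8 * norm v\<rceil> + 1"]
  proof eventually_elim
    case (elim n)
    then have "8 * norm v \<le> real n" "real n \<ge> 1" by linarith+
    then show ?case using logderiv_error[of "real n" v] v by (simp add: K_def add.assoc norm_minus_commute)
  qed
  then show "(\<lambda>n. (\<Sum>w\<in>Z \<inter> cball 0 (real n). of_nat (mult w) / (v - w)) - deriv X v / X v) \<longlonglongrightarrow> 0"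
    using lim by (rule Lim_null_comparison)
qed

end

section \<open>Vertical line integrals against the kernel\<close>

text \<open>Since \<open>ds = \<i> dt\<close>, this is \<open>1 / (2 \<pi> \<i>)\<close> times the
  upward line integral, so that moving the line to the right adds plain residues.\<close>

definition vint :: "(complex \<Rightarrow> complex) \<Rightarrow> real \<Rightarrow> complex" where
  "vint F c = (LINT t|lborel. F (Complex c t)) / (2 * of_real pi)"

text \<open>The bound is asked for large \<open>\<bar>Im s\<bar>\<close> only, which leaves room for
  poles at bounded height in the strip.\<close>

definition vdecay :: "(complex \<Rightarrow> complex) \<Rightarrow> real \<Rightarrow> real \<Rightarrow> bool" where
  "vdecay F a b \<longleftrightarrow> (\<exists>K \<delta> Y. \<delta> > 0 \<and>
     (\<forall>s. a \<le> Re s \<and> Re s \<le> b \<and> \<bar>Im s\<bar> \<ge> Y \<longrightarrow> norm (F s) \<le> K * exp (- \<delta> * \<bar>Im s\<bar>)))"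

lemma vdecay_mono: "vdecay F a b \<Longrightarrow> a \<le> a' \<Longrightarrow> b' \<le> b \<Longrightarrow> vdecay F a' b'"
  unfolding vdecay_def by (meson order_trans)

lemma integrable_exp_abs:
  assumes "\<delta> > (0::real)" shows "integrable lborel (\<lambda>t. exp (- \<delta> * \<bar>t\<bar>))"
proof -
  have "set_integrable lebesgue {0..} (\<lambda>t. exp (- \<delta> * t))"
    using assms by (intro nonnegative_absolutely_integrable_1 integrable_on_exp_minus_to_infinity) auto
  then have 1: "integrable lborel (\<lambda>t. indicator {0..} t * exp (- \<delta> * t))"
    unfolding set_integrable_def by (subst (asm) integrable_completion) (auto simp: mult_ac)
  have "integrable lborel (\<lambda>t. indicator {0..} (0 + (-1) * t) * exp (- \<delta> * (0 + (-1) * t)))"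
    using 1 by (rule lborel_integrable_real_affine) simp
  with 1 have "integrable lborel (\<lambda>t. indicator {0..} t * exp (- \<delta> * t) +
      indicator {0..} (0 + (-1) * t) * exp (- \<delta> * (0 + (-1) * t)))"
    by (rule Bochner_Integration.integrable_add)
  then show ?thesis
    by (rule Bochner_Integration.integrable_bound) (auto simp: indicator_def)
qed

lemma vdecay_dominated:
  assumes "vdecay F c c" "continuous_on {s. Re s = c} F"
  obtains K \<delta> where "\<delta> > 0" "\<And>t. norm (F (Complex c t)) \<le> K * exp (- \<delta> * \<bar>t\<bar>)"
proof -
  obtain K \<delta> Y where K: "\<delta> > 0"
    "\<And>s. Re s = c \<Longrightarrow> \<bar>Im s\<bar> \<ge> Y \<Longrightarrow> norm (F s) \<le> K * exp (- \<delta> * \<bar>Im s\<bar>)"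
    using assms(1) unfolding vdecay_def by force
  define y where "y = max Y 0"
  have cont: "continuous_on UNIV (\<lambda>t. F (Complex c t))"
    by (rule continuous_on_compose2[OF assms(2)]) (auto simp: Complex_eq intro!: continuous_intros)
  have "bounded ((\<lambda>t. F (Complex c t)) ` {-y..y})"
    by (intro compact_imp_bounded compact_continuous_image continuous_on_subset[OF cont]) auto
  then obtain B where B: "\<And>t. t \<in> {-y..y} \<Longrightarrow> norm (F (Complex c t)) \<le> B"
    unfolding bounded_iff by blast
  define K' where "K' = max K (B * exp (\<delta> * y))"
  have "norm (F (Complex c t)) \<le> K' * exp (- \<delta> * \<bar>t\<bar>)" for t
  proof (cases "\<bar>t\<bar> \<ge> y")
    case True
    then have "norm (F (Complex c t)) \<le> K * exp (- \<delta> * \<bar>t\<bar>)" using K(2)[of "Complex c t"] by (simp add: y_def)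
    also have "\<dots> \<le> K' * exp (- \<delta> * \<bar>t\<bar>)" by (intro mult_right_mono) (auto simp: K'_def)
    finally show ?thesis .
  next
    case False
    then have "norm (F (Complex c t)) \<le> B" by (intro B) auto
    also have "B \<le> B * (exp (\<delta> * y) * exp (- \<delta> * \<bar>t\<bar>))"
    proof -
      have "B \<ge> 0" using order_trans[OF norm_ge_zero B[of 0]] by (simp add: y_def)
      moreover have "1 \<le> exp (\<delta> * y) * exp (- \<delta> * \<bar>t\<bar>)"
        using False K(1) by (simp add: exp_add[symmetric])
      ultimately show ?thesis using mult_left_mono[of 1 "exp (\<delta> * y) * exp (- \<delta> * \<bar>t\<bar>)" B] by simp
    qed
    also have "\<dots> = (B * exp (\<delta> * y)) * exp (- \<delta> * \<bar>t\<bar>)" by simp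
    also have "\<dots> \<le> K' * exp (- \<delta> * \<bar>t\<bar>)" by (intro mult_right_mono) (auto simp: K'_def)
    finally show ?thesis .
  qed
  with K(1) show ?thesis using that by blast
qed

lemma vline_measurable:
  assumes "continuous_on {s. Re s = c} F"
  shows "(\<lambda>t. F (Complex c t)) \<in> borel_measurable borel"
proof (rule borel_measurable_continuous_onI)
  show "continuous_on UNIV (\<lambda>t. F (Complex c t))"
    by (rule continuous_on_compose2[OF assms]) (auto simp: Complex_eq intro!: continuous_intros)
qed

lemma vdecay_integrable:
  assumes "vdecay F c c" "continuous_on {s. Re s = c} F"
  shows "integrable lborel (\<lambda>t. F (Complex c t))"
proof -
  obtain K \<delta> where K: "\<delta> > 0" "\<And>t. norm (F (Complex c t)) \<le> K * exp (- \<delta> * \<bar>t\<bar>)"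
    using vdecay_dominated[OF assms] by blast
  have "integrable lborel (\<lambda>t. K * exp (- \<delta> * \<bar>t\<bar>))"
    using integrable_exp_abs[OF K(1)] by simp
  then show ?thesis
  proof (rule Bochner_Integration.integrable_bound)
    show "(\<lambda>t. F (Complex c t)) \<in> borel_measurable lborel"
      using vline_measurable[OF assms(2)] by simp
    show "AE t in lborel. norm (F (Complex c t)) \<le> norm (K * exp (- \<delta> * \<bar>t\<bar>))"
      by (rule always_eventually) (use K(2) order_trans abs_ge_self in \<open>fastforce\<close>)
  qed
qed

text \<open>The bridge between Lebesgue integrals over the whole line, used for Fubini and dominated
  convergence, and contour integrals over finite segments.\<close>

lemma integral_symmetric_limit:
  fixes f :: "real \<Rightarrow> complex"
  assumes f: "integrable lborel f"
  shows "(\<lambda>n. integral {- real n..real n} f) \<longlonglongrightarrow> (LINT t|lborel. f t)"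
proof -
  have "(\<lambda>n. LINT t|lborel. indicator {- real n..real n} t *\<^sub>R f t) \<longlonglongrightarrow> (LINT t|lborel. f t)"
  proof (rule integral_dominated_convergence[where w = "\<lambda>t. norm (f t)"])
    show "integrable lborel (\<lambda>t. norm (f t))" using f by simp
    show "AE t in lborel. (\<lambda>n. indicator {- real n..real n} t *\<^sub>R f t) \<longlonglongrightarrow> f t"
    proof (rule always_eventually, rule allI, rule tendsto_eventually)
      fix t :: real
      show "\<forall>\<^sub>F n in sequentially. indicator {- real n..real n} t *\<^sub>R f t = f t"
        using eventually_ge_at_top[of "nat \<lceil>\<bar>t\<bar>\<rceil>"]
        by eventually_elim (auto simp: indicator_def nat_le_iff ceiling_le_iff)
    qed
  qed (use f in \<open>auto simp: indicator_def\<close>)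
  moreover have "(LINT t|lborel. indicator {- real n..real n} t *\<^sub>R f t) = integral {- real n..real n} f" for n
  proof -
    have "set_integrable lborel {- real n..real n} f"
      unfolding set_integrable_def using f by (intro integrable_mult_indicator) auto
    from set_borel_integral_eq_integral(2)[OF this] show ?thesis
      by (simp add: set_lebesgue_integral_def)
  qed
  ultimately show ?thesis by simp
qed

text \<open>Residue theorem on rectangles reaching from height \<open>- n\<close> to
  \<open>n\<close>, whose horizontal sides vanish in the limit. The margins \<open>a' < a\<close>
  and \<open>b < b'\<close> place the closed rectangles inside an open strip.\<close>

lemma vint_shift:
  assumes ab: "a' < a" "a < b" "b < b'"
    and P: "finite P" "\<And>p. p \<in> P \<Longrightarrow> a < Re p \<and> Re p < b"
    and holo: "F holomorphic_on {s. a' < Re s \<and> Re s < b'} - P"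
    and decay: "vdecay F a b"
  shows "vint F b - vint F a = (\<Sum>p\<in>P. residue F p)"
proof -
  define S where "S = {s. a' < Re s \<and> Re s < b'}"
  have S: "open S" "connected S"
  proof -
    have eq: "S = {s. Re s > a'} \<inter> {s. Re s < b'}" by (auto simp: S_def)
    show "open S" unfolding eq by (intro open_Int open_halfspace_Re_gt open_halfspace_Re_lt)
    show "connected S" unfolding eq
      by (intro convex_connected convex_Int convex_halfspace_Re_gt convex_halfspace_Re_lt)
  qed
  have contF: "continuous_on (S - P) F"
    using holo unfolding S_def by (rule holomorphic_on_imp_continuous_on)
  have int: "integrable lborel (\<lambda>t. F (Complex c t))" if "c \<in> {a, b}" for c
  proof (rule vdecay_integrable)
    show "vdecay F c c" using vdecay_mono[OF decay] that ab by auto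
    show "continuous_on {s. Re s = c} F"
      by (rule continuous_on_subset[OF contF]) (use that ab P(2) in \<open>force simp: S_def\<close>)
  qed
  obtain K \<delta> Y where K: "\<delta> > 0"
    "\<And>s. a \<le> Re s \<Longrightarrow> Re s \<le> b \<Longrightarrow> \<bar>Im s\<bar> \<ge> Y \<Longrightarrow> norm (F s) \<le> K * exp (- \<delta> * \<bar>Im s\<bar>)"
    using decay unfolding vdecay_def by blast
  have K0: "K \<ge> 0"
  proof -
    have "0 \<le> norm (F (Complex a \<bar>Y\<bar>))" by simp
    also have "\<dots> \<le> K * exp (- \<delta> * \<bar>Y\<bar>)" using K(2)[of "Complex a \<bar>Y\<bar>"] ab by simp
    finally show ?thesis by (simp add: zero_le_mult_iff)
  qed
  \<comment> \<open>From height \<open>N\<close> on, all poles lie inside the rectangle and the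
    decay bound holds on its horizontal sides.\<close>
  obtain N where N: "\<And>p. p \<in> P \<Longrightarrow> \<bar>Im p\<bar> < real N" "N \<ge> 1" "Y \<le> real N"
  proof -
    obtain M where "\<And>p. p \<in> P \<Longrightarrow> norm p \<le> M"
      using finite_imp_bounded[OF P(1)] unfolding bounded_iff by blast
    then have "\<bar>Im p\<bar> < real (nat \<lceil>max M Y\<rceil> + 1)" if "p \<in> P" for p
      using abs_Im_le_cmod[of p] that real_nat_ceiling_ge[of "max M Y"] by fastforce
    moreover have "Y \<le> real (nat \<lceil>max M Y\<rceil> + 1)" using real_nat_ceiling_ge[of "max M Y"] by simp
    ultimately show ?thesis using that[of "nat \<lceil>max M Y\<rceil> + 1"] by simp
  qed
  define I where "I = (\<lambda>c n. integral {- real n..real n} (\<lambda>t. F (Complex c t)))"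
  define D where "D = 2 * of_real pi * \<i> * (\<Sum>p\<in>P. residue F p)"
  have key: "norm (\<i> * I b n - \<i> * I a n - D) \<le> 2 * ((K * exp (- \<delta> * real n)) * (b - a))" if n: "n \<ge> N" for n
  proof -
    define h where "h = real n"
    have h1: "h \<ge> 1" using n N(2) by (simp add: h_def)
    define a1 where "a1 = Complex a (-h)"
    define a2 where "a2 = Complex b (-h)"
    define a3 where "a3 = Complex b h"
    define a4 where "a4 = Complex a h"
    have box: "cbox a1 a3 \<subseteq> S" using ab by (auto simp: in_cbox_complex_iff a1_def a3_def S_def)
    have Pbox: "p \<in> box a1 a3" if "p \<in> P" for p
      using P(2)[OF that] N(1)[OF that] n by (auto simp: in_box_complex_iff a1_def a3_def h_def)
    have img: "path_image (rectpath a1 a3) \<subseteq> S - P"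
      using Pbox box ab h1 by (subst path_image_rectpath_cbox_minus_box) (auto simp: a1_def a3_def)
    have wind: "winding_number (rectpath a1 a3) p = 1" if "p \<in> P" for p
      by (rule winding_number_rectpath[OF Pbox[OF that]])
    have "contour_integral (rectpath a1 a3) F =
        2 * pi * \<i> * (\<Sum>p\<in>P. winding_number (rectpath a1 a3) p * residue F p)"
    proof (rule Residue_theorem[OF S P(1)])
      show "F holomorphic_on S - P" using holo by (simp add: S_def)
      show "\<forall>z. z \<notin> S \<longrightarrow> winding_number (rectpath a1 a3) z = 0"
        using box ab h1 by (auto intro!: winding_number_rectpath_outside simp: a1_def a3_def)
    qed (use img in auto)
    also have "\<dots> = D" using wind by (simp add: D_def)
    finally have 1: "contour_integral (rectpath a1 a3) F = D" .
    have rp: "rectpath a1 a3 = linepath a1 a2 +++ linepath a2 a3 +++ linepath a3 a4 +++ linepath a4 a1"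
      by (simp add: rectpath_def Let_def a1_def a2_def a3_def a4_def)
    have sub: "closed_segment x y \<subseteq> S - P" if "(x, y) \<in> {(a1,a2),(a2,a3),(a3,a4),(a4,a1)}" for x y
      using img that unfolding rp by (auto simp: path_image_join)
    have ci: "F contour_integrable_on linepath x y" if "(x, y) \<in> {(a1,a2),(a2,a3),(a3,a4),(a4,a1)}" for x y
      by (intro contour_integrable_continuous_linepath continuous_on_subset[OF contF] sub that)
    have "contour_integral (rectpath a1 a3) F = contour_integral (linepath a1 a2) F +
       (contour_integral (linepath a2 a3) F + (contour_integral (linepath a3 a4) F + contour_integral (linepath a4 a1) F))"
      unfolding rp by (simp add: ci contour_integrable_joinI)
    moreover have "contour_integral (linepath a2 a3) F = \<i> * I b n"
      unfolding I_def h_def[symmetric] by (rule contour_integral_linepath_same_Re) (use h1 in \<open>auto simp: a2_def a3_def\<close>)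
    moreover have "contour_integral (linepath a4 a1) F = - contour_integral (linepath a1 a4) F"
    proof (rule contour_integral_reverse_linepath)
      show "continuous_on (closed_segment a4 a1) F"
        by (intro continuous_on_subset[OF contF] sub) auto
    qed
    moreover have "contour_integral (linepath a1 a4) F = \<i> * I a n"
      unfolding I_def h_def[symmetric] by (rule contour_integral_linepath_same_Re) (use h1 in \<open>auto simp: a1_def a4_def\<close>)
    ultimately have eq: "\<i> * I b n - \<i> * I a n - D = - (contour_integral (linepath a1 a2) F + contour_integral (linepath a3 a4) F)"
      using 1 by (simp add: algebra_simps)
    have bnd: "norm (F x) \<le> K * exp (- \<delta> * h)" if "Im x = y" "\<bar>y\<bar> = h" "a \<le> Re x" "Re x \<le> b" for x y
      using K(2)[of x] that h1 n N(3) by (auto simp: h_def)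
    have seg: "Im x = Im p \<and> a \<le> Re x \<and> Re x \<le> b"
      if "x \<in> closed_segment p q" "(p, q) \<in> {(a1,a2),(a3,a4)}" for x p q
    proof -
      have "Im p = Im q" using that(2) by (auto simp: a1_def a2_def a3_def a4_def)
      then have "Im x = Im p \<and> Re x \<in> closed_segment (Re p) (Re q)"
        using that(1) closed_segment_same_Im[of p q] by auto
      then show ?thesis using that(2) ab
        by (auto simp: a1_def a2_def a3_def a4_def closed_segment_eq_real_ivl split: if_splits)
    qed
    have hb: "norm (contour_integral (linepath p q) F) \<le> (K * exp (- \<delta> * h)) * (b - a)"
      if pq: "(p, q) \<in> {(a1,a2),(a3,a4)}" for p q
    proof -
      have "norm (contour_integral (linepath p q) F) \<le> (K * exp (- \<delta> * h)) * norm (q - p)"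
      proof (rule contour_integral_bound_linepath)
        show "F contour_integrable_on linepath p q" using pq by (intro ci) auto
        fix x assume "x \<in> closed_segment p q"
        from seg[OF this pq] show "norm (F x) \<le> K * exp (- \<delta> * h)"
          using pq h1 by (intro bnd[of x "Im p"]) (auto simp: a1_def a3_def)
      qed (use K0 in simp)
      also have "norm (q - p) = b - a"
      proof -
        have "q - p = of_real (b - a) \<or> q - p = - of_real (b - a)"
          using pq by (auto simp: a1_def a2_def a3_def a4_def complex_eq_iff)
        then show ?thesis using ab by (metis abs_of_pos diff_gt_0_iff_gt norm_minus_cancel norm_of_real)
      qed
      finally show ?thesis .
    qed
    have "norm (\<i> * I b n - \<i> * I a n - D) \<le> norm (contour_integral (linepath a1 a2) F) + norm (contour_integral (linepath a3 a4) F)"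
      unfolding eq norm_minus_cancel by (rule norm_triangle_ineq)
    also have "\<dots> \<le> 2 * ((K * exp (- \<delta> * real n)) * (b - a))"
      using hb[of a1 a2] hb[of a3 a4] by (simp add: h_def)
    finally show ?thesis .
  qed
  have "(\<lambda>n. \<i> * I b n - \<i> * I a n - D) \<longlonglongrightarrow> 0"
  proof (rule Lim_null_comparison)
    show "\<forall>\<^sub>F n in sequentially. norm (\<i> * I b n - \<i> * I a n - D) \<le> 2 * ((K * exp (- \<delta> * real n)) * (b - a))"
      using eventually_ge_at_top[of N] by eventually_elim (rule key)
    have "(\<lambda>n. exp (- \<delta> * real n)) \<longlonglongrightarrow> 0" using K(1) by real_asymp
    then have "(\<lambda>n. 2 * ((K * exp (- \<delta> * real n)) * (b - a))) \<longlonglongrightarrow> 2 * ((K * 0) * (b - a))"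
      by (intro tendsto_intros)
    then show "(\<lambda>n. 2 * ((K * exp (- \<delta> * real n)) * (b - a))) \<longlonglongrightarrow> 0" by simp
  qed
  moreover have "(\<lambda>n. \<i> * I b n - \<i> * I a n - D) \<longlonglongrightarrow>
      \<i> * (LINT t|lborel. F (Complex b t)) - \<i> * (LINT t|lborel. F (Complex a t)) - D"
    unfolding I_def using int by (intro tendsto_intros integral_symmetric_limit) auto
  ultimately have "\<i> * (LINT t|lborel. F (Complex b t)) - \<i> * (LINT t|lborel. F (Complex a t)) - D = 0"
    using LIMSEQ_unique by blast
  then have "\<i> * ((LINT t|lborel. F (Complex b t)) - (LINT t|lborel. F (Complex a t))) = \<i> * (2 * of_real pi * (\<Sum>p\<in>P. residue F p))"
    by (simp add: D_def algebra_simps)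
  then have "(LINT t|lborel. F (Complex b t)) - (LINT t|lborel. F (Complex a t)) = 2 * of_real pi * (\<Sum>p\<in>P. residue F p)"
    by simp
  then show ?thesis by (simp add: vint_def diff_divide_distrib[symmetric])
qed


section \<open>The exponential kernel: decay, residues and shifts\<close>

text \<open>The exponential obeys simple laws: replacing \<open>v\<close> by \<open>v + 1\<close>
  multiplies the kernel by \<open>- exp (\<i> * z)\<close>, and a factor
  \<open>exp (- y * v)\<close> replaces \<open>z\<close> by \<open>z + \<i> * y\<close>. The price
  is a pole at 0, where the sine kernel has none.\<close>

definition ker :: "complex \<Rightarrow> complex \<Rightarrow> complex" where
  "ker z v = exp (\<i> * z * v) / sin (of_real pi * v)"

definition polyb :: "(complex \<Rightarrow> complex) \<Rightarrow> real \<Rightarrow> real \<Rightarrow> bool" where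
  "polyb G a b \<longleftrightarrow> (\<exists>D k. \<forall>v. a \<le> Re v \<and> Re v \<le> b \<longrightarrow> norm (G v) \<le> D * (1 + norm v) ^ k)"

lemma polyb_bounded: "(\<And>v. a \<le> Re v \<Longrightarrow> Re v \<le> b \<Longrightarrow> norm (G v) \<le> D) \<Longrightarrow> polyb G a b"
  unfolding polyb_def by (rule exI[of _ D], rule exI[of _ 0]) auto

lemma polyb_const: "polyb (\<lambda>_. c) a b"
  by (rule polyb_bounded) (rule order_refl)

lemma norm_ge_Re_diff: "Re v - Re p \<le> norm (v - p)"
  using abs_Re_le_cmod[of "v - p"] by simp

lemma polyb_inverse:
  assumes "Re p < a" shows "polyb (\<lambda>v. 1 / (v - p)) a b"
proof (rule polyb_bounded)
  fix v assume "a \<le> Re v"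
  then have "a - Re p \<le> norm (v - p)" using norm_ge_Re_diff[of v p] by linarith
  then show "norm (1 / (v - p)) \<le> 1 / (a - Re p)"
    using assms by (simp add: norm_divide frac_le)
qed

lemma sin_pi_eq_0_iff: "sin (of_real pi * v) = 0 \<longleftrightarrow> (\<exists>n::int. v = of_int n)" for v :: complex
proof
  assume "sin (of_real pi * v) = 0"
  then obtain n :: int where "of_real pi * v = of_real (of_int n * pi)" unfolding sin_eq_0 by blast
  then have "of_real pi * v = of_real pi * of_int n" by (simp add: mult.commute)
  then show "\<exists>n::int. v = of_int n" by auto
next
  assume "\<exists>n::int. v = of_int n"
  then obtain n :: int where "v = of_int n" ..
  then have "of_real pi * v = of_real (of_int n * pi)" by simp
  then show "sin (of_real pi * v) = 0" unfolding sin_eq_0 by blast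
qed

lemma norm_sin_pi_ge:
  assumes "\<bar>Im v\<bar> \<ge> 1"
  shows "exp (pi * \<bar>Im v\<bar>) / 4 \<le> norm (sin (of_real pi * v))"
proof -
  define w where "w = of_real pi * v"
  define y where "y = Im w"
  have y: "\<bar>y\<bar> = pi * \<bar>Im v\<bar>" by (simp add: y_def w_def abs_mult)
  have "sin w = (exp (\<i> * w) - exp (- (\<i> * w))) / (2 * \<i>)" by (rule sin_exp_eq)
  then have "norm (sin w) = norm (exp (\<i> * w) - exp (- (\<i> * w))) / 2"
    by (simp only: norm_divide norm_mult) simp
  moreover have "\<bar>exp (- y) - exp y\<bar> \<le> norm (exp (\<i> * w) - exp (- (\<i> * w)))"
    using norm_triangle_ineq3[of "exp (\<i> * w)" "exp (- (\<i> * w))"] by (simp add: y_def)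
  moreover have "exp \<bar>y\<bar> - exp (- \<bar>y\<bar>) = \<bar>exp (- y) - exp y\<bar>" by (cases "y \<ge> 0") auto
  moreover have "exp (- \<bar>y\<bar>) \<le> exp \<bar>y\<bar> / 2"
  proof -
    have "1 \<le> \<bar>y\<bar>" using assms pi_gt3 mult_mono[of 1 pi 1 "\<bar>Im v\<bar>"] unfolding y by simp
    then have "2 \<le> exp \<bar>y\<bar>" using exp_ge_add_one_self[of "\<bar>y\<bar>"] by linarith
    moreover have "exp (- \<bar>y\<bar>) \<le> 1" by simp
    ultimately show ?thesis by linarith
  qed
  ultimately show ?thesis by (simp add: y w_def)
qed

lemma one_plus_power_le_exp:
  assumes "\<delta> > 0"
  obtains K where "K > 0" "\<And>x::real. x \<ge> 0 \<Longrightarrow> (1 + x) ^ k \<le> K * exp (\<delta> * x)"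
proof -
  \<comment> \<open>The exponent \<open>Suc k\<close> keeps the quotient meaningful for
    \<open>k = 0\<close>; raising the power is harmless because
    \<open>1 + x \<ge> 1\<close>.\<close>
  define e where "e = \<delta> / real (Suc k)"
  have e: "e > 0" using assms by (simp add: e_def)
  have "(1 + x) ^ k \<le> (exp e / e) ^ Suc k * exp (\<delta> * x)" if x: "x \<ge> 0" for x
  proof -
    have "(1 + x) ^ k \<le> (1 + x) ^ Suc k" using x by (intro power_increasing) auto
    also have "1 + x \<le> exp (e * (1 + x)) / e"
    proof -
      have "e * (1 + x) \<le> exp (e * (1 + x))" using exp_ge_add_one_self[of "e * (1 + x)"] by linarith
      then show ?thesis using e by (simp add: pos_le_divide_eq mult.commute)
    qed
    then have "(1 + x) ^ Suc k \<le> (exp (e * (1 + x)) / e) ^ Suc k" using x by (intro power_mono) auto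
    also have "exp (e * (1 + x)) / e = exp e / e * exp (e * x)" by (simp add: exp_add[symmetric] algebra_simps)
    also have "(exp e / e * exp (e * x)) ^ Suc k = (exp e / e) ^ Suc k * exp (real (Suc k) * (e * x))"
      by (simp only: power_mult_distrib exp_of_nat_mult)
    also have "real (Suc k) * (e * x) = \<delta> * x" by (simp add: e_def del: of_nat_Suc)
    finally show ?thesis .
  qed
  moreover have "(exp e / e) ^ Suc k > 0" using e by simp
  ultimately show ?thesis using that by blast
qed

text \<open>The numerator grows at most like
  \<open>exp (\<bar>Re z\<bar> * \<bar>Im v\<bar>)\<close>, the sine at least like
  \<open>exp (pi * \<bar>Im v\<bar>)\<close>. The gap between the two rates is
  \<open>2 * \<delta>\<close>: one half absorbs the polynomial, the other remains as decay.\<close>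

lemma vdecay_ker_times:
  assumes z: "\<bar>Re z\<bar> < pi" and G: "polyb G a b"
  shows "vdecay (\<lambda>v. ker z v * G v) a b"
proof -
  obtain D k where D: "\<And>v. a \<le> Re v \<Longrightarrow> Re v \<le> b \<Longrightarrow> norm (G v) \<le> D * (1 + norm v) ^ k"
    using G unfolding polyb_def by blast
  define M where "M = max \<bar>a\<bar> \<bar>b\<bar>"
  define \<delta> where "\<delta> = (pi - \<bar>Re z\<bar>) / 2"
  have \<delta>: "\<delta> > 0" using z by (simp add: \<delta>_def)
  obtain K where K: "K > 0" "\<And>x::real. x \<ge> 0 \<Longrightarrow> (1 + x) ^ k \<le> K * exp (\<delta> * x)"
    using one_plus_power_le_exp[OF \<delta>] by blast
  have "norm (ker z v * G v) \<le> (4 * exp (\<bar>Im z\<bar> * M) * (\<bar>D\<bar> * K * exp (\<delta> * M))) * exp (- \<delta> * \<bar>Im v\<bar>)"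
    if v: "a \<le> Re v" "Re v \<le> b" "\<bar>Im v\<bar> \<ge> 1" for v
  proof -
    have rv: "\<bar>Re v\<bar> \<le> M" using v by (auto simp: M_def)
    have "- (Re z * Im v + Im z * Re v) \<le> \<bar>Re z\<bar> * \<bar>Im v\<bar> + \<bar>Im z\<bar> * \<bar>Re v\<bar>"
      using abs_ge_minus_self[of "Re z * Im v"] abs_ge_minus_self[of "Im z * Re v"]
      unfolding abs_mult by linarith
    also have "\<dots> \<le> \<bar>Re z\<bar> * \<bar>Im v\<bar> + \<bar>Im z\<bar> * M" using rv by (intro add_left_mono mult_left_mono) auto
    finally have "norm (exp (\<i> * z * v)) \<le> exp (\<bar>Re z\<bar> * \<bar>Im v\<bar> + \<bar>Im z\<bar> * M)"
      by (simp add: algebra_simps)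
    then have "norm (ker z v) \<le> exp (\<bar>Re z\<bar> * \<bar>Im v\<bar> + \<bar>Im z\<bar> * M) / (exp (pi * \<bar>Im v\<bar>) / 4)"
      unfolding ker_def norm_divide using norm_sin_pi_ge[OF v(3)] by (intro frac_le) auto
    also have "\<dots> = 4 * exp (\<bar>Im z\<bar> * M) * exp (- 2 * \<delta> * \<bar>Im v\<bar>)"
    proof -
      have "\<bar>Re z\<bar> * \<bar>Im v\<bar> + \<bar>Im z\<bar> * M - pi * \<bar>Im v\<bar> = \<bar>Im z\<bar> * M + - 2 * \<delta> * \<bar>Im v\<bar>"
        by (simp add: \<delta>_def field_simps)
      moreover have "exp A / (exp B / 4) = 4 * exp (A - B)" for A B :: real by (simp add: exp_diff)
      ultimately have "exp (\<bar>Re z\<bar> * \<bar>Im v\<bar> + \<bar>Im z\<bar> * M) / (exp (pi * \<bar>Im v\<bar>) / 4) =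
          4 * exp (\<bar>Im z\<bar> * M + - 2 * \<delta> * \<bar>Im v\<bar>)" by metis
      then show ?thesis by (simp only: exp_add[of "\<bar>Im z\<bar> * M"] mult.assoc)
    qed
    finally have 1: "norm (ker z v) \<le> 4 * exp (\<bar>Im z\<bar> * M) * exp (- 2 * \<delta> * \<bar>Im v\<bar>)" .
    have "norm (G v) \<le> \<bar>D\<bar> * (1 + norm v) ^ k"
      using D[OF v(1,2)] by (rule order_trans) (auto intro!: mult_right_mono)
    also have "\<dots> \<le> \<bar>D\<bar> * (K * exp (\<delta> * norm v))" using K by (intro mult_left_mono) auto
    also have "\<dots> \<le> \<bar>D\<bar> * (K * exp (\<delta> * (M + \<bar>Im v\<bar>)))"
      using K \<delta> rv cmod_le[of v] by (intro mult_left_mono) auto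
    finally have 2: "norm (G v) \<le> \<bar>D\<bar> * K * exp (\<delta> * M) * exp (\<delta> * \<bar>Im v\<bar>)"
      by (simp add: exp_add ring_distribs mult_ac)
    have "norm (ker z v * G v) \<le> (4 * exp (\<bar>Im z\<bar> * M) * exp (- 2 * \<delta> * \<bar>Im v\<bar>)) * (\<bar>D\<bar> * K * exp (\<delta> * M) * exp (\<delta> * \<bar>Im v\<bar>))"
      unfolding norm_mult using 1 2 by (intro mult_mono) auto
    also have "\<dots> = (4 * exp (\<bar>Im z\<bar> * M) * (\<bar>D\<bar> * K * exp (\<delta> * M))) * (exp (- 2 * \<delta> * \<bar>Im v\<bar>) * exp (\<delta> * \<bar>Im v\<bar>))"
      by (simp add: mult_ac)
    also have "exp (- 2 * \<delta> * \<bar>Im v\<bar>) * exp (\<delta> * \<bar>Im v\<bar>) = exp (- \<delta> * \<bar>Im v\<bar>)"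
      by (simp add: exp_add[symmetric])
    finally show ?thesis .
  qed
  then show ?thesis using \<delta> unfolding vdecay_def by blast
qed

lemma ker_shift: "ker z (v + 1) = - exp (\<i> * z) * ker z v"
proof -
  have "sin (of_real pi * (v + 1)) = - sin (of_real pi * v)"
    by (simp add: distrib_left sin_add)
  then show ?thesis by (simp add: ker_def distrib_left exp_add)
qed

lemma ker_holomorphic:
  assumes "\<And>n::int. of_int n \<notin> S"
  shows "ker z holomorphic_on S"
  unfolding ker_def by (intro holomorphic_intros) (use assms in \<open>auto simp: sin_pi_eq_0_iff\<close>)

lemma open_vstrip: "open {s. a < Re s \<and> Re s < b}"
  by (intro open_Collect_conj open_halfspace_Re_lt open_halfspace_Re_gt)

text \<open>The sine has a simple zero at \<open>n\<close> with derivative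
  \<open>pi * (-1) ^ n\<close>, whose reciprocal is the residue of the inverse sine.\<close>

lemma residue_ker_times:
  assumes G: "G holomorphic_on S" and S: "open S" "of_nat n \<in> S"
  shows "residue (\<lambda>v. ker z v * G v) (of_nat n) = (-1) ^ n * exp (\<i> * z * of_nat n) * G (of_nat n) / of_real pi"
proof -
  define T where "T = ball (of_nat n :: complex) 1 \<inter> S"
  have cos: "cos (of_real pi * of_nat n) = (-1 :: complex) ^ n"
    using cos_npi_complex'[of n] by (simp add: mult.commute)
  have sin: "sin (of_real pi * of_nat n) = (0 :: complex)"
    using sin_pi_eq_0_iff[of "of_nat n"] by (metis of_int_of_nat_eq)
  have "((\<lambda>v::complex. sin (of_real pi * v)) has_field_derivative of_real pi * (-1) ^ n) (at (of_nat n))"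
    by (rule derivative_eq_intros refl)+ (simp add: cos)
  then have "((\<lambda>v::complex. sin (of_real pi * v) / (v - of_nat n)) \<longlongrightarrow> of_real pi * (-1) ^ n) (at (of_nat n))"
    by (simp add: has_field_derivative_iff sin)
  then have "((\<lambda>v::complex. inverse (sin (of_real pi * v) / (v - of_nat n))) \<longlongrightarrow> inverse (of_real pi * (-1) ^ n)) (at (of_nat n))"
    by (rule tendsto_inverse) simp
  note sin_lim = this
  have "((\<lambda>v. exp (\<i> * z * v) * G v) \<longlongrightarrow> exp (\<i> * z * of_nat n) * G (of_nat n)) (at (of_nat n))"
  proof -
    have "isCont G (of_nat n)"
      using G S holomorphic_on_imp_continuous_on continuous_on_eq_continuous_at by blast
    then have "isCont (\<lambda>v. exp (\<i> * z * v) * G v) (of_nat n)" by (intro continuous_intros)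
    then show ?thesis by (simp only: isCont_def)
  qed
  from tendsto_mult[OF this sin_lim] have lim: "((\<lambda>v. (exp (\<i> * z * v) * G v) * inverse (sin (of_real pi * v) / (v - of_nat n)))
      \<longlongrightarrow> (exp (\<i> * z * of_nat n) * G (of_nat n)) * inverse (of_real pi * (-1) ^ n)) (at (of_nat n))" .
  show ?thesis
  proof (rule residue_simple'[of T])
    show "open T" "of_nat n \<in> T" using S by (auto simp: T_def)
    have "k = n" if "dist (of_nat n) (of_int k :: complex) < 1" for k :: int
    proof -
      have "norm (of_int (int n - k) :: complex) < 1" using that by (simp add: dist_norm)
      then have "\<bar>real_of_int (int n - k)\<bar> < 1" by (simp only: norm_of_int)
      then show ?thesis by linarith
    qed
    note kn = this
    have "ker z holomorphic_on (T - {of_nat n})"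
    proof (rule ker_holomorphic)
      fix k :: int
      show "of_int k \<notin> T - {of_nat n}" using kn[of k] by (auto simp: T_def)
    qed
    moreover have "G holomorphic_on (T - {of_nat n})"
      using G by (rule holomorphic_on_subset) (auto simp: T_def)
    ultimately show "(\<lambda>v. ker z v * G v) holomorphic_on (T - {of_nat n})"
      by (intro holomorphic_intros)
    have "(exp (\<i> * z * of_nat n) * G (of_nat n)) * inverse (of_real pi * (-1) ^ n) =
        (-1) ^ n * exp (\<i> * z * of_nat n) * G (of_nat n) / of_real pi"
      by (cases "even n") (auto simp: field_simps)
    moreover have "(exp (\<i> * z * w) * G w) * inverse (sin (of_real pi * w) / (w - of_nat n)) = ker z w * G w * (w - of_nat n)" for w
      by (simp add: ker_def divide_inverse mult_ac)
    ultimately show "((\<lambda>w. ker z w * G w * (w - of_nat n)) \<longlongrightarrow>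
        (-1) ^ n * exp (\<i> * z * of_nat n) * G (of_nat n) / of_real pi) (at (of_nat n))"
      using lim by (simp only:)
  qed
qed

lemma ker_line_continuous:
  assumes "c \<notin> \<int>" shows "continuous_on {s. Re s = c} (ker z)"
proof -
  have "sin (of_real pi * v) \<noteq> 0" if "Re v = c" for v :: complex
    using that assms by (auto simp: sin_pi_eq_0_iff)
  then show ?thesis unfolding ker_def by (intro continuous_intros) auto
qed

lemma ker_line_integrable:
  assumes "\<bar>Re z\<bar> < pi" "polyb G c c" "c \<notin> \<int>" "continuous_on {s. Re s = c} G"
  shows "integrable lborel (\<lambda>t. ker z (Complex c t) * G (Complex c t))"
  using vdecay_integrable[OF vdecay_ker_times[OF assms(1,2)]] assms(4) ker_line_continuous[OF assms(3)]
  by (auto intro: continuous_on_mult)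

lemma vint_ker_shift:
  assumes z: "\<bar>Re z\<bar> < pi" and ab: "a' < a" "a < b" "b < b'"
    and P: "finite P" "\<And>n. n \<in> P \<Longrightarrow> a < real n \<and> real n < b"
      "\<And>n::int. a' < of_int n \<Longrightarrow> of_int n < b' \<Longrightarrow> n \<in> int ` P"
    and G: "G holomorphic_on {s. a' < Re s \<and> Re s < b'}" "polyb G a b"
  shows "vint (\<lambda>v. ker z v * G v) b - vint (\<lambda>v. ker z v * G v) a =
    (\<Sum>n\<in>P. (-1) ^ n * exp (\<i> * z * of_nat n) * G (of_nat n) / of_real pi)"
proof -
  have "vint (\<lambda>v. ker z v * G v) b - vint (\<lambda>v. ker z v * G v) a =
    (\<Sum>p\<in>of_nat ` P. residue (\<lambda>v. ker z v * G v) p)"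
  proof (rule vint_shift[OF ab])
    show "vdecay (\<lambda>v. ker z v * G v) a b" by (rule vdecay_ker_times[OF z G(2)])
    have "ker z holomorphic_on {s. a' < Re s \<and> Re s < b'} - of_nat ` P"
    proof (rule ker_holomorphic)
      fix n :: int
      show "of_int n \<notin> {s. a' < Re s \<and> Re s < b'} - of_nat ` P"
        using P(3)[of n] by force
    qed
    moreover have "G holomorphic_on {s. a' < Re s \<and> Re s < b'} - of_nat ` P"
      using G(1) by (rule holomorphic_on_subset) auto
    ultimately show "(\<lambda>v. ker z v * G v) holomorphic_on {s. a' < Re s \<and> Re s < b'} - of_nat ` P"
      by (intro holomorphic_intros)
  qed (use P in auto)
  also have "\<dots> = (\<Sum>n\<in>P. residue (\<lambda>v. ker z v * G v) (of_nat n))"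
    by (subst sum.reindex) (auto intro: inj_onI)
  also have "\<dots> = (\<Sum>n\<in>P. (-1) ^ n * exp (\<i> * z * of_nat n) * G (of_nat n) / of_real pi)"
    using P(2) ab by (intro sum.cong residue_ker_times[OF G(1) open_vstrip] refl) force
  finally show ?thesis .
qed

lemma exp_ne_minus_one:
  assumes "\<bar>Re z\<bar> < pi" shows "1 + exp (\<i> * z) \<noteq> 0"
proof
  assume "1 + exp (\<i> * z) = 0"
  then have "exp (\<i> * z) = exp (\<i> * of_real pi)" by (simp add: add_eq_0_iff exp_pi_i')
  then obtain n :: int where "\<i> * z = \<i> * of_real pi + of_int (2 * n) * of_real pi * \<i>"
    unfolding exp_eq by auto
  then have "z = of_real (pi + of_int (2 * n) * pi)"
    by (simp add: complex_eq_iff)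
  then have "\<bar>pi * (1 + 2 * of_int n)\<bar> < pi * 1" using assms by (simp add: algebra_simps)
  then have "\<bar>1 + 2 * of_int n :: real\<bar> < 1" using pi_gt_zero by (simp add: abs_mult)
  then have "real_of_int \<bar>1 + 2 * n\<bar> < 1" by simp
  then have "\<bar>1 + 2 * n\<bar> < 1" by linarith
  then show False by presburger
qed

text \<open>Shifting the line by 1 multiplies the integral by \<open>- exp (\<i> * z)\<close> and
  crosses only the pole at 1. The resulting linear equation has the coefficient
  \<open>1 + exp (\<i> * z)\<close>, which is nonzero for these \<open>z\<close>.\<close>

lemma vint_ker:
  assumes z: "\<bar>Re z\<bar> < pi" and c: "0 < c" "c < 1"
  shows "vint (ker z) c = exp (\<i> * z) / (of_real pi * (1 + exp (\<i> * z)))"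
proof -
  have "vint (\<lambda>v. ker z v * 1) (c + 1) - vint (\<lambda>v. ker z v * 1) c =
    (\<Sum>n\<in>{1}. (-1) ^ n * exp (\<i> * z * of_nat n) * 1 / of_real pi)"
  proof (rule vint_ker_shift[OF z, where a' = 0 and b' = 2])
    fix n :: int assume "0 < real_of_int n" "real_of_int n < 2"
    then have "n = 1" by linarith
    then show "n \<in> int ` {1}" by simp
  qed (use c in \<open>auto intro!: polyb_const\<close>)
  moreover have "vint (ker z) (c + 1) = - exp (\<i> * z) * vint (ker z) c"
  proof -
    have "ker z (Complex (c + 1) t) = - exp (\<i> * z) * ker z (Complex c t)" for t
      using ker_shift[of z "Complex c t"] by (simp add: complex_eq_iff plus_complex.ctr one_complex.ctr)
    then show ?thesis by (simp add: vint_def)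
  qed
  ultimately have eq: "- exp (\<i> * z) * vint (ker z) c - vint (ker z) c = - (exp (\<i> * z) / of_real pi)"
    by simp
  have "(1 + exp (\<i> * z)) * vint (ker z) c = - (- exp (\<i> * z) * vint (ker z) c - vint (ker z) c)"
    by (simp add: algebra_simps)
  also have "\<dots> = exp (\<i> * z) / of_real pi" unfolding eq by simp
  finally have "vint (ker z) c * (1 + exp (\<i> * z)) = exp (\<i> * z) / of_real pi" by (simp only: mult.commute)
  then have "vint (ker z) c = exp (\<i> * z) / of_real pi / (1 + exp (\<i> * z))"
    by (simp only: nonzero_eq_divide_eq[OF exp_ne_minus_one[OF z]])
  then show ?thesis by (simp only: divide_divide_eq_left)
qed

section \<open>Kernel integrals of simple fractions\<close>

lemma integral_halfline_FTC:
  fixes f A :: "real \<Rightarrow> complex"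
  assumes A: "\<And>y. y \<ge> 0 \<Longrightarrow> (A has_vector_derivative f y) (at y)"
    and f: "integrable lborel (\<lambda>y. indicator {0..} y *\<^sub>R f y)"
    and lim: "(\<lambda>n. A (real n)) \<longlonglongrightarrow> L"
  shows "(LINT y|lborel. indicator {0..} y *\<^sub>R f y) = L - A 0"
proof -
  have "(\<lambda>n. integral {- real n..real n} (\<lambda>y. indicator {0..} y *\<^sub>R f y)) \<longlonglongrightarrow> (LINT y|lborel. indicator {0..} y *\<^sub>R f y)"
    by (rule integral_symmetric_limit[OF f])
  moreover have "integral {- real n..real n} (\<lambda>y. indicator {0..} y *\<^sub>R f y) = A (real n) - A 0" for n
  proof -
    have "(f has_integral A (real n) - A 0) {0..real n}"
    proof (rule fundamental_theorem_of_calculus)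
      fix y assume "y \<in> {0..real n}"
      then have "(A has_vector_derivative f y) (at y)" by (intro A) auto
      then show "(A has_vector_derivative f y) (at y within {0..real n})"
        by (rule has_vector_derivative_at_within)
    qed simp
    then have "((\<lambda>y. if y \<in> {0..real n} then f y else 0) has_integral A (real n) - A 0) {- real n..real n}"
      by (subst has_integral_restrict) auto
    then have "((\<lambda>y. indicator {0..} y *\<^sub>R f y) has_integral A (real n) - A 0) {- real n..real n}"
      by (rule has_integral_eq[rotated]) auto
    then show ?thesis by (rule integral_unique)
  qed
  ultimately have "(\<lambda>n. A (real n) - A 0) \<longlonglongrightarrow> (LINT y|lborel. indicator {0..} y *\<^sub>R f y)" by simp
  moreover have "(\<lambda>n. A (real n) - A 0) \<longlonglongrightarrow> L - A 0" using lim by (intro tendsto_intros)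
  ultimately show ?thesis by (rule LIMSEQ_unique)
qed

lemma integrable_exp_halfline:
  assumes "Re a > 0" shows "integrable lborel (\<lambda>y. indicator {0..} y *\<^sub>R exp (- (of_real y * a)))"
proof -
  have "integrable lborel (\<lambda>y. exp (- Re a * \<bar>y\<bar>))" by (rule integrable_exp_abs[OF assms])
  then show ?thesis
    by (rule Bochner_Integration.integrable_bound) (auto simp: indicator_def mult.commute)
qed

lemma exp_minus_nat_tendsto_0:
  assumes "Re a > 0" shows "(\<lambda>n. exp (- (of_real (real n) * a))) \<longlonglongrightarrow> (0::complex)"
proof (rule tendsto_norm_zero_cancel)
  have "(\<lambda>n. exp (- (real n * Re a))) \<longlonglongrightarrow> 0" using assms by real_asymp
  then show "(\<lambda>n. norm (exp (- (of_real (real n) * a)))) \<longlonglongrightarrow> 0" by simp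
qed

lemma integral_exp_halfline:
  assumes a: "Re a > 0"
  shows "(LINT y|lborel. indicator {0..} y *\<^sub>R exp (- (of_real y * a))) = 1 / a"
proof -
  have a0: "a \<noteq> 0" using a by auto
  define A where "A = (\<lambda>y. - exp (- (of_real y * a)) / a)"
  have "(LINT y|lborel. indicator {0..} y *\<^sub>R exp (- (of_real y * a))) = 0 - A 0"
  proof (rule integral_halfline_FTC)
    fix y :: real
    have "((\<lambda>x. - exp (- (x * a)) / a) has_field_derivative exp (- (of_real y * a))) (at (of_real y))"
      using a0 by (auto intro!: derivative_eq_intros)
    then show "(A has_vector_derivative exp (- (of_real y * a))) (at y)"
      unfolding A_def by (rule has_vector_derivative_real_field)
    have "(\<lambda>n. - exp (- (of_real (real n) * a)) / a) \<longlonglongrightarrow> - 0 / a"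
      by (intro tendsto_intros exp_minus_nat_tendsto_0 a a0)
    then show "(\<lambda>n. A (real n)) \<longlonglongrightarrow> 0" by (simp add: A_def)
  qed (rule integrable_exp_halfline[OF a])
  then show ?thesis by (simp add: A_def)
qed

text \<open>Keeps \<open>Arctan\<close> away from its branch cuts, on the imaginary axis, both in
  the integration over the ray and in the passage to \<open>Ln\<close> in
  \<open>Arctan_exp\<close>.\<close>

lemma exp_half_Re_pos:
  assumes "\<bar>Re z\<bar> < pi" shows "Re (exp (\<i> * z / 2)) > 0"
proof -
  have "cos (Re z / 2) > 0" using assms by (intro cos_gt_zero_pi) auto
  then show ?thesis by (simp add: Re_exp)
qed

text \<open>Writing \<open>1 / (v + 1/2)\<close> as a Laplace integral turns the kernel integral into the integral of
  \<open>vint_ker\<close> along the vertical ray from \<open>z\<close>.\<close>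
lemma vint_ker_plus_half:
  assumes z: "\<bar>Re z\<bar> < pi" and c: "0 < c" "c < 1"
  shows "vint (\<lambda>v. ker z v * (1 / (v + 1/2))) c = 2 / of_real pi * (1 - Arctan (exp (\<i> * z / 2)) / exp (\<i> * z / 2))"
proof -
  define u where "u = exp (\<i> * z / 2)"
  have u: "Re u > 0" using exp_half_Re_pos[OF z] by (simp add: u_def)
  then have u0: "u \<noteq> 0" by auto
  have cZ: "c \<notin> \<int>" using c by (auto elim!: Ints_cases)
  define f where "f = (\<lambda>t y. ker z (Complex c t) * (indicator {0..} y *\<^sub>R exp (- (of_real y * (Complex c t + 1/2)))))"
  have pos: "Re (Complex c t + 1/2) > 0" for t using c by simp
  have ker_int: "integrable lborel (\<lambda>t. ker z (Complex c t))"
    using ker_line_integrable[OF z polyb_const cZ, of 1] by (simp add: continuous_on_const)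
  have fint: "integrable (lborel \<Otimes>\<^sub>M lborel) (case_prod f)"
  proof (rule lborel_pair.Fubini_integrable)
    have "(\<lambda>t. ker z (Complex c t)) \<in> borel_measurable borel"
      using ker_int by simp
    then show "case_prod f \<in> borel_measurable (lborel \<Otimes>\<^sub>M lborel)"
      unfolding f_def split_beta' Complex_eq by measurable
    have nf: "norm (f t y) = norm (ker z (Complex c t)) * (indicator {0..} y * exp (- (y * (c + 1/2))))" for t y
      by (simp add: f_def norm_mult indicator_def)
    have "Re (complex_of_real (c + 1/2)) > 0" using c by simp
    from integrable_exp_halfline[OF this]
    have "integrable lborel (\<lambda>y. norm (indicator {0..} y *\<^sub>R exp (- (of_real y * complex_of_real (c + 1/2)))))"
      by (rule integrable_norm)
    show "integrable lborel (\<lambda>t. LINT y|lborel. norm (case (t, y) of (t, y) \<Rightarrow> f t y))"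
      using ker_int by (simp add: nf)
    show "AE t in lborel. integrable lborel (\<lambda>y. case (t, y) of (t, y) \<Rightarrow> f t y)"
      unfolding f_def prod.case
      by (rule always_eventually, rule allI, rule Bochner_Integration.integrable_mult_right, rule integrable_exp_halfline[OF pos])
  qed
  have inner: "(LINT t|lborel. f t y) = indicator {0..} y *\<^sub>R
      (2 * of_real pi * (exp (- (of_real y / 2)) * (exp (\<i> * z - of_real y) / (of_real pi * (1 + exp (\<i> * z - of_real y))))))" for y
  proof -
    \<comment> \<open>The factor \<open>exp (- y * v)\<close> moves \<open>z\<close> vertically. The
      real part is unchanged, so \<open>vint_ker\<close> applies again.\<close>
    define z' where "z' = z + \<i> * of_real y"
    have z': "\<bar>Re z'\<bar> < pi" using z by (simp add: z'_def)
    have "f t y = (indicator {0..} y *\<^sub>R exp (- (of_real y / 2))) * ker z' (Complex c t)" for t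
    proof -
      have "exp (\<i> * z' * Complex c t) * exp (- (of_real y / 2)) = exp (\<i> * z * Complex c t) * exp (- (of_real y * (Complex c t + 1/2)))"
        by (simp add: z'_def exp_add[symmetric] algebra_simps)
      then show ?thesis by (simp add: f_def ker_def divide_simps mult_ac)
    qed
    then have "(LINT t|lborel. f t y) = (indicator {0..} y *\<^sub>R exp (- (of_real y / 2))) * (2 * of_real pi * vint (ker z') c)"
      by (simp add: vint_def)
    moreover have "\<i> * z' = \<i> * z - of_real y" by (simp add: z'_def algebra_simps)
    ultimately show "(LINT t|lborel. f t y) = indicator {0..} y *\<^sub>R
      (2 * of_real pi * (exp (- (of_real y / 2)) * (exp (\<i> * z - of_real y) / (of_real pi * (1 + exp (\<i> * z - of_real y))))))"
      unfolding vint_ker[OF z' c] by (cases "y \<in> {0..}") (simp_all add: mult_ac)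
  qed
  have "(LINT t|lborel. ker z (Complex c t) * (1 / (Complex c t + 1/2))) = (LINT t|lborel. LINT y|lborel. f t y)"
    unfolding f_def by (simp only: integral_mult_right_zero integral_exp_halfline[OF pos])
  also have "\<dots> = (LINT y|lborel. LINT t|lborel. f t y)"
    by (rule lborel_pair.Fubini_integral[OF fint, symmetric])
  also have "\<dots> = (LINT y|lborel. indicator {0..} y *\<^sub>R
      (2 * of_real pi * (exp (- (of_real y / 2)) * (exp (\<i> * z - of_real y) / (of_real pi * (1 + exp (\<i> * z - of_real y)))))))"
    by (simp only: inner)
  \<comment> \<open>With \<open>r = u * exp (- y / 2)\<close> the integrand is
    \<open>2 * exp (- y / 2) * r^2 / (1 + r^2)\<close>, which has the antiderivative
    \<open>- 4 / u * (r - Arctan r)\<close>. Here \<open>r\<close> runs from \<open>u\<close> at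
    \<open>y = 0\<close> to 0 at infinity.\<close>
  also have "\<dots> = 0 - (- 4 / u * (u * exp (- (of_real 0 / 2)) - Arctan (u * exp (- (of_real 0 / 2)))))"
  proof (rule integral_halfline_FTC)
    fix y :: real assume "y \<ge> 0"
    define r where "r = u * exp (- (of_real y / 2))"
    have r2: "exp (\<i> * z - of_real y) = r ^ 2"
      by (simp add: r_def u_def power_mult_distrib exp_diff exp_minus field_simps flip: exp_double)
    have "exp (- (complex_of_real y / 2)) = of_real (exp (- (y / 2)))" by (simp flip: exp_of_real)
    then have r: "Re r > 0" using u by (simp add: r_def)
    have "1 + r ^ 2 \<noteq> 0"
    proof
      assume "1 + r ^ 2 = 0"
      then have "(r - \<i>) * (r + \<i>) = 0" by (simp add: algebra_simps power2_eq_square)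
      then have "r = \<i> \<or> r = - \<i>" by (auto simp: add_eq_0_iff2)
      then show False using r by auto
    qed
    note r2nz = this
    have dE: "((\<lambda>x. u * exp (- (x / 2))) has_field_derivative - r / 2) (at (of_real y))"
      by (auto intro!: derivative_eq_intros simp: r_def)
    have dA: "(Arctan has_field_derivative inverse (1 + r\<^sup>2)) (at (u * exp (- (of_real y / 2))))"
      unfolding r_def[symmetric] by (rule has_field_derivative_Arctan) (use r in auto)
    have "((\<lambda>x. - 4 / u * (u * exp (- (x / 2)) - Arctan (u * exp (- (x / 2))))) has_field_derivative
        - 4 / u * (- r / 2 - inverse (1 + r\<^sup>2) * (- r / 2))) (at (of_real y))"
      by (rule DERIV_cmult[OF DERIV_diff[OF dE DERIV_chain2[OF dA dE]]])
    also have "- 4 / u * (- r / 2 - i * (- r / 2)) = 2 * (r / u) * (1 - i)" for i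
      using u0 by (simp add: field_simps)
    also have "1 - inverse (1 + r\<^sup>2) = r\<^sup>2 / (1 + r\<^sup>2)" using r2nz by (simp add: field_simps)
    also have "r / u = exp (- (of_real y / 2))" using u0 by (simp add: r_def)
    also have "2 * exp (- (of_real y / 2)) * (r\<^sup>2 / (1 + r\<^sup>2)) =
        2 * of_real pi * (exp (- (of_real y / 2)) * (r ^ 2 / (of_real pi * (1 + r ^ 2))))" by simp
    finally have "((\<lambda>x. - 4 / u * (u * exp (- (x / 2)) - Arctan (u * exp (- (x / 2))))) has_field_derivative
        (2 * of_real pi * (exp (- (of_real y / 2)) * (r ^ 2 / (of_real pi * (1 + r ^ 2)))))) (at (of_real y))" .
    then show "((\<lambda>y. - 4 / u * (u * exp (- (of_real y / 2)) - Arctan (u * exp (- (of_real y / 2))))) has_vector_derivative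
       2 * of_real pi * (exp (- (of_real y / 2)) * (exp (\<i> * z - of_real y) / (of_real pi * (1 + exp (\<i> * z - of_real y)))))) (at y)"
      unfolding r2 by (rule has_vector_derivative_real_field)
  next
    have "integrable lborel (\<lambda>y. LINT t|lborel. f t y)"
      using lborel_pair.integrable_snd[OF fint] by simp
    then show "integrable lborel (\<lambda>y. indicator {0..} y *\<^sub>R
      (2 * of_real pi * (exp (- (of_real y / 2)) * (exp (\<i> * z - of_real y) / (of_real pi * (1 + exp (\<i> * z - of_real y)))))))"
      by (simp only: inner)
  next
    have "(\<lambda>n. exp (- (of_real (real n) * (1/2)))) \<longlonglongrightarrow> (0::complex)"
      by (rule exp_minus_nat_tendsto_0) simp
    then have e: "(\<lambda>n. exp (- (of_real (real n) / 2))) \<longlonglongrightarrow> (0::complex)" by simp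
    have "isCont Arctan 0" by (rule DERIV_isCont[OF has_field_derivative_Arctan]) simp
    then have "isCont Arctan (u * 0)" by simp
    then have "(\<lambda>n. Arctan (u * exp (- (of_real (real n) / 2)))) \<longlonglongrightarrow> Arctan (u * 0)"
      by (rule isCont_tendsto_compose) (intro tendsto_intros e)
    then have "(\<lambda>n. - 4 / u * (u * exp (- (of_real (real n) / 2)) - Arctan (u * exp (- (of_real (real n) / 2))))) \<longlonglongrightarrow>
        - 4 / u * (u * 0 - Arctan (u * 0))"
      by (intro tendsto_intros e)
    then show "(\<lambda>n. - 4 / u * (u * exp (- (of_real (real n) / 2)) - Arctan (u * exp (- (of_real (real n) / 2))))) \<longlonglongrightarrow> 0"
      by simp
  qed
  finally have "(LINT t|lborel. ker z (Complex c t) * (1 / (Complex c t + 1/2))) = 4 * (1 - Arctan u / u)"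
    using u0 by (simp add: field_simps)
  moreover have "4 * X / (2 * of_real pi) = 2 / of_real pi * X" for X :: complex by simp
  ultimately show ?thesis by (simp only: vint_def u_def)
qed


text \<open>Up to the factor \<open>- exp (\<i> * z)\<close> the integrand is that of
  \<open>vint_ker_plus_half\<close> taken at \<open>v - 1\<close>. Moving the line from
  \<open>c - 1\<close> back to \<open>c\<close> crosses the pole at 0, and \<open>c > 1/2\<close>
  keeps it to the right of \<open>- 1/2\<close>.\<close>

lemma vint_ker_minus_half:
  assumes z: "\<bar>Re z\<bar> < pi" and c: "1/2 < c" "c < 1"
  shows "vint (\<lambda>v. ker z v * (1 / (v - 1/2))) c = 2 / of_real pi * (exp (\<i> * z / 2) * Arctan (exp (\<i> * z / 2)))"
proof -
  define K where "K = (\<lambda>c. vint (\<lambda>v. ker z v * (1 / (v + 1/2))) c)"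
  define u where "u = exp (\<i> * z / 2)"
  have u0: "u \<noteq> 0" by (simp add: u_def)
  have q: "exp (\<i> * z) = u ^ 2" by (simp add: u_def flip: exp_double)
  have "K c - K (c - 1) = (\<Sum>n\<in>{0}. (-1) ^ n * exp (\<i> * z * of_nat n) * (1 / (of_nat n + 1/2)) / of_real pi)"
    unfolding K_def
  proof (rule vint_ker_shift[OF z, where a' = "-1/2" and b' = 1])
    fix n :: int assume "-1/2 < real_of_int n" "real_of_int n < 1"
    then have "n = 0" by linarith
    then show "n \<in> int ` {0}" by simp
  next
    show "polyb (\<lambda>v. 1 / (v + 1/2)) (c - 1) c"
      using polyb_inverse[of "-1/2" "c - 1" c] c by simp
    show "(\<lambda>v. 1 / (v + 1/2)) holomorphic_on {s. - 1/2 < Re s \<and> Re s < 1}"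
      by (intro holomorphic_intros) (auto simp: add_eq_0_iff2)
  qed (use c in auto)
  moreover have "vint (\<lambda>v. ker z v * (1 / (v - 1/2))) c = - exp (\<i> * z) * K (c - 1)"
  proof -
    have "Complex c t = Complex (c - 1) t + 1" for t by (simp add: complex_eq_iff)
    then have "ker z (Complex c t) * (1 / (Complex c t - 1/2)) =
        - exp (\<i> * z) * (ker z (Complex (c - 1) t) * (1 / (Complex (c - 1) t + 1/2)))" for t
      using ker_shift[of z "Complex (c - 1) t"] by simp
    note eq = this
    show ?thesis unfolding vint_def K_def eq integral_mult_right_zero by simp
  qed
  moreover have "K c = 2 / of_real pi * (1 - Arctan u / u)"
    unfolding K_def u_def using z c by (intro vint_ker_plus_half) auto
  ultimately have "vint (\<lambda>v. ker z v * (1 / (v - 1/2))) c = - (u ^ 2) * (2 / of_real pi * (1 - Arctan u / u) - 2 / of_real pi)"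
    unfolding q by (simp add: algebra_simps)
  then show ?thesis using u0 by (simp add: u_def[symmetric] field_simps power2_eq_square)
qed

section \<open>The digamma function: special values and growth\<close>

lemma Gamma_ne_0_complex: "(z :: complex) \<notin> \<int> \<Longrightarrow> Gamma z \<noteq> 0"
  by (auto simp: Gamma_eq_zero_iff)

text \<open>Obtained by differentiating \<open>Gamma z * Gamma (1 - z) * sin (pi * z)\<close>, which
  is constant by the reflection formula for Gamma.\<close>

lemma Digamma_reflection:
  assumes z: "(z :: complex) \<notin> \<int>"
  shows "Digamma z - Digamma (1 - z) = - of_real pi * cot (of_real pi * z)"
proof -
  have z1: "1 - z \<notin> \<int>"
  proof
    assume "1 - z \<in> \<int>"
    from Ints_diff[OF Ints_1 this] have "1 - (1 - z) \<in> \<int>" .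
    then show False using z by simp
  qed
  have nz: "z \<notin> \<int>\<^sub>\<le>\<^sub>0" "1 - z \<notin> \<int>\<^sub>\<le>\<^sub>0" using z z1 by auto
  have s: "sin (of_real pi * z) \<noteq> 0" using z by (auto simp: sin_pi_eq_0_iff)
  have refl: "(\<lambda>z. Gamma z * Gamma (1 - z) * sin (of_real pi * z)) w = of_real pi" if "w \<in> - \<int>" for w :: complex
    using Gamma_reflection_complex[of w] that sin_pi_eq_0_iff[of w] by (auto simp: field_simps)
  have "((\<lambda>z. Gamma z * Gamma (1 - z) * sin (of_real pi * z)) has_field_derivative
     Gamma z * Gamma (1 - z) * sin (of_real pi * z) * (Digamma z - Digamma (1 - z))
     + Gamma z * Gamma (1 - z) * (of_real pi * cos (of_real pi * z))) (at z)"
    using nz by (auto intro!: derivative_eq_intros simp: algebra_simps)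
  then have "((\<lambda>_. of_real pi) has_field_derivative
     Gamma z * Gamma (1 - z) * sin (of_real pi * z) * (Digamma z - Digamma (1 - z))
     + Gamma z * Gamma (1 - z) * (of_real pi * cos (of_real pi * z))) (at z)"
    by (rule has_field_derivative_transform_within_open[where S = "- \<int>"])
       (use z refl in \<open>auto intro!: closed_Ints open_Compl\<close>)
  then have "0 = Gamma z * Gamma (1 - z) * sin (of_real pi * z) * (Digamma z - Digamma (1 - z))
     + Gamma z * Gamma (1 - z) * (of_real pi * cos (of_real pi * z))"
    by (rule DERIV_unique[OF DERIV_const])
  then have "Gamma z * Gamma (1 - z) * (sin (of_real pi * z) * (Digamma z - Digamma (1 - z)) + of_real pi * cos (of_real pi * z)) = 0"
    by (simp add: algebra_simps)
  then have "sin (of_real pi * z) * (Digamma z - Digamma (1 - z)) + of_real pi * cos (of_real pi * z) = 0"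
    using Gamma_ne_0_complex[OF z] Gamma_ne_0_complex[OF z1] by simp
  then show ?thesis using s by (simp add: cot_def field_simps add_eq_0_iff2)
qed

lemma Digamma_duplication:
  assumes z: "z \<notin> \<int>\<^sub>\<le>\<^sub>0" "z + 1/2 \<notin> \<int>\<^sub>\<le>\<^sub>0" "2 * z \<notin> \<int>\<^sub>\<le>\<^sub>0"
  shows "Digamma z + Digamma (z + 1/2 :: complex) = 2 * Digamma (2 * z) - 2 * of_real (ln 2)"
proof -
  define S where "S = - {w::complex. w \<in> \<int>\<^sub>\<le>\<^sub>0 \<or> w + 1/2 \<in> \<int>\<^sub>\<le>\<^sub>0}"
  have "S = (- \<int>\<^sub>\<le>\<^sub>0) \<inter> ((\<lambda>w. w + 1/2) -` (- \<int>\<^sub>\<le>\<^sub>0))" by (auto simp: S_def)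
  moreover have "open ((\<lambda>w::complex. w + 1/2) -` (- \<int>\<^sub>\<le>\<^sub>0))"
    by (intro open_vimage continuous_intros) auto
  ultimately have "open S" by (simp only:) (intro open_Int open_Compl closed_nonpos_Ints)
  moreover have "z \<in> S" using z by (simp add: S_def)
  ultimately have S: "open S" "z \<in> S" by blast+
  define E where "E = (\<lambda>w::complex. exp ((1 - 2 * w) * of_real (ln 2)) * of_real (sqrt pi))"
  have dup: "Gamma w * Gamma (w + 1/2) = E w * Gamma (2 * w)" if "w \<in> S" for w
    using Gamma_legendre_duplication[of w] that by (simp add: S_def E_def)
  have "((\<lambda>w. Gamma w * Gamma (w + 1/2)) has_field_derivative
      Gamma z * Gamma (z + 1/2) * (Digamma z + Digamma (z + 1/2))) (at z)"
    using z by (auto intro!: derivative_eq_intros simp: algebra_simps)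
  then have "((\<lambda>w. E w * Gamma (2 * w)) has_field_derivative
      Gamma z * Gamma (z + 1/2) * (Digamma z + Digamma (z + 1/2))) (at z)"
    by (rule has_field_derivative_transform_within_open[OF _ S]) (rule dup)
  moreover have "((\<lambda>w. E w * Gamma (2 * w)) has_field_derivative
      E z * Gamma (2 * z) * (2 * Digamma (2 * z) - 2 * of_real (ln 2))) (at z)"
    unfolding E_def using z by (auto intro!: derivative_eq_intros simp: algebra_simps)
  ultimately have "Gamma z * Gamma (z + 1/2) * (Digamma z + Digamma (z + 1/2)) =
      E z * Gamma (2 * z) * (2 * Digamma (2 * z) - 2 * of_real (ln 2))"
    by (rule DERIV_unique)
  moreover have "Gamma z * Gamma (z + 1/2) \<noteq> 0" using z by (simp add: Gamma_eq_zero_iff)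
  ultimately show ?thesis using dup[OF S(2)] by simp
qed

lemma quarter_not_Ints: "(1/4 :: complex) \<notin> \<int>" "(3/4 :: complex) \<notin> \<int>" "(1/2 :: complex) \<notin> \<int>"
  using fraction_not_in_Ints[of 4 1, where 'a = complex] fraction_not_in_Ints[of 4 3, where 'a = complex]
    fraction_not_in_Ints[of 2 1, where 'a = complex] by simp_all

text \<open>Duplication gives the sum of the two values, reflection their difference. They enter
  through the residues of the digamma term at \<open>v = 1\<close> and \<open>v = 2\<close>, where
  the argument is 3/4 and 1/4 + 1.\<close>

lemma Digamma_quarters:
  "Digamma (1/4 :: complex) = - euler_mascheroni - 3 * of_real (ln 2) - of_real pi / 2"
  "Digamma (3/4 :: complex) = - euler_mascheroni - 3 * of_real (ln 2) + of_real pi / 2"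
proof -
  have "Digamma (1/4 :: complex) + Digamma (1/4 + 1/2) = 2 * Digamma (2 * (1/4)) - 2 * of_real (ln 2)"
    by (rule Digamma_duplication) (use quarter_not_Ints in auto)
  then have 1: "Digamma (1/4 :: complex) + Digamma (3/4) = - 2 * euler_mascheroni - 6 * of_real (ln 2)"
    by (simp add: Digamma_one_half algebra_simps)
  have "cot (of_real pi * (1/4 :: complex)) = of_real (cot (pi / 4))"
    by (simp add: cot_def flip: sin_of_real cos_of_real)
  also have "\<dots> = 1" by (simp add: cot_def sin_45 cos_45)
  finally have "Digamma (1/4 :: complex) - Digamma (3/4) = - of_real pi"
    using Digamma_reflection[of "1/4"] quarter_not_Ints by simp
  then have 2: "Digamma (3/4 :: complex) = Digamma (1/4) + of_real pi" by (simp add: algebra_simps)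
  have "2 * Digamma (1/4 :: complex) = 2 * (- euler_mascheroni - 3 * of_real (ln 2) - of_real pi / 2)"
    using 1 unfolding 2 by (simp add: algebra_simps add_eq_0_iff2)
  then show 3: "Digamma (1/4 :: complex) = - euler_mascheroni - 3 * of_real (ln 2) - of_real pi / 2"
    by (simp only: mult_cancel_left) simp
  show "Digamma (3/4 :: complex) = - euler_mascheroni - 3 * of_real (ln 2) + of_real pi / 2"
    unfolding 2 3 by simp
qed

text \<open>Linear growth is far from sharp, but the kernel decays exponentially. It comes from the
  terms \<open>(z - 1) / ((k + 1) * (z + k))\<close> of the defining series, with
  \<open>norm (z + k) \<ge> (k + 1) / 4\<close>.\<close>

lemma norm_Digamma_le:
  obtains D where "D \<ge> 0" "\<And>z::complex. Re z \<ge> 1/4 \<Longrightarrow> norm (Digamma z) \<le> D * (1 + norm z)"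
proof -
  define S where "S = (\<Sum>k. 1 / (real k + 1)\<^sup>2)"
  have S: "summable (\<lambda>k. 1 / (real k + 1)\<^sup>2)" using sums_summable[OF inverse_squares_sums] by (simp add: add.commute)
  then have S0: "S \<ge> 0" unfolding S_def by (intro suminf_nonneg) auto
  have "norm (Digamma z) \<le> (4 * S + \<bar>euler_mascheroni\<bar>) * (1 + norm z)" if z: "Re z \<ge> 1/4" for z :: complex
  proof -
    have b: "norm (inverse (of_nat (Suc k)) - inverse (z + of_nat k)) \<le> 4 * (1 + norm z) * (1 / (real k + 1)\<^sup>2)" for k
    proof -
      have ge: "(real k + 1) / 4 \<le> norm (z + of_nat k)"
        using z complex_Re_le_cmod[of "z + of_nat k"] by simp
      then have nz: "z + of_nat k \<noteq> 0" by auto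
      have "inverse (of_nat (Suc k)) - inverse (z + of_nat k) = (z - 1) / (of_nat (Suc k) * (z + of_nat k))"
        using nz by (simp add: field_simps del: of_nat_Suc) (simp add: algebra_simps)
      then have "norm (inverse (of_nat (Suc k)) - inverse (z + of_nat k)) = norm (z - 1) / ((real k + 1) * norm (z + of_nat k))"
        by (simp only: norm_divide norm_mult norm_of_nat) (simp add: add.commute)
      also have "\<dots> \<le> (1 + norm z) / ((real k + 1) * ((real k + 1) / 4))"
        using ge norm_triangle_ineq4[of z 1] by (intro frac_le mult_left_mono) auto
      also have "\<dots> = 4 * (1 + norm z) * (1 / (real k + 1)\<^sup>2)" by (simp add: power2_eq_square)
      finally show ?thesis .
    qed
    have sm: "summable (\<lambda>k. 4 * (1 + norm z) * (1 / (real k + 1)\<^sup>2))" by (intro summable_mult S)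
    have "norm (\<Sum>k. inverse (of_nat (Suc k)) - inverse (z + of_nat k)) \<le> (\<Sum>k. 4 * (1 + norm z) * (1 / (real k + 1)\<^sup>2))"
      by (rule norm_suminf_le[OF b sm])
    also have "\<dots> = 4 * (1 + norm z) * S" unfolding S_def by (rule suminf_mult[OF S])
    finally have "norm (Digamma z) \<le> 4 * (1 + norm z) * S + norm (euler_mascheroni :: complex)"
      unfolding Digamma_def using norm_triangle_ineq4 order_trans add_right_mono by meson
    also have "norm (euler_mascheroni :: complex) = \<bar>euler_mascheroni\<bar>"
      by (metis norm_of_real of_real_euler_mascheroni)
    also have "4 * (1 + norm z) * S + \<bar>euler_mascheroni\<bar> \<le> (4 * S + \<bar>euler_mascheroni\<bar>) * (1 + norm z)"
      by (simp add: algebra_simps)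
    finally show ?thesis .
  qed
  then show ?thesis using that[of "4 * S + \<bar>euler_mascheroni\<bar>"] S0 by simp
qed


text \<open>The logarithmic derivative of \<open>Gamma (s / 2)\<close> with respect to
  \<open>s\<close>, at \<open>s = 1/2 + v\<close>.\<close>

definition psi_half :: "complex \<Rightarrow> complex" where
  "psi_half v = Digamma (1/4 + v / 2) / 2"

lemma psi_half_polyb:
  assumes "0 \<le> a" shows "polyb psi_half a b"
proof -
  obtain D where D: "D \<ge> 0" "\<And>z::complex. Re z \<ge> 1/4 \<Longrightarrow> norm (Digamma z) \<le> D * (1 + norm z)"
    using norm_Digamma_le by blast
  have "norm (psi_half v) \<le> D * (1 + norm v) ^ 1" if "a \<le> Re v" for v
  proof -
    have "norm (Digamma (1/4 + v / 2)) \<le> D * (1 + norm (1/4 + v / 2))"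
      using that assms by (intro D) simp
    also have "D * (1 + norm (1/4 + v / 2)) \<le> D * (2 * (1 + norm v))"
    proof (rule mult_left_mono[OF _ D(1)])
      have "norm (1/4 + v / 2) \<le> norm (1/4 :: complex) + norm (v / 2)" by (rule norm_triangle_ineq)
      then show "1 + norm (1/4 + v / 2) \<le> 2 * (1 + norm v)"
        using norm_ge_zero[of v] by (simp add: norm_divide field_simps del: norm_ge_zero)
    qed
    also have "D * (2 * (1 + norm v)) = 2 * (D * (1 + norm v))" by simp
    finally have "norm (Digamma (1/4 + v / 2)) / 2 \<le> D * (1 + norm v)" by linarith
    then show ?thesis by (simp only: psi_half_def norm_divide power_one_right) simp
  qed
  then show ?thesis unfolding polyb_def by blast
qed

lemma not_nonpos_Ints_if_Re_pos: "Re z > 0 \<Longrightarrow> z \<notin> \<int>\<^sub>\<le>\<^sub>0"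
  by (auto elim!: nonpos_Ints_cases)

lemma psi_half_holomorphic: "psi_half holomorphic_on {s. - 1/2 < Re s \<and> Re s < b}"
proof -
  have "(Digamma \<circ> (\<lambda>v. 1/4 + v / 2)) holomorphic_on {s. - 1/2 < Re s \<and> Re s < b}"
  proof (rule holomorphic_on_compose_gen)
    show "Digamma holomorphic_on {s::complex. Re s > 0}"
      by (rule holomorphic_on_Polygamma) (use not_nonpos_Ints_if_Re_pos in auto)
  qed (auto intro!: holomorphic_intros)
  then show ?thesis unfolding psi_half_def o_def by (intro holomorphic_intros) auto
qed

lemma psi_half_plus2:
  assumes "Re v > - 1/2" shows "psi_half (v + 2) = psi_half v + 1 / (v + 1/2)"
proof -
  have nz: "1/4 + v / 2 \<noteq> 0"
  proof
    assume "1/4 + v / 2 = 0"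
    then have "Re (1/4 + v / 2) = 0" by simp
    then show False using assms by simp
  qed
  have "1/4 + (v + 2) / 2 = (1/4 + v / 2) + 1" by (simp add: add_divide_distrib)
  then have "Digamma (1/4 + (v + 2) / 2) = Digamma (1/4 + v / 2) + 1 / (1/4 + v / 2)"
    using Digamma_plus1[OF nz] by simp
  moreover have "1 / (1/4 + v / 2) / 2 = 1 / (v + 1/2)"
  proof -
    have "v + 1/2 = 2 * (1/4 + v / 2)" by (simp add: algebra_simps)
    then show ?thesis by simp
  qed
  ultimately show ?thesis by (simp add: psi_half_def add_divide_distrib)
qed

lemma holomorphic_vline_continuous:
  assumes "G holomorphic_on {s. a < Re s \<and> Re s < b}" "a < c" "c < b"
  shows "continuous_on {s. Re s = c} G"
  by (rule continuous_on_subset[OF holomorphic_on_imp_continuous_on[OF assms(1)]]) (use assms in auto)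

lemma vint_add:
  assumes "integrable lborel (\<lambda>t. F (Complex c t))" "integrable lborel (\<lambda>t. G (Complex c t))"
  shows "vint (\<lambda>v. F v + G v) c = vint F c + vint G c"
  using assms by (simp add: vint_def add_divide_distrib)

lemma vint_cmult: "vint (\<lambda>v. k * F v) c = k * vint F c"
  by (simp add: vint_def)

lemma inverse_plus_half_holomorphic:
  "(\<lambda>v. 1 / (v + 1/2)) holomorphic_on {s. - 1/2 < Re s \<and> Re s < b}"
  by (intro holomorphic_intros) (auto simp: add_eq_0_iff2)

lemma unit_interval_not_Ints: "0 < c \<Longrightarrow> c < 1 \<Longrightarrow> (c::real) \<notin> \<int>"
  by (auto elim!: Ints_cases)

text \<open>Shifting by \<open>2\<close> multiplies the kernel by \<open>exp (2 i z)\<close> and changes \<open>psi_half\<close> by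
  \<open>1 / (v + 1/2)\<close>, which makes the integral satisfy a linear equation.\<close>
lemma vint_ker_psi_half:
  assumes z: "\<bar>Re z\<bar> < pi" and c: "0 < c" "c < 1"
  defines "q \<equiv> exp (\<i> * z)"
  shows "(q ^ 2 - 1) * vint (\<lambda>v. ker z v * psi_half v) c =
    (q ^ 2 * psi_half 2 - q * psi_half 1) / of_real pi - q ^ 2 * vint (\<lambda>v. ker z v * (1 / (v + 1/2))) c"
proof -
  define J where "J = vint (\<lambda>v. ker z v * psi_half v)"
  define K where "K = vint (\<lambda>v. ker z v * (1 / (v + 1/2))) c"
  have "J (c + 2) - J c = (\<Sum>n\<in>{1, 2}. (-1) ^ n * exp (\<i> * z * of_nat n) * psi_half (of_nat n) / of_real pi)"
    unfolding J_def
  proof (rule vint_ker_shift[OF z, where a' = 0 and b' = 3])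
    fix n :: int assume "0 < real_of_int n" "real_of_int n < 3"
    then have "n = 1 \<or> n = 2" by linarith
    then show "n \<in> int ` {1, 2}" by auto
  next
    show "polyb psi_half c (c + 2)" using c by (intro psi_half_polyb) simp
    show "psi_half holomorphic_on {s. 0 < Re s \<and> Re s < 3}"
      by (rule holomorphic_on_subset[OF psi_half_holomorphic[of 3]]) auto
  qed (use c in auto)
  also have "\<dots> = (q ^ 2 * psi_half 2 - q * psi_half 1) / of_real pi"
    by (simp add: q_def mult_ac exp_double[symmetric] diff_divide_distrib)
  finally have 1: "J (c + 2) - J c = (q ^ 2 * psi_half 2 - q * psi_half 1) / of_real pi" .
  have "J (c + 2) = vint (\<lambda>v. q ^ 2 * (ker z v * psi_half v + ker z v * (1 / (v + 1/2)))) c"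
  proof -
    have "ker z (Complex (c + 2) t) * psi_half (Complex (c + 2) t) =
      q ^ 2 * (ker z (Complex c t) * psi_half (Complex c t) + ker z (Complex c t) * (1 / (Complex c t + 1/2)))" for t
    proof -
      have eq: "Complex (c + 2) t = Complex c t + 2" by (simp add: complex_eq_iff)
      have "Complex c t + 2 = (Complex c t + 1) + 1" by simp
      then have k: "ker z (Complex c t + 2) = q ^ 2 * ker z (Complex c t)"
        by (simp only: ker_shift q_def power2_eq_square) simp
      have p: "psi_half (Complex c t + 2) = psi_half (Complex c t) + 1 / (Complex c t + 1/2)"
        by (rule psi_half_plus2) (use c in simp)
      show ?thesis unfolding eq k p by (simp only: ring_distribs mult_ac)
    qed
    then show ?thesis by (simp only: J_def vint_def)
  qed
  also have "\<dots> = q ^ 2 * (J c + K)"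
    unfolding vint_cmult J_def K_def
  proof (subst vint_add)
    note cZ = unit_interval_not_Ints[OF c]
    show "integrable lborel (\<lambda>t. ker z (Complex c t) * psi_half (Complex c t))"
      by (rule ker_line_integrable[OF z psi_half_polyb cZ holomorphic_vline_continuous[OF psi_half_holomorphic[of 3]]])
         (use c in auto)
    show "integrable lborel (\<lambda>t. ker z (Complex c t) * (1 / (Complex c t + 1/2)))"
    proof (rule ker_line_integrable[OF z _ cZ holomorphic_vline_continuous[OF inverse_plus_half_holomorphic[of 3]]])
      show "polyb (\<lambda>v. 1 / (v + 1/2)) c c" using polyb_inverse[of "-1/2" c c] c by simp
    qed (use c in auto)
  qed simp
  finally show ?thesis using 1 unfolding J_def K_def by (simp add: algebra_simps)
qed

section \<open>The sine kernel\<close>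

definition sker :: "complex \<Rightarrow> complex \<Rightarrow> complex" where
  "sker z v = sin (z * v) / sin (of_real pi * v)"

lemma sker_eq: "sker z v = (ker z v - ker (- z) v) / (2 * \<i>)"
proof -
  have "sin (z * v) = (exp (\<i> * z * v) - exp (\<i> * (- z) * v)) / (2 * \<i>)"
    by (simp only: sin_exp_eq[of "z * v"] mult.assoc mult_minus_left mult_minus_right)
  moreover have "(a - b) / k / s = (a / s - b / s) / k" for a b k s :: complex
    by (simp add: diff_divide_distrib divide_divide_eq_left mult.commute)
  ultimately show ?thesis by (simp only: sker_def ker_def)
qed

lemma sker_even: "sker z (- v) = sker z v"
  by (simp add: sker_def)

lemma vdecay_diff_cmult:
  assumes "vdecay F a b" "vdecay G a b"
  shows "vdecay (\<lambda>v. (F v - G v) / k) a b"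
proof -
  obtain K \<delta> Y where K: "\<delta> > 0" "\<And>s. a \<le> Re s \<Longrightarrow> Re s \<le> b \<Longrightarrow> \<bar>Im s\<bar> \<ge> Y \<Longrightarrow> norm (F s) \<le> K * exp (- \<delta> * \<bar>Im s\<bar>)"
    using assms(1) unfolding vdecay_def by blast
  obtain L \<epsilon> Y' where L: "\<epsilon> > 0" "\<And>s. a \<le> Re s \<Longrightarrow> Re s \<le> b \<Longrightarrow> \<bar>Im s\<bar> \<ge> Y' \<Longrightarrow> norm (G s) \<le> L * exp (- \<epsilon> * \<bar>Im s\<bar>)"
    using assms(2) unfolding vdecay_def by blast
  define \<eta> where "\<eta> = min \<delta> \<epsilon>"
  have "norm ((F s - G s) / k) \<le> ((\<bar>K\<bar> + \<bar>L\<bar>) / norm k) * exp (- \<eta> * \<bar>Im s\<bar>)"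
    if s: "a \<le> Re s" "Re s \<le> b" "\<bar>Im s\<bar> \<ge> max Y Y'" for s
  proof -
    have s': "\<bar>Im s\<bar> \<ge> Y" "\<bar>Im s\<bar> \<ge> Y'" using s(3) by auto
    have "norm (F s) \<le> \<bar>K\<bar> * exp (- \<eta> * \<bar>Im s\<bar>)"
      by (rule order_trans[OF K(2)[OF s(1,2) s'(1)]], rule mult_mono)
         (auto simp: \<eta>_def intro!: mult_right_mono)
    moreover have "norm (G s) \<le> \<bar>L\<bar> * exp (- \<eta> * \<bar>Im s\<bar>)"
      by (rule order_trans[OF L(2)[OF s(1,2) s'(2)]], rule mult_mono)
         (auto simp: \<eta>_def intro!: mult_right_mono)
    ultimately have "norm (F s - G s) \<le> (\<bar>K\<bar> + \<bar>L\<bar>) * exp (- \<eta> * \<bar>Im s\<bar>)"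
      using norm_triangle_ineq4[of "F s" "G s"] by (simp add: ring_distribs)
    then show ?thesis by (simp add: norm_divide divide_right_mono)
  qed
  moreover have "\<eta> > 0" using K L by (simp add: \<eta>_def)
  ultimately show ?thesis unfolding vdecay_def by blast
qed

lemma vdecay_sker_times:
  assumes "\<bar>Re z\<bar> < pi" "polyb G a b"
  shows "vdecay (\<lambda>v. sker z v * G v) a b"
proof -
  have "vdecay (\<lambda>v. (ker z v * G v - ker (- z) v * G v) / (2 * \<i>)) a b"
    using assms by (intro vdecay_diff_cmult vdecay_ker_times) auto
  moreover have "(ker z v * G v - ker (- z) v * G v) / (2 * \<i>) = sker z v * G v" for v
    by (simp only: sker_eq times_divide_eq_left left_diff_distrib)
  ultimately show ?thesis by (simp only:)
qed


lemma vdecay_mult_bounded: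
  assumes "vdecay F a b"
    and G: "\<And>s. a \<le> Re s \<Longrightarrow> Re s \<le> b \<Longrightarrow> \<bar>Im s\<bar> \<ge> Y' \<Longrightarrow> norm (G s) \<le> D"
  shows "vdecay (\<lambda>s. F s * G s) a b"
proof -
  obtain K \<delta> Y where K: "\<delta> > 0" "\<And>s. a \<le> Re s \<Longrightarrow> Re s \<le> b \<Longrightarrow> \<bar>Im s\<bar> \<ge> Y \<Longrightarrow> norm (F s) \<le> K * exp (- \<delta> * \<bar>Im s\<bar>)"
    using assms(1) unfolding vdecay_def by blast
  have "norm (F s * G s) \<le> (K * D) * exp (- \<delta> * \<bar>Im s\<bar>)"
    if s: "a \<le> Re s" "Re s \<le> b" "\<bar>Im s\<bar> \<ge> max Y Y'" for s
  proof -
    have F: "norm (F s) \<le> K * exp (- \<delta> * \<bar>Im s\<bar>)" using s by (intro K(2)) auto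
    then have "norm (F s) * norm (G s) \<le> (K * exp (- \<delta> * \<bar>Im s\<bar>)) * D"
      using s order_trans[OF norm_ge_zero F] by (intro mult_mono G) auto
    then show ?thesis by (simp add: norm_mult mult_ac)
  qed
  then show ?thesis using K(1) unfolding vdecay_def by blast
qed

lemma vint_uminus: "vint F (- c) = vint (\<lambda>v. F (- v)) c"
proof -
  have "(LINT t|lborel. F (Complex (- c) t)) = (LINT t|lborel. F (Complex (- c) (0 + (-1) * t)))"
    using lborel_integral_real_affine[of "-1" "\<lambda>t. F (Complex (- c) t)" 0] by simp
  moreover have "Complex (- c) (0 + (-1) * t) = - Complex c t" for t by (simp add: complex_eq_iff)
  ultimately show ?thesis by (simp only: vint_def)
qed

text \<open>The integrand \<open>F\<close> is odd in \<open>v\<close>, so its integrals over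
  \<open>Re v = c\<close> and \<open>Re v = - c\<close> differ by a sign, and twice the integral is
  the sum of the residues in between. Those at \<open>w\<close> and \<open>- w\<close> both equal
  \<open>sker z w\<close> because \<open>sker\<close> is even; \<open>c < 1\<close> keeps the
  nonzero integers outside.\<close>

lemma sker_Cauchy:
  assumes z: "\<bar>Re z\<bar> < pi" and w: "\<bar>Re w\<bar> < c" "c < 1" "w \<noteq> 0"
  shows "sker z w = vint (\<lambda>v. sker z v * (1 / (v - w) + 1 / (v + w))) c"
proof -
  define F where "F = (\<lambda>v. sker z v * (1 / (v - w) + 1 / (v + w)))"
  define S where "S = {s. - 1 < Re s \<and> Re s < 1}"
  define P where "P = {0, w, - w}"
  have wS: "w \<in> S" "- w \<in> S" "0 \<in> S" using w by (auto simp: S_def)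
  have openS: "open S" unfolding S_def by (rule open_vstrip)
  have sin0: "sin (of_real pi * v) = 0 \<longleftrightarrow> v = 0" if "v \<in> S" for v
  proof
    assume "sin (of_real pi * v) = 0"
    then obtain n :: int where n: "v = of_int n" by (auto simp: sin_pi_eq_0_iff)
    then have "n = 0" using that by (simp add: S_def)
    then show "v = 0" using n by simp
  qed auto
  have sker_holo: "sker z holomorphic_on S - {0}"
    unfolding sker_def by (intro holomorphic_intros) (use sin0 in auto)
  then have F_holo: "F holomorphic_on S - P"
    unfolding F_def
    by (intro holomorphic_intros holomorphic_on_subset[OF sker_holo]) (auto simp: P_def add_eq_0_iff2)
  have decay: "vdecay F (- c) c"
    unfolding F_def
  proof (rule vdecay_mult_bounded[where Y' = "\<bar>Im w\<bar> + 1" and D = 2])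
    show "vdecay (sker z) (- c) c" using vdecay_sker_times[OF z polyb_const[of 1]] by simp
    fix s assume s: "\<bar>Im w\<bar> + 1 \<le> \<bar>Im s\<bar>"
    have b: "norm (1 / p) \<le> 1" if "1 \<le> norm p" for p :: complex
      using that by (simp add: norm_divide divide_simps)
    have "1 \<le> norm (s - w)" using s abs_Im_le_cmod[of "s - w"] by simp
    moreover have "1 \<le> norm (s + w)" using s abs_Im_le_cmod[of "s + w"] by simp
    ultimately show "norm (1 / (s - w) + 1 / (s + w)) \<le> 2"
      using b[of "s - w"] b[of "s + w"] norm_triangle_ineq[of "1 / (s - w)" "1 / (s + w)"] by linarith
  qed
  have "vint F c - vint F (- c) = (\<Sum>p\<in>P. residue F p)"
  proof (rule vint_shift[where a' = "- 1" and b' = 1])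
    show "F holomorphic_on {s. - 1 < Re s \<and> Re s < 1} - P" using F_holo by (simp add: S_def)
  qed (use w decay in \<open>auto simp: P_def\<close>)
  moreover have "vint F (- c) = - vint F c"
  proof -
    have "F (- v) = - F v" for v
    proof -
      have "1 / (- v - w) + 1 / (- v + w) = - (1 / (v - w) + 1 / (v + w))"
        by (metis add.commute minus_add_distrib minus_diff_eq minus_divide_right uminus_add_conv_diff)
      then show ?thesis by (simp only: F_def sker_even mult_minus_right)
    qed
    then have "vint (\<lambda>v. F (- v)) c = vint (\<lambda>v. (- 1) * F v) c" by simp
    then show ?thesis unfolding vint_uminus vint_cmult by simp
  qed
  \<comment> \<open>The zero of \<open>sin (pi * v)\<close> at 0 is matched by that of
    \<open>sin (z * v)\<close>, so 0 contributes nothing.\<close>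
  moreover have "residue F 0 = 0"
  proof (rule residue_simple'[of "ball 0 (min 1 (norm w))"])
    have "x \<in> S - P" if "x \<in> ball 0 (min 1 (norm w)) - {0}" for x
      using that abs_Re_le_cmod[of x] by (auto simp: S_def P_def)
    then show "F holomorphic_on ball 0 (min 1 (norm w)) - {0}"
      by (intro holomorphic_on_subset[OF F_holo]) blast
    have "((\<lambda>v::complex. sin (of_real pi * v)) has_field_derivative of_real pi) (at 0)"
      by (auto intro!: derivative_eq_intros)
    then have "((\<lambda>v::complex. sin (of_real pi * v) / v) \<longlongrightarrow> of_real pi) (at 0)"
      by (simp add: has_field_derivative_iff)
    then have "((\<lambda>v::complex. inverse (sin (of_real pi * v) / v)) \<longlongrightarrow> inverse (of_real pi)) (at 0)"
      by (rule tendsto_inverse) simp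
    moreover have "((\<lambda>v. sin (z * v) * (1 / (v - w) + 1 / (v + w))) \<longlongrightarrow> sin (z * 0) * (1 / (0 - w) + 1 / (0 + w))) (at 0)"
      by (intro tendsto_intros) (use w in auto)
    ultimately have "((\<lambda>v. inverse (sin (of_real pi * v) / v) * (sin (z * v) * (1 / (v - w) + 1 / (v + w)))) \<longlongrightarrow>
        inverse (of_real pi) * (sin (z * 0) * (1 / (0 - w) + 1 / (0 + w)))) (at 0)"
      by (rule tendsto_mult)
    then show "((\<lambda>v. F v * (v - 0)) \<longlongrightarrow> 0) (at 0)"
      by (simp add: F_def sker_def field_simps)
  qed (use w in auto)
  moreover have res: "residue F p = sker z p" if p: "p = w \<or> p = - w" for p
  proof (rule residue_simple'[of "S - (P - {p})"])
    show "open (S - (P - {p}))" using openS by (intro open_Diff finite_imp_closed) (auto simp: P_def)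
    show "p \<in> S - (P - {p})" using p wS by auto
    show "F holomorphic_on S - (P - {p}) - {p}"
      by (rule holomorphic_on_subset[OF F_holo]) auto
    have p0: "p \<noteq> 0" and pS: "p \<in> S" using p w wS by auto
    have cont: "isCont (sker z) p"
      unfolding sker_def by (intro continuous_intros) (use sin0[OF pS] p0 in auto)
    have "isCont (\<lambda>v. sker z v * (1 + (v - p) / (v + p))) p"
      by (intro continuous_intros cont) (use p0 in auto)
    then have "((\<lambda>v. sker z v * (1 + (v - p) / (v + p))) \<longlongrightarrow> sker z p * (1 + (p - p) / (p + p))) (at p)"
      unfolding isCont_def .
    then have "((\<lambda>v. sker z v * (1 + (v - p) / (v + p))) \<longlongrightarrow> sker z p) (at p)" by simp
    moreover have "\<forall>\<^sub>F v in at p. sker z v * (1 + (v - p) / (v + p)) = F v * (v - p)"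
      unfolding eventually_at_filter
    proof (rule always_eventually, intro allI impI)
      fix v assume "v \<noteq> p"
      then have "1 + (v - p) / (v + p) = (1 / (v - p) + 1 / (v + p)) * (v - p)"
        by (simp only: distrib_right) simp
      moreover have "1 / (v - w) + 1 / (v + w) = 1 / (v - p) + 1 / (v + p)" using p by auto
      ultimately show "sker z v * (1 + (v - p) / (v + p)) = F v * (v - p)"
        by (simp only: F_def mult.assoc)
    qed
    ultimately show "((\<lambda>v. F v * (v - p)) \<longlongrightarrow> sker z p) (at p)"
      by (rule Lim_transform_eventually)
  qed
  moreover have "(\<Sum>p\<in>P. residue F p) = residue F 0 + (residue F w + residue F (- w))"
  proof -
    have "w \<noteq> - w" using w(3) by (simp add: eq_neg_iff_add_eq_0)
    then show ?thesis using w(3) by (simp add: P_def)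
  qed
  ultimately have "2 * vint F c = 2 * sker z w" by (simp add: sker_even)
  then show ?thesis by (simp add: F_def)
qed

section \<open>Analytic continuation of zeta\<close>

lemma
  fixes f :: "nat \<Rightarrow> complex \<Rightarrow> complex"
  assumes S: "open S" and f: "\<And>n. f n holomorphic_on S"
    and M: "\<And>x. x \<in> S \<Longrightarrow> \<exists>d>0. cball x d \<subseteq> S \<and> (\<exists>M. summable M \<and> (\<forall>n. \<forall>y\<in>cball x d. norm (f n y) \<le> M n))"
  shows holomorphic_suminf: "(\<lambda>x. \<Sum>n. f n x) holomorphic_on S"
    and deriv_suminf: "\<And>x. x \<in> S \<Longrightarrow> (\<lambda>n. deriv (f n) x) sums deriv (\<lambda>x. \<Sum>n. f n x) x"
proof -
  have lim: "\<exists>d. 0 < d \<and> cball x d \<subseteq> S \<and>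
      uniform_limit (cball x d) (\<lambda>N x. \<Sum>n<N. f n x) (\<lambda>x. \<Sum>n. f n x) sequentially" if x: "x \<in> S" for x
  proof -
    obtain d M where "d > 0" "cball x d \<subseteq> S" "summable M" "\<And>n y. y \<in> cball x d \<Longrightarrow> norm (f n y) \<le> M n"
      using M[OF x] by blast
    then show ?thesis by (intro exI[of _ d] conjI Weierstrass_m_test) auto
  qed
  have hN: "(\<lambda>x. \<Sum>n<N. f n x) holomorphic_on S" for N
    by (intro holomorphic_intros f)
  show "(\<lambda>x. \<Sum>n. f n x) holomorphic_on S"
    by (rule holomorphic_uniform_sequence[OF S hN lim])
  fix x assume x: "x \<in> S"
  obtain d where d: "d > 0" "cball x d \<subseteq> S"
    "uniform_limit (cball x d) (\<lambda>N x. \<Sum>n<N. f n x) (\<lambda>x. \<Sum>n. f n x) sequentially" using lim[OF x] by blast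
  have "(\<lambda>N. (deriv ^^ 1) (\<lambda>x. \<Sum>n<N. f n x) x) \<longlonglongrightarrow> (deriv ^^ 1) (\<lambda>x. \<Sum>n. f n x) x"
  proof (rule higher_deriv_complex_uniform_limit[where A = "ball x d"])
    show "uniform_limit (ball x d) (\<lambda>N x. \<Sum>n<N. f n x) (\<lambda>x. \<Sum>n. f n x) sequentially"
      using d(3) by (rule uniform_limit_on_subset) auto
    show "\<forall>\<^sub>F N in sequentially. (\<lambda>x. \<Sum>n<N. f n x) holomorphic_on ball x d"
      using hN d(2) by (intro always_eventually allI) (meson ball_subset_cball holomorphic_on_subset order_trans)
  qed (use d in auto)
  moreover have "deriv (\<lambda>x. \<Sum>n<N. f n x) x = (\<Sum>n<N. deriv (f n) x)" for N
    using f S x by (intro DERIV_imp_deriv DERIV_sum holomorphic_derivI) auto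
  ultimately show "(\<lambda>n. deriv (f n) x) sums deriv (\<lambda>x. \<Sum>n. f n x) x"
    by (simp add: sums_def)
qed

definition ups :: "nat \<Rightarrow> complex \<Rightarrow> complex" where
  "ups n s = (s - 1) * (of_nat n powr - s + of_nat (Suc n) powr - s) / 2
     + of_nat (Suc n) powr (1 - s) - of_nat n powr (1 - s)"

text \<open>Up to the factor \<open>s - 1\<close>, \<open>ups n s\<close> is the error of the trapezoidal rule for \<open>t powr - s\<close> on
  \<open>[n, n + 1]\<close>.\<close>
lemma norm_ups_le:
  assumes n: "n \<ge> 1" and s: "Re s \<ge> - 2"
  shows "norm (ups n s) \<le> norm (s - 1) * norm s * norm (s + 1) / 8 * real n powr (- Re s - 2)"
proof -
  \<comment> \<open>The Peano kernel of the trapezoidal rule. Two integrations by parts of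
    \<open>(s - 1) * k t\<close> against the second derivative of \<open>t powr - s\<close> lead to
    the antiderivative \<open>H\<close>, whose increment over the interval is
    \<open>ups n s\<close>. The kernel is at most 1/8, and the second derivative supplies the power
    \<open>- Re s - 2\<close>.\<close>
  define k where "k = (\<lambda>t::complex. (t - of_nat n) * (of_nat (Suc n) - t) / 2)"
  define H where "H = (\<lambda>t::complex. (s - 1) * (k t * (- s * t powr (- s - 1))
     - (2 * of_nat n + 1 - 2 * t) / 2 * t powr - s) + t powr (1 - s))"
  define H' where "H' = (\<lambda>t::complex. (s - 1) * (k t * (s * (s + 1) * t powr (- s - 2))))"
  define B where "B = norm (s - 1) * norm s * norm (s + 1) / 8 * real n powr (- Re s - 2)"
  define S where "S = closed_segment (of_nat n :: complex) (of_nat (Suc n))"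
  have S: "\<exists>x. t = of_real x \<and> real n \<le> x \<and> x \<le> real (Suc n)" if "t \<in> S" for t
  proof -
    have eq: "S = of_real ` closed_segment (real n) (real (Suc n))"
      unfolding S_def by (metis closed_segment_of_real of_real_of_nat_eq)
    with that show ?thesis by (auto simp: closed_segment_eq_real_ivl)
  qed
  have "norm (H (of_nat (Suc n)) - H (of_nat n)) \<le> B * norm (of_nat (Suc n) - of_nat n :: complex)"
  proof (rule field_differentiable_bound[of S H H'])
    show "convex S" "of_nat (Suc n) \<in> S" "of_nat n \<in> S" by (auto simp: S_def)
    fix t assume "t \<in> S"
    then obtain x where x: "t = of_real x" "real n \<le> x" "x \<le> real (Suc n)" using S by blast
    have x0: "x > 0" using x n by simp
    have t: "t \<notin> \<real>\<^sub>\<le>\<^sub>0" "t \<noteq> 0" using x x0 by (auto simp: complex_nonpos_Reals_iff)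
    have kd: "(k has_field_derivative (2 * of_nat n + 1 - 2 * t) / 2) (at t)"
      unfolding k_def by (auto intro!: derivative_eq_intros simp: field_simps)
    define l where "l = (\<lambda>t::complex. (2 * of_nat n + 1 - 2 * t) / 2)"
    have kd': "(k has_field_derivative l t) (at t)" using kd by (simp only: l_def)
    have ld: "(l has_field_derivative - 1) (at t)"
      unfolding l_def by (auto intro!: derivative_eq_intros)
    have d: "((\<lambda>t. t powr r) has_field_derivative r * t powr (r - 1)) (at t)" for r
      using t by (intro has_field_derivative_powr)
    have d1: "((\<lambda>t. t powr (- s - 1)) has_field_derivative (- s - 1) * t powr (- s - 2)) (at t)"
    proof -
      have e: "- s - 1 - 1 = - s - 2" by simp
      show ?thesis using d[of "- s - 1"] unfolding e .
    qed
    have d3: "((\<lambda>t. t powr (1 - s)) has_field_derivative (1 - s) * t powr - s) (at t)"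
      using d[of "1 - s"] by simp
    have "((\<lambda>t. (s - 1) * (k t * (- s * t powr (- s - 1)) - l t * t powr - s) + t powr (1 - s)) has_field_derivative H' t) (at t)"
      by (rule DERIV_cong[OF DERIV_add[OF DERIV_cmult[OF DERIV_diff[OF
            DERIV_mult[OF kd' DERIV_cmult[OF d1]] DERIV_mult[OF ld d[of "- s"]]]] d3]])
         (simp add: H'_def algebra_simps)
    also have "(\<lambda>t. (s - 1) * (k t * (- s * t powr (- s - 1)) - l t * t powr - s) + t powr (1 - s)) = H"
      by (simp only: H_def l_def)
    finally show "(H has_field_derivative H' t) (at t within S)" by (rule has_field_derivative_at_within)
    have "\<bar>(x - real n) * (real (Suc n) - x)\<bar> \<le> 1/4"
    proof -
      have "0 \<le> (x - real n - 1/2) ^ 2" by simp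
      then have "(x - real n) * (real (Suc n) - x) \<le> 1/4" by (simp add: power2_eq_square algebra_simps)
      moreover have "(x - real n) * (real (Suc n) - x) \<ge> 0" using x by simp
      ultimately show ?thesis by simp
    qed
    moreover have "k t = of_real ((x - real n) * (real (Suc n) - x) / 2)" by (simp add: k_def x)
    ultimately have k: "norm (k t) \<le> 1/8" by (simp only: norm_of_real)
    have "norm (t powr (- s - 2)) = x powr (- Re s - 2)"
      using x0 by (simp add: x(1) norm_powr_real_powr)
    also have "\<dots> \<le> real n powr (- Re s - 2)" using x n s by (intro powr_mono2') auto
    finally have "norm (k t) * norm (t powr (- s - 2)) \<le> 1/8 * real n powr (- Re s - 2)"
      using k by (intro mult_mono) auto
    then have "norm (s - 1) * norm s * norm (s + 1) * (norm (k t) * norm (t powr (- s - 2))) \<le>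
       norm (s - 1) * norm s * norm (s + 1) * (1/8 * real n powr (- Re s - 2))"
      by (intro mult_left_mono) auto
    then show "norm (H' t) \<le> B" by (simp add: H'_def B_def norm_mult mult_ac)
  qed
  moreover have "H (of_nat (Suc n)) - H (of_nat n) = ups n s"
    by (simp add: H_def ups_def k_def field_simps)
  ultimately show ?thesis by (simp add: B_def)
qed

lemma summable_Suc_powr: "a < - 1 \<Longrightarrow> summable (\<lambda>n. real (Suc n) powr a)"
  using summable_real_powr_iff[of a] by (subst summable_Suc_iff) simp

lemma ups_holomorphic: "n \<ge> 1 \<Longrightarrow> ups n holomorphic_on S"
  unfolding ups_def by (intro holomorphic_intros) auto

lemma ups_majorant:
  assumes x: "Re x > - 1"
  shows "\<exists>d>0. cball x d \<subseteq> {s. - 1 < Re s} \<and> (\<exists>M. summable M \<and> (\<forall>n. \<forall>y\<in>cball x d. norm (ups (Suc n) y) \<le> M n))"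
proof -
  \<comment> \<open>Half the distance of \<open>x\<close> from the line \<open>Re s = - 1\<close>;
    on the disc the exponent \<open>- Re y - 2\<close> then stays below
    \<open>- 1 - d\<close>.\<close>
  define d where "d = (Re x + 1) / 2"
  define K where "K = norm x + d + 1"
  define M where "M = (\<lambda>n. K * K * K / 8 * real (Suc n) powr (- 1 - d))"
  have d: "d > 0" using x by (simp add: d_def)
  have b: "Re y \<ge> Re x - d \<and> norm y \<le> norm x + d" if "y \<in> cball x d" for y
  proof -
    have "norm (x - y) \<le> d" using that by (simp add: dist_norm)
    then show ?thesis using abs_Re_le_cmod[of "x - y"] norm_triangle_ineq2[of y x]
      by (simp add: norm_minus_commute)
  qed
  have "norm (ups (Suc n) y) \<le> M n" if y: "y \<in> cball x d" for n y
  proof -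
    have 1: "norm (y - 1) \<le> K" "norm y \<le> K" "norm (y + 1) \<le> K"
      using b[OF y] norm_triangle_ineq4[of y 1] norm_triangle_ineq[of y 1] d by (auto simp: K_def)
    have K0: "K \<ge> 0" using 1(2) norm_ge_zero order_trans by blast
    have re: "- 2 \<le> Re y" "- Re y - 2 \<le> - 1 - d" using b[OF y] x by (auto simp: d_def field_simps)
    have "norm (ups (Suc n) y) \<le> norm (y - 1) * norm y * norm (y + 1) / 8 * real (Suc n) powr (- Re y - 2)"
      by (rule norm_ups_le) (use re in auto)
    also have "\<dots> \<le> K * K * K / 8 * real (Suc n) powr (- 1 - d)"
      using 1 re K0 by (intro mult_mono divide_right_mono powr_mono mult_nonneg_nonneg) auto
    finally show ?thesis by (simp add: M_def)
  qed
  moreover have "summable M" unfolding M_def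
    by (intro summable_mult summable_Suc_powr) (use d in auto)
  moreover have "cball x d \<subseteq> {s. - 1 < Re s}"
  proof
    fix y assume "y \<in> cball x d"
    then have "Re y \<ge> Re x - d" using b by blast
    then show "y \<in> {s. - 1 < Re s}" using d by (simp add: d_def field_simps)
  qed
  ultimately show ?thesis using d by blast
qed

text \<open>The product \<open>(s - 1) * zeta s\<close>, continued to \<open>Re s > - 1\<close> by the trapezoidal rule.\<close>
definition zeta1 :: "complex \<Rightarrow> complex" where
  "zeta1 s = 1 + (s - 1) / 2 + (\<Sum>n. ups (Suc n) s)"

lemma open_Re_gt_minus1: "open {s. - 1 < Re s}"
  by (rule open_halfspace_Re_gt)

lemma zeta1_holomorphic: "zeta1 holomorphic_on {s. - 1 < Re s}"
  unfolding zeta1_def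
  by (intro holomorphic_intros holomorphic_suminf[OF open_Re_gt_minus1] ups_holomorphic ups_majorant) auto

lemma ups_summable: "Re s > - 1 \<Longrightarrow> summable (\<lambda>n. ups (Suc n) s)"
  using ups_majorant[of s] by (metis summable_comparison_test' centre_in_cball less_imp_le)

lemma powr_tendsto_0:
  assumes "Re a < 0" shows "(\<lambda>n. of_nat (Suc n) powr a) \<longlonglongrightarrow> (0 :: complex)"
proof (rule tendsto_norm_zero_cancel)
  have "(\<lambda>n. real (Suc n) powr Re a) \<longlonglongrightarrow> 0" using assms by real_asymp
  moreover have "norm (of_nat (Suc n) powr a) = real (Suc n) powr Re a" for n
    using norm_powr_real_powr[of "of_nat (Suc n)" a] by simp
  ultimately show "(\<lambda>n. norm (of_nat (Suc n) powr a :: complex)) \<longlonglongrightarrow> 0" by simp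
qed

text \<open>Neighbouring trapezoids share a point: interior points count fully, the two end points
  half, and the integrals join into one from 1 to \<open>Suc N\<close>.\<close>

lemma sum_ups:
  "(\<Sum>n<N. ups (Suc n) s) = (s - 1) * ((\<Sum>n<Suc N. of_nat (Suc n) powr - s) - 1/2 - of_nat (Suc N) powr - s / 2)
     + of_nat (Suc N) powr (1 - s) - 1"
proof (induction N)
  case (Suc N)
  show ?case
    unfolding sum.lessThan_Suc[of _ N] sum.lessThan_Suc[of _ "Suc N"] Suc.IH
    by (simp add: ups_def field_simps)
qed (simp add: field_simps)

lemma zeta1_sums:
  assumes s: "Re s > 1"
  shows "(\<lambda>n. of_nat (Suc n) powr - s) sums (zeta1 s / (s - 1))"
proof -
  have s1: "s - 1 \<noteq> 0" using s by auto
  have "(\<lambda>N. \<Sum>n<N. ups (Suc n) s) \<longlonglongrightarrow> (\<Sum>n. ups (Suc n) s)"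
    using ups_summable[of s] s summable_LIMSEQ by simp
  moreover have "(\<lambda>N. of_nat (Suc N) powr (1 - s)) \<longlonglongrightarrow> (0::complex)" "(\<lambda>N. of_nat (Suc N) powr - s) \<longlonglongrightarrow> (0::complex)"
    using s by (auto intro!: powr_tendsto_0 simp del: of_nat_Suc)
  ultimately have "(\<lambda>N. ((\<Sum>n<N. ups (Suc n) s) + 1 - of_nat (Suc N) powr (1 - s)) / (s - 1) + 1/2 + of_nat (Suc N) powr - s / 2)
     \<longlonglongrightarrow> ((\<Sum>n. ups (Suc n) s) + 1 - 0) / (s - 1) + 1/2 + 0 / 2"
    using s1 by (intro tendsto_intros) auto
  moreover have "((\<Sum>n<N. ups (Suc n) s) + 1 - of_nat (Suc N) powr (1 - s)) / (s - 1) + 1/2 + of_nat (Suc N) powr - s / 2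
     = (\<Sum>n<Suc N. of_nat (Suc n) powr - s)" for N
    unfolding sum_ups using s1 by (simp add: field_simps del: sum.lessThan_Suc of_nat_Suc)
  moreover have "((\<Sum>n. ups (Suc n) s) + 1 - 0) / (s - 1) + 1/2 + 0 / 2 = zeta1 s / (s - 1)"
    using s1 by (simp add: zeta1_def field_simps)
  ultimately have "(\<lambda>N. \<Sum>n<Suc N. of_nat (Suc n) powr - s) \<longlonglongrightarrow> zeta1 s / (s - 1)" by simp
  then show ?thesis unfolding sums_def by (rule LIMSEQ_imp_Suc)
qed

text \<open>The cube stems from the three linear factors in \<open>norm_ups_le\<close>. The half
  plane \<open>Re s \<ge> 1/2\<close> is enough for the growth of xi, the rest following by
  symmetry.\<close>

lemma norm_zeta1_le:
  obtains K where "K > 0" "\<And>s. Re s \<ge> 1/2 \<Longrightarrow> norm (zeta1 s) \<le> K * (1 + norm s) ^ 3"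
proof -
  define T where "T = (\<Sum>n. real (Suc n) powr (-2))"
  have sT: "summable (\<lambda>n. real (Suc n) powr (-2))" by (intro summable_Suc_powr) simp
  have T: "T \<ge> 0" unfolding T_def using sT by (intro suminf_nonneg) auto
  have "norm (zeta1 s) \<le> (2 + T) * (1 + norm s) ^ 3" if s: "Re s \<ge> 1/2" for s
  proof -
    define m where "m = 1 + norm s"
    have m: "m \<ge> 1" by (simp add: m_def)
    have "norm (ups (Suc n) s) \<le> m ^ 3 * real (Suc n) powr (-2)" for n
    proof -
      have 1: "norm (s - 1) \<le> m" "norm s \<le> m" "norm (s + 1) \<le> m"
        using norm_triangle_ineq4[of s 1] norm_triangle_ineq[of s 1] by (auto simp: m_def)
      have "norm (ups (Suc n) s) \<le> norm (s - 1) * norm s * norm (s + 1) / 8 * real (Suc n) powr (- Re s - 2)"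
        by (rule norm_ups_le) (use s in auto)
      also have "\<dots> \<le> m * m * m / 8 * real (Suc n) powr (-2)"
        using 1 s m by (intro mult_mono divide_right_mono powr_mono mult_nonneg_nonneg) auto
      also have "\<dots> \<le> m ^ 3 * real (Suc n) powr (-2)"
        using m by (intro mult_right_mono) (auto simp: power3_eq_cube)
      finally show ?thesis .
    qed
    then have "norm (\<Sum>n. ups (Suc n) s) \<le> (\<Sum>n. m ^ 3 * real (Suc n) powr (-2))"
      by (intro norm_suminf_le summable_mult sT)
    also have "\<dots> = m ^ 3 * T" unfolding T_def by (rule suminf_mult[OF sT])
    finally have A: "norm (\<Sum>n. ups (Suc n) s) \<le> m ^ 3 * T" .
    have "norm (1 + (s - 1) / 2) \<le> 2 * m"
    proof -
      have "1 + (s - 1) / 2 = (1 + s) / 2" by (simp add: field_simps)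
      then have "norm (1 + (s - 1) / 2) = norm (1 + s) / 2" by (simp only: norm_divide) simp
      moreover have "norm (1 + s) \<le> m" using norm_triangle_ineq[of 1 s] by (simp add: m_def)
      ultimately show ?thesis using m by linarith
    qed
    moreover have "m \<le> m ^ 3" using m by (intro self_le_power) auto
    ultimately have "norm (1 + (s - 1) / 2) \<le> 2 * m ^ 3" by linarith
    then have "norm (zeta1 s) \<le> 2 * m ^ 3 + m ^ 3 * T"
      unfolding zeta1_def using A norm_triangle_ineq[of "1 + (s - 1) / 2" "\<Sum>n. ups (Suc n) s"] by linarith
    then show ?thesis by (simp add: m_def algebra_simps)
  qed
  then show ?thesis using that[of "2 + T"] T by simp
qed

text \<open>The main term \<open>1 + (x - 1) / 2\<close> equals \<open>(1 + x) / 2\<close>, while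
  the trapezoidal errors add up to at most \<open>(1 - x) * x * (x + 1) / 8 * (pi^2 / 6)\<close>,
  which is smaller. This excludes real zeros in the strip and gives
  \<open>Xi 0 \<noteq> 0\<close>.\<close>

lemma zeta1_real_pos:
  assumes "0 < x" "x < 1" shows "zeta1 (of_real x) \<noteq> 0"
proof
  assume z: "zeta1 (of_real x) = 0"
  have sT: "summable (\<lambda>n. real (Suc n) powr (-2))" by (intro summable_Suc_powr) simp
  have 6: "(\<lambda>n. 1 / (real n + 1)\<^sup>2) sums (pi\<^sup>2 / 6)" using inverse_squares_sums by (simp add: add.commute)
  have e: "real (Suc n) powr (-2) = 1 / (real n + 1)\<^sup>2" for n
    by (simp add: powr_minus divide_inverse powr_numeral add.commute)
  have b: "norm (ups (Suc n) (of_real x)) \<le> (1 - x) * x * (x + 1) / 8 * (1 / (real n + 1)\<^sup>2)" for n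
  proof -
    have "norm (ups (Suc n) (of_real x)) \<le> norm (complex_of_real x - 1) * norm (complex_of_real x) * norm (complex_of_real x + 1) / 8 * real (Suc n) powr (- x - 2)"
      using norm_ups_le[of "Suc n" "of_real x"] assms by simp
    also have "norm (complex_of_real x - 1) = 1 - x"
      using assms by (metis norm_of_real of_real_1 of_real_diff abs_minus_commute abs_of_pos diff_gt_0_iff_gt)
    also have "norm (complex_of_real x) = x" using assms by simp
    also have "norm (complex_of_real x + 1) = x + 1"
      using assms by (metis norm_of_real of_real_1 of_real_add abs_of_pos add_pos_pos zero_less_one)
    also have "(1 - x) * x * (x + 1) / 8 * real (Suc n) powr (- x - 2) \<le> (1 - x) * x * (x + 1) / 8 * real (Suc n) powr (-2)"
      using assms by (intro mult_left_mono powr_mono) auto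
    finally show ?thesis unfolding e .
  qed
  have "norm (\<Sum>n. ups (Suc n) (of_real x)) \<le> (\<Sum>n. (1 - x) * x * (x + 1) / 8 * (1 / (real n + 1)\<^sup>2))"
    using 6 by (intro norm_suminf_le b summable_mult) (auto simp: sums_iff)
  also have "\<dots> = (1 - x) * x * (x + 1) / 8 * (pi\<^sup>2 / 6)"
    by (simp only: suminf_mult[OF sums_summable[OF 6]] sums_unique[OF 6, symmetric])
  also have "\<dots> \<le> (1 - x) * x * (x + 1) / 8 * (16 / 6)"
  proof -
    have "pi\<^sup>2 \<le> 4\<^sup>2" using pi_less_4 pi_gt_zero by (intro power_mono) auto
    then show ?thesis using assms by (intro mult_left_mono) auto
  qed
  also have "\<dots> < (1 + x) / 2"
  proof -
    have "(1 - x) * x \<le> 1 * 1" using assms by (intro mult_mono) auto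
    then have "(1 - x) * x * (x + 1) \<le> 1 * (x + 1)" using assms by (intro mult_right_mono) auto
    moreover have "A / 8 * (16 / 6) \<le> B / 8 * (16 / 6)" if "A \<le> B" for A B :: real using that by simp
    ultimately have "(1 - x) * x * (x + 1) / 8 * (16 / 6) \<le> 1 * (x + 1) / 8 * (16 / 6)" by blast
    also have "\<dots> < (1 + x) / 2" using assms by simp
    finally show ?thesis .
  qed
  finally have "norm (\<Sum>n. ups (Suc n) (of_real x)) < (1 + x) / 2" .
  moreover have "(\<Sum>n. ups (Suc n) (of_real x)) = - of_real ((1 + x) / 2)"
    using z by (simp add: zeta1_def add_eq_0_iff field_simps)
  then have "norm (\<Sum>n. ups (Suc n) (of_real x)) = (1 + x) / 2"
    using assms by (simp only: norm_minus_cancel norm_of_real) simp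
  ultimately show False by simp
qed

lemma zeta1_1: "zeta1 1 = 1"
proof -
  have "ups (Suc n) 1 = 0" for n using norm_ups_le[of "Suc n" 1] by simp
  then show ?thesis by (simp add: zeta1_def)
qed

section \<open>Mellin transforms\<close>

text \<open>Stated for nonnegative extended integrals, so that the later exchanges of sums and
  integrals ask for measurability only.\<close>

lemma nn_integral_Gamma:
  assumes a: "a > 0" and t: "t > (0::real)"
  shows "(\<integral>\<^sup>+x. ennreal (indicator {0<..} x * (x powr (a - 1) * exp (- (t * x)))) \<partial>lborel) = ennreal (Gamma a * t powr - a)"
proof -
  have "ennreal (Gamma a) = (\<integral>\<^sup>+x. ennreal (indicator {0..} x * x powr (a - 1) / exp x) \<partial>lborel)"
    by (rule Gamma_conv_nn_integral_real[OF a])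
  also have "\<dots> = (\<integral>\<^sup>+x. ennreal (indicator {0<..} x * (x powr (a - 1) * exp (- x))) \<partial>lborel)"
    by (intro nn_integral_cong) (auto simp: indicator_def exp_minus field_simps)
  also have "\<dots> = ennreal \<bar>t\<bar> * (\<integral>\<^sup>+x. ennreal (indicator {0<..} (0 + t * x) * ((0 + t * x) powr (a - 1) * exp (- (0 + t * x)))) \<partial>lborel)"
    by (rule nn_integral_real_affine) (use t in auto)
  also have "\<dots> = ennreal t * (\<integral>\<^sup>+x. ennreal (t powr (a - 1)) * ennreal (indicator {0<..} x * (x powr (a - 1) * exp (- (t * x)))) \<partial>lborel)"
    using t by (intro arg_cong2[where f = times] nn_integral_cong)
      (auto simp: indicator_def powr_mult zero_less_mult_iff ennreal_mult[symmetric] mult_ac)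
  also have "\<dots> = ennreal t * (ennreal (t powr (a - 1)) * (\<integral>\<^sup>+x. ennreal (indicator {0<..} x * (x powr (a - 1) * exp (- (t * x)))) \<partial>lborel))"
    by (subst nn_integral_cmult) auto
  also have "\<dots> = ennreal (t powr a) * (\<integral>\<^sup>+x. ennreal (indicator {0<..} x * (x powr (a - 1) * exp (- (t * x)))) \<partial>lborel)"
    using t by (simp add: mult.assoc[symmetric] ennreal_mult[symmetric] powr_diff)
  finally have eq: "ennreal (Gamma a) = ennreal (t powr a) * (\<integral>\<^sup>+x. ennreal (indicator {0<..} x * (x powr (a - 1) * exp (- (t * x)))) \<partial>lborel)" .
  have "ennreal (Gamma a * t powr - a) = ennreal (t powr - a) * ennreal (Gamma a)"
    using a by (subst ennreal_mult[symmetric]) (auto simp: mult.commute)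
  also have "\<dots> = ennreal (t powr - a * t powr a) * (\<integral>\<^sup>+x. ennreal (indicator {0<..} x * (x powr (a - 1) * exp (- (t * x)))) \<partial>lborel)"
    unfolding eq by (simp add: mult.assoc[symmetric] ennreal_mult[symmetric])
  also have "t powr - a * t powr a = 1" using t by (simp add: powr_add[symmetric])
  finally show ?thesis by simp
qed

lemma has_integral_Gamma:
  assumes a: "a > 0" and t: "t > (0::real)"
  shows "((\<lambda>x. x powr (a - 1) * exp (- (t * x))) has_integral (Gamma a * t powr - a)) {0<..}"
proof -
  have "((\<lambda>x. indicator {0<..} x * (x powr (a - 1) * exp (- (t * x)))) has_integral (Gamma a * t powr - a)) UNIV"
    by (rule nn_integral_has_integral) (use nn_integral_Gamma[OF a t] a in \<open>auto intro: less_imp_le\<close>)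
  then have "((\<lambda>x. if x \<in> {0<..} then x powr (a - 1) * exp (- (t * x)) else 0) has_integral (Gamma a * t powr - a)) UNIV"
    by (rule has_integral_eq[rotated]) auto
  then show ?thesis by (simp only: has_integral_restrict_UNIV)
qed

text \<open>The substitution \<open>y = x^2\<close> in the Gamma integral.\<close>

lemma nn_integral_Gamma_square:
  assumes b: "b > 0" and v: "v > (0::real)"
  shows "(\<integral>\<^sup>+x. ennreal (indicator {0<..} x * (2 * x powr (2 * b - 1) * exp (- (v * x\<^sup>2)))) \<partial>lborel) = ennreal (Gamma b * v powr - b)"
proof -
  let ?f = "\<lambda>y. y powr (b - 1) * exp (- (v * y)) :: real"
  have im: "(\<lambda>x::real. x\<^sup>2) ` {0<..} = {0<..}"
  proof (intro equalityI subsetI)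
    fix y :: real assume "y \<in> {0<..}"
    then show "y \<in> (\<lambda>x. x\<^sup>2) ` {0<..}" by (intro image_eqI[of _ _ "sqrt y"]) auto
  qed auto
  have inj: "inj_on (\<lambda>x::real. x\<^sup>2) {0<..}" by (auto intro!: inj_onI)
  have "?f absolutely_integrable_on {0<..}"
    using has_integral_Gamma[OF b v] by (intro nonnegative_absolutely_integrable_1) auto
  moreover have "integral {0<..} ?f = Gamma b * v powr - b"
    using has_integral_Gamma[OF b v] by (rule integral_unique)
  ultimately have "(\<lambda>x. \<bar>2 * x\<bar> * ?f (x\<^sup>2)) absolutely_integrable_on {0<..} \<and>
      integral {0<..} (\<lambda>x. \<bar>2 * x\<bar> * ?f (x\<^sup>2)) = Gamma b * v powr - b"
    by (subst has_absolute_integral_change_of_variables_1'[of "{0<..}" "\<lambda>x. x\<^sup>2" "\<lambda>x. 2 * x" ?f])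
       (use inj im in \<open>auto intro!: derivative_eq_intros\<close>)
  then have A: "(\<lambda>x. \<bar>2 * x\<bar> * ?f (x\<^sup>2)) absolutely_integrable_on {0<..}"
    and I: "integral {0<..} (\<lambda>x. \<bar>2 * x\<bar> * ?f (x\<^sup>2)) = Gamma b * v powr - b" by (rule conjunct1, rule conjunct2)
  have "((\<lambda>x. \<bar>2 * x\<bar> * ?f (x\<^sup>2)) has_integral (Gamma b * v powr - b)) {0<..}"
    using integrable_integral[OF set_lebesgue_integral_eq_integral(1)[OF A]] unfolding I .
  moreover have "\<bar>2 * x\<bar> * ?f (x\<^sup>2) = 2 * x powr (2 * b - 1) * exp (- (v * x\<^sup>2))" if "x \<in> {0<..}" for x
  proof -
    have "(x\<^sup>2) powr (b - 1) = x powr (2 * (b - 1))"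
      using that by (simp add: powr_powr flip: powr_numeral)
    moreover have "x * x powr (2 * (b - 1)) = x powr (2 * b - 1)"
      using that by (simp add: powr_mult_base algebra_simps)
    ultimately show ?thesis using that by (simp add: mult.assoc[symmetric])
  qed
  ultimately have "((\<lambda>x. 2 * x powr (2 * b - 1) * exp (- (v * x\<^sup>2))) has_integral (Gamma b * v powr - b)) {0<..}"
    by (rule has_integral_eq[rotated])
  from nn_integral_has_integral_lebesgue[OF _ this] show ?thesis by simp
qed

text \<open>Write \<open>1 / (x^2 + a^2)\<close> as the integral of
  \<open>exp (- v * (x^2 + a^2))\<close> over \<open>v > 0\<close> and integrate over
  \<open>x\<close> first: both integrals are then Gamma integrals, with parameters \<open>b\<close>
  and \<open>1 - b\<close>. The two Gamma values are left as a product, the form that the functional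
  equation uses.\<close>

lemma nn_integral_partial_fraction:
  assumes \<sigma>: "0 < \<sigma>" "\<sigma> < 1" and a: "a > (0::real)"
  shows "(\<integral>\<^sup>+x. ennreal (indicator {0<..} x * (x powr (- \<sigma> - 1) * (2 * x / (x\<^sup>2 + a\<^sup>2)))) \<partial>lborel) =
    ennreal (a powr (- \<sigma> - 1) * (Gamma ((1 - \<sigma>) / 2) * Gamma ((1 + \<sigma>) / 2)))"
proof -
  define b where "b = (1 - \<sigma>) / 2"
  have b: "b > 0" "1 - b > 0" using \<sigma> by (auto simp: b_def field_simps)
  define f where "f = (\<lambda>x v. indicator {0<..} x * indicator {0<..} v * (2 * x powr - \<sigma> * exp (- (v * (x\<^sup>2 + a\<^sup>2)))) :: real)"
  have "(\<integral>\<^sup>+x. ennreal (indicator {0<..} x * (x powr (- \<sigma> - 1) * (2 * x / (x\<^sup>2 + a\<^sup>2)))) \<partial>lborel) = (\<integral>\<^sup>+x. \<integral>\<^sup>+v. ennreal (f x v) \<partial>lborel \<partial>lborel)"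
  proof (rule nn_integral_cong)
    fix x :: real
    show "ennreal (indicator {0<..} x * (x powr (- \<sigma> - 1) * (2 * x / (x\<^sup>2 + a\<^sup>2)))) = (\<integral>\<^sup>+v. ennreal (f x v) \<partial>lborel)"
    proof (cases "x > 0")
      case True
      have p: "x\<^sup>2 + a\<^sup>2 > 0" using a by (simp add: add_nonneg_pos)
      have "(\<integral>\<^sup>+v. ennreal (f x v) \<partial>lborel) = (\<integral>\<^sup>+v. ennreal (2 * x powr - \<sigma>) * ennreal (indicator {0<..} v * (v powr (1 - 1) * exp (- ((x\<^sup>2 + a\<^sup>2) * v)))) \<partial>lborel)"
        using True by (intro nn_integral_cong) (auto simp: f_def indicator_def ennreal_mult[symmetric] mult_ac)
      also have "\<dots> = ennreal (2 * x powr - \<sigma>) * ennreal (Gamma 1 * (x\<^sup>2 + a\<^sup>2) powr - 1)"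
        by (subst nn_integral_cmult) (use nn_integral_Gamma[of 1, OF _ p] in auto)
      also have "\<dots> = ennreal (2 * x powr - \<sigma> * (Gamma 1 * (x\<^sup>2 + a\<^sup>2) powr - 1))"
        by (rule ennreal_mult[symmetric]) auto
      also have "2 * x powr - \<sigma> * (Gamma 1 * (x\<^sup>2 + a\<^sup>2) powr - 1) = x powr (- \<sigma> - 1) * (2 * x / (x\<^sup>2 + a\<^sup>2))"
        using True p by (simp add: powr_minus powr_diff field_simps)
      finally show ?thesis using True by simp
    qed (simp add: f_def)
  qed
  also have "\<dots> = (\<integral>\<^sup>+v. \<integral>\<^sup>+x. ennreal (f x v) \<partial>lborel \<partial>lborel)"
    by (rule lborel_pair.Fubini') (simp add: f_def)
  also have "\<dots> = (\<integral>\<^sup>+v. ennreal (Gamma b) * ennreal (indicator {0<..} v * (v powr ((1 - b) - 1) * exp (- (a\<^sup>2 * v)))) \<partial>lborel)"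
  proof (rule nn_integral_cong)
    fix v :: real
    show "(\<integral>\<^sup>+x. ennreal (f x v) \<partial>lborel) = ennreal (Gamma b) * ennreal (indicator {0<..} v * (v powr ((1 - b) - 1) * exp (- (a\<^sup>2 * v))))"
    proof (cases "v > 0")
      case True
      have e: "2 * b - 1 = - \<sigma>" unfolding b_def by (simp add: field_simps)
      have ex: "exp (- (v * (x\<^sup>2 + a\<^sup>2))) = exp (- (a\<^sup>2 * v)) * exp (- (v * x\<^sup>2))" for x
        by (simp add: exp_add[symmetric] algebra_simps)
      have "(\<integral>\<^sup>+x. ennreal (f x v) \<partial>lborel) = (\<integral>\<^sup>+x. ennreal (exp (- (a\<^sup>2 * v))) * ennreal (indicator {0<..} x * (2 * x powr (2 * b - 1) * exp (- (v * x\<^sup>2)))) \<partial>lborel)"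
        using True unfolding e by (intro nn_integral_cong) (auto simp: f_def indicator_def ex ennreal_mult[symmetric] mult_ac)
      also have "\<dots> = ennreal (exp (- (a\<^sup>2 * v))) * ennreal (Gamma b * v powr - b)"
        by (subst nn_integral_cmult) (use nn_integral_Gamma_square[OF b(1) True] in auto)
      also have "\<dots> = ennreal (Gamma b) * ennreal (v powr ((1 - b) - 1) * exp (- (a\<^sup>2 * v)))"
        using b by (simp add: ennreal_mult[symmetric] mult_ac less_imp_le)
      finally show ?thesis using True by simp
    qed (simp add: f_def)
  qed
  also have "\<dots> = ennreal (Gamma b) * ennreal (Gamma (1 - b) * (a\<^sup>2) powr - (1 - b))"
    by (subst nn_integral_cmult) (use nn_integral_Gamma[OF b(2), of "a\<^sup>2"] a in auto)
  also have "\<dots> = ennreal (Gamma b * (Gamma (1 - b) * (a\<^sup>2) powr - (1 - b)))"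
    using b by (intro ennreal_mult[symmetric]) (auto intro: less_imp_le)
  also have "(a\<^sup>2) powr - (1 - b) = a powr (2 * - (1 - b))"
    using a by (simp add: powr_powr flip: powr_numeral)
  also have "2 * - (1 - b) = - \<sigma> - 1" by (simp add: b_def field_simps)
  also have "1 - b = (1 + \<sigma>) / 2" by (simp add: b_def field_simps)
  finally show ?thesis by (simp add: b_def mult_ac)
qed

section \<open>Errors of the trapezoidal rule as integrals\<close>

definition trapk :: "nat \<Rightarrow> real \<Rightarrow> real" where
  "trapk n t = indicator {real n<..<real (Suc n)} t * ((t - real n) * (real (Suc n) - t) / 2)"

lemma trapk_nonneg: "trapk n t \<ge> 0" by (auto simp: trapk_def indicator_def)

lemma trapk_measurable [measurable]: "trapk n \<in> borel_measurable borel"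
  unfolding trapk_def by measurable

lemma nn_integral_trapk:
  assumes "\<And>t. t \<in> {real n<..<real (Suc n)} \<Longrightarrow> 0 \<le> g t"
    and "((\<lambda>t. (t - real n) * (real (Suc n) - t) / 2 * g t) has_integral I) {real n..real (Suc n)}"
  shows "(\<integral>\<^sup>+t. ennreal (trapk n t * g t) \<partial>lborel) = ennreal I"
proof -
  have "((\<lambda>t. (t - real n) * (real (Suc n) - t) / 2 * g t) has_integral I) {real n<..<real (Suc n)}"
    using assms(2) by (simp add: has_integral_Icc_iff_Ioo)
  from nn_integral_has_integral_lebesgue[OF _ this] assms(1) show ?thesis
    by (simp add: trapk_def mult.assoc)
qed

text \<open>Two integrations by parts. The Peano kernel vanishes at both ends, and its derivative
  takes the values 1/2 and - 1/2 there, which produces the mean of the end values of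
  \<open>\<phi>\<close>.\<close>

lemma trapezoid_has_integral:
  fixes \<phi> \<phi>' \<phi>'' \<Phi> :: "real \<Rightarrow> real"
  assumes "\<And>t. t \<in> {real n..real (Suc n)} \<Longrightarrow> (\<Phi> has_real_derivative \<phi> t) (at t)"
    "\<And>t. t \<in> {real n..real (Suc n)} \<Longrightarrow> (\<phi> has_real_derivative \<phi>' t) (at t)"
    "\<And>t. t \<in> {real n..real (Suc n)} \<Longrightarrow> (\<phi>' has_real_derivative \<phi>'' t) (at t)"
  shows "((\<lambda>t. (t - real n) * (real (Suc n) - t) / 2 * \<phi>'' t) has_integral
    ((\<phi> (real n) + \<phi> (real (Suc n))) / 2 - (\<Phi> (real (Suc n)) - \<Phi> (real n)))) {real n..real (Suc n)}"
proof -
  define H where "H = (\<lambda>t. (t - real n) * (real (Suc n) - t) / 2 * \<phi>' t - (2 * real n + 1 - 2 * t) / 2 * \<phi> t - \<Phi> t)"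
  have "((\<lambda>t. (t - real n) * (real (Suc n) - t) / 2 * \<phi>'' t) has_integral (H (real (Suc n)) - H (real n))) {real n..real (Suc n)}"
  proof (rule fundamental_theorem_of_calculus)
    fix t assume t: "t \<in> {real n..real (Suc n)}"
    have k: "((\<lambda>t. (t - real n) * (real (Suc n) - t) / 2) has_real_derivative (2 * real n + 1 - 2 * t) / 2) (at t)"
      by (auto intro!: derivative_eq_intros simp: field_simps)
    have l: "((\<lambda>t. (2 * real n + 1 - 2 * t) / 2) has_real_derivative - 1) (at t)"
      by (auto intro!: derivative_eq_intros)
    have "(H has_real_derivative (t - real n) * (real (Suc n) - t) / 2 * \<phi>'' t) (at t)"
      unfolding H_def
      by (rule DERIV_cong[OF DERIV_diff[OF DERIV_diff[OF DERIV_mult[OF k assms(3)[OF t]]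
            DERIV_mult[OF l assms(2)[OF t]]] assms(1)[OF t]]]) simp
    then show "(H has_vector_derivative (t - real n) * (real (Suc n) - t) / 2 * \<phi>'' t) (at t within {real n..real (Suc n)})"
      by (simp add: has_real_derivative_iff_has_vector_derivative has_vector_derivative_at_within)
  qed simp
  moreover have "H (real (Suc n)) - H (real n) = (\<phi> (real n) + \<phi> (real (Suc n))) / 2 - (\<Phi> (real (Suc n)) - \<Phi> (real n))"
    by (simp add: H_def field_simps)
  ultimately show ?thesis by simp
qed

definition trap_exp :: "nat \<Rightarrow> real \<Rightarrow> real" where
  "trap_exp n x = exp (- (real n * x)) * ((1 + exp (- x)) / 2 - (1 - exp (- x)) / x)"

lemma trap_exp_has_integral:
  assumes x: "x > 0"
  shows "((\<lambda>t. (t - real n) * (real (Suc n) - t) / 2 * (x\<^sup>2 * exp (- (t * x)))) has_integral trap_exp n x) {real n..real (Suc n)}"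
proof -
  have "((\<lambda>t. (t - real n) * (real (Suc n) - t) / 2 * (x\<^sup>2 * exp (- (t * x)))) has_integral
    ((exp (- (real n * x)) + exp (- (real (Suc n) * x))) / 2 - (- exp (- (real (Suc n) * x)) / x - (- exp (- (real n * x)) / x)))) {real n..real (Suc n)}"
    by (rule trapezoid_has_integral[where \<phi>' = "\<lambda>t. - x * exp (- (t * x))"])
       (use x in \<open>auto intro!: derivative_eq_intros simp: power2_eq_square\<close>)
  also have "(exp (- (real n * x)) + exp (- (real (Suc n) * x))) / 2 - (- exp (- (real (Suc n) * x)) / x - (- exp (- (real n * x)) / x)) = trap_exp n x"
  proof -
    have "exp (- (real (Suc n) * x)) = exp (- (real n * x)) * exp (- x)" by (simp add: exp_add[symmetric] algebra_simps)
    then show ?thesis using x by (simp only: trap_exp_def) (simp add: field_simps)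
  qed
  finally show ?thesis .
qed

lemma nn_integral_trap_exp:
  assumes "x > 0"
  shows "(\<integral>\<^sup>+t. ennreal (trapk n t * (x\<^sup>2 * exp (- (t * x)))) \<partial>lborel) = ennreal (trap_exp n x)"
  by (intro nn_integral_trapk trap_exp_has_integral assms) auto

lemma trap_exp_nonneg: "x > 0 \<Longrightarrow> trap_exp n x \<ge> 0"
  by (rule has_integral_nonneg[OF trap_exp_has_integral]) auto

lemma trap_exp_sums:
  assumes x: "x > 0"
  shows "(\<lambda>n. trap_exp n x) sums ((1 + exp (- x)) / (2 * (1 - exp (- x))) - 1 / x)"
proof -
  have "(\<lambda>n. exp (- x) ^ n * ((1 + exp (- x)) / 2 - (1 - exp (- x)) / x)) sums (1 / (1 - exp (- x)) * ((1 + exp (- x)) / 2 - (1 - exp (- x)) / x))"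
    using x by (intro sums_mult2 geometric_sums) auto
  moreover have "exp (- x) ^ n = exp (- (real n * x))" for n
    by (simp add: exp_of_nat_mult[symmetric])
  moreover have "1 / (1 - exp (- x)) * ((1 + exp (- x)) / 2 - (1 - exp (- x)) / x) = (1 + exp (- x)) / (2 * (1 - exp (- x))) - 1 / x"
    using x by (simp add: field_simps)
  ultimately show ?thesis by (simp add: trap_exp_def)
qed

text \<open>The trapezoidal error of \<open>t powr \<sigma>\<close> on \<open>[n, n + 1]\<close>,
  divided by the factor \<open>\<sigma> * (\<sigma> - 1)\<close> of the second derivative. It is
  meant for \<open>n = 0\<close> as well.\<close>

definition trap_powr :: "real \<Rightarrow> nat \<Rightarrow> real" where
  "trap_powr \<sigma> n = ((real n powr \<sigma> + real (Suc n) powr \<sigma>) / 2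
     - (real (Suc n) powr (1 + \<sigma>) - real n powr (1 + \<sigma>)) / (1 + \<sigma>)) / (\<sigma> * (\<sigma> - 1))"

lemma trap_powr_has_integral:
  assumes \<sigma>: "0 < \<sigma>" "\<sigma> < 1"
  shows "((\<lambda>t. (t - real n) * (real (Suc n) - t) / 2 * t powr (\<sigma> - 2)) has_integral trap_powr \<sigma> n) {real n..real (Suc n)}"
proof (cases "n = 0")
  case True
  \<comment> \<open>On \<open>[0, 1]\<close> the second derivative is singular at 0, but times the
    kernel it is the integrable \<open>(x powr (\<sigma> - 1) - x powr \<sigma>) / 2\<close>, which
    is integrated directly.\<close>
  have p: "((\<lambda>x. (1/2) * (x powr (\<sigma> - 1) - x powr \<sigma>)) has_integral ((1/2) * (1 powr (\<sigma> - 1 + 1) / (\<sigma> - 1 + 1) - 1 powr (\<sigma> + 1) / (\<sigma> + 1)))) {0..1}"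
    by (intro has_integral_mult_right has_integral_diff has_integral_powr_from_0) (use \<sigma> in auto)
  have "((\<lambda>t. (t - real n) * (real (Suc n) - t) / 2 * t powr (\<sigma> - 2)) has_integral ((1/2) * (1 powr (\<sigma> - 1 + 1) / (\<sigma> - 1 + 1) - 1 powr (\<sigma> + 1) / (\<sigma> + 1)))) {0..1}"
  proof (rule has_integral_eq[OF _ p])
    fix x :: real assume "x \<in> {0..1}"
    then show "1 / 2 * (x powr (\<sigma> - 1) - x powr \<sigma>) = (x - real n) * (real (Suc n) - x) / 2 * x powr (\<sigma> - 2)"
      using True by (cases "x = 0") (auto simp: powr_diff power2_eq_square field_simps)
  qed
  moreover have "(1/2) * (1 powr (\<sigma> - 1 + 1) / (\<sigma> - 1 + 1) - 1 powr (\<sigma> + 1) / (\<sigma> + 1)) = trap_powr \<sigma> n"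
  proof -
    have "1/2 - 1 / (1 + \<sigma>) = (\<sigma> - 1) / (2 * (1 + \<sigma>))" using \<sigma> by (simp add: field_simps)
    then have "trap_powr \<sigma> n = (\<sigma> - 1) / (2 * (1 + \<sigma>)) / (\<sigma> * (\<sigma> - 1))" using True by (simp add: trap_powr_def)
    also have "\<dots> = 1 / (2 * \<sigma> * (1 + \<sigma>))" using \<sigma> by simp
    also have "\<dots> = (1/2) * (1 powr (\<sigma> - 1 + 1) / (\<sigma> - 1 + 1) - 1 powr (\<sigma> + 1) / (\<sigma> + 1))"
      using \<sigma> by (simp add: field_simps)
    finally show ?thesis by simp
  qed
  ultimately show ?thesis using True by simp
next
  case False
  have "((\<lambda>t. (t - real n) * (real (Suc n) - t) / 2 * (\<sigma> * (\<sigma> - 1) * t powr (\<sigma> - 2))) has_integral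
    ((real n powr \<sigma> + real (Suc n) powr \<sigma>) / 2 - (real (Suc n) powr (1 + \<sigma>) / (1 + \<sigma>) - real n powr (1 + \<sigma>) / (1 + \<sigma>)))) {real n..real (Suc n)}"
  proof (rule trapezoid_has_integral[where \<phi>' = "\<lambda>t. \<sigma> * t powr (\<sigma> - 1)" and \<Phi> = "\<lambda>t. t powr (1 + \<sigma>) / (1 + \<sigma>)"])
    fix t assume "t \<in> {real n..real (Suc n)}"
    then have t: "t > 0" using False by (auto intro: less_le_trans)
    show "((\<lambda>t. t powr (1 + \<sigma>) / (1 + \<sigma>)) has_real_derivative t powr \<sigma>) (at t)"
      by (rule DERIV_cong[OF DERIV_cdivide[OF has_real_derivative_powr[OF t]]]) (use \<sigma> in simp)
    show "((\<lambda>t. t powr \<sigma>) has_real_derivative \<sigma> * t powr (\<sigma> - 1)) (at t)"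
      by (rule has_real_derivative_powr[OF t])
    have "((\<lambda>t. t powr (\<sigma> - 1)) has_real_derivative (\<sigma> - 1) * t powr (\<sigma> - 1 - 1)) (at t)"
      by (rule has_real_derivative_powr[OF t])
    from DERIV_cmult[OF this, of \<sigma>] show "((\<lambda>t. \<sigma> * t powr (\<sigma> - 1)) has_real_derivative \<sigma> * (\<sigma> - 1) * t powr (\<sigma> - 2)) (at t)"
      by (simp add: mult.assoc)
  qed
  from has_integral_divide[OF this, of "\<sigma> * (\<sigma> - 1)"]
  have "((\<lambda>t. (t - real n) * (real (Suc n) - t) / 2 * (\<sigma> * (\<sigma> - 1) * t powr (\<sigma> - 2)) / (\<sigma> * (\<sigma> - 1))) has_integral trap_powr \<sigma> n) {real n..real (Suc n)}"
    by (simp only: trap_powr_def diff_divide_distrib)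
  moreover have "(t - real n) * (real (Suc n) - t) / 2 * (\<sigma> * (\<sigma> - 1) * t powr (\<sigma> - 2)) / (\<sigma> * (\<sigma> - 1)) =
      (t - real n) * (real (Suc n) - t) / 2 * t powr (\<sigma> - 2)" for t
  proof -
    have "X * (c * P) / c = X * P" if "c \<noteq> 0" for X c P :: real using that by simp
    moreover have "\<sigma> * (\<sigma> - 1) \<noteq> 0" using \<sigma> by simp
    ultimately show ?thesis by blast
  qed
  ultimately show ?thesis by (simp only:)
qed

lemma nn_integral_trap_powr:
  assumes "0 < \<sigma>" "\<sigma> < 1"
  shows "(\<integral>\<^sup>+t. ennreal (trapk n t * t powr (\<sigma> - 2)) \<partial>lborel) = ennreal (trap_powr \<sigma> n)"
  by (intro nn_integral_trapk trap_powr_has_integral assms) auto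

lemma trap_powr_nonneg:
  assumes "0 < \<sigma>" "\<sigma> < 1" shows "trap_powr \<sigma> n \<ge> 0"
  by (rule has_integral_nonneg[OF trap_powr_has_integral[OF assms]]) auto

section \<open>The functional equation\<close>

text \<open>The imaginary part of the series for \<open>Digamma (1 + z) - Digamma (1 - z)\<close> at
  \<open>z = \<i> * x / (2 * pi)\<close>. Recurrence and reflection evaluate the same difference by
  the cotangent, which becomes hyperbolic there: the limit is
  \<open>coth (x / 2) / 2 - 1 / x\<close>.\<close>

lemma coth_partial_fractions:
  assumes x: "x > (0::real)"
  shows "(\<lambda>m. 2 * x / (x\<^sup>2 + (2 * pi * real (Suc m))\<^sup>2)) sums ((1 + exp (- x)) / (2 * (1 - exp (- x))) - 1 / x)"
proof -
  define y where "y = x / (2 * pi)"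
  have y: "y > 0" using x by (simp add: y_def)
  define z where "z = \<i> * of_real y"
  have zZ: "z \<notin> \<int>" using y by (auto elim!: Ints_cases simp: z_def complex_eq_iff)
  have z0: "z \<noteq> 0" using zZ by auto
  have nz: "1 + z \<noteq> 0" "1 - z \<noteq> 0" by (auto simp: z_def complex_eq_iff)
  have D: "(\<lambda>k. inverse (of_nat (Suc k)) - inverse (w + of_nat k)) sums (Digamma w + euler_mascheroni)" if "w \<noteq> 0" for w :: complex
    using summable_sums[OF summable_Digamma[OF that]] by (simp add: Digamma_def)
  have "(\<lambda>k. (inverse (of_nat (Suc k)) - inverse (1 + z + of_nat k)) - (inverse (of_nat (Suc k)) - inverse (1 - z + of_nat k)))
      sums ((Digamma (1 + z) + euler_mascheroni) - (Digamma (1 - z) + euler_mascheroni))"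
    by (intro sums_diff D nz)
  then have s: "(\<lambda>k. Im (inverse (1 - z + of_nat k) - inverse (1 + z + of_nat k))) sums Im (Digamma (1 + z) - Digamma (1 - z))"
    by (intro sums_Im) simp
  have term_eq: "Im (inverse (1 - z + of_nat k) - inverse (1 + z + of_nat k)) = 2 * y / (y\<^sup>2 + (real (Suc k))\<^sup>2)" for k
    by (simp add: z_def inverse_eq_divide Im_divide power2_eq_square add_divide_distrib[symmetric] algebra_simps)
  have dig: "Digamma (1 + z) - Digamma (1 - z) = 1 / z - of_real pi * cot (of_real pi * z)"
    using Digamma_plus1[OF z0] Digamma_reflection[OF zZ] by (simp add: add.commute algebra_simps)
  have sin_e: "sin (of_real pi * z) = \<i> * of_real ((exp (pi * y) - exp (- (pi * y))) / 2)"
    by (simp add: sin_exp_eq z_def exp_of_real[symmetric] field_simps)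
  have cos_e: "cos (of_real pi * z) = of_real ((exp (pi * y) + exp (- (pi * y))) / 2)"
    by (simp add: cos_exp_eq z_def exp_of_real[symmetric] field_simps)
  define c where "c = (exp (pi * y) + exp (- (pi * y))) / (exp (pi * y) - exp (- (pi * y)))"
  have ne: "exp (pi * y) - exp (- (pi * y)) > 0" using y by simp
  have "cot (of_real pi * z) = of_real ((exp (pi * y) + exp (- (pi * y))) / 2) / (\<i> * of_real ((exp (pi * y) - exp (- (pi * y))) / 2))"
    by (simp only: cot_def sin_e cos_e)
  also have "\<dots> = - \<i> * of_real (((exp (pi * y) + exp (- (pi * y))) / 2) / ((exp (pi * y) - exp (- (pi * y))) / 2))"
  proof -
    have "of_real a / (\<i> * of_real b) = - \<i> * of_real (a / b)" for a b :: real
      by (cases "b = 0") (simp_all add: complex_eq_iff Re_divide Im_divide power2_eq_square)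
    then show ?thesis .
  qed
  also have "((exp (pi * y) + exp (- (pi * y))) / 2) / ((exp (pi * y) - exp (- (pi * y))) / 2) = c"
  proof -
    have "(a / 2) / (b / 2) = a / b" for a b :: real by simp
    then show ?thesis unfolding c_def .
  qed
  finally have cot: "cot (of_real pi * z) = - \<i> * of_real c" .
  have c: "c = (1 + exp (- x)) / (1 - exp (- x))"
  proof -
    have e: "exp (- x) = exp (- (pi * y)) * exp (- (pi * y))" by (simp add: exp_add[symmetric] y_def)
    have "c = (exp (- (pi * y)) * (exp (pi * y) + exp (- (pi * y)))) / (exp (- (pi * y)) * (exp (pi * y) - exp (- (pi * y))))"
      unfolding c_def by simp
    also have "\<dots> = (1 + exp (- x)) / (1 - exp (- x))"
      unfolding distrib_left right_diff_distrib e by (simp add: exp_add[symmetric])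
    finally show ?thesis .
  qed
  have "Im (Digamma (1 + z) - Digamma (1 - z)) = pi * c - 1 / y"
    unfolding dig cot using y by (simp add: z_def Im_divide power2_eq_square)
  with s have "(\<lambda>k. 2 * y / (y\<^sup>2 + (real (Suc k))\<^sup>2)) sums (pi * c - 1 / y)"
    by (simp only: term_eq)
  then have A: "(\<lambda>k. 1 / (2 * pi) * (2 * y / (y\<^sup>2 + (real (Suc k))\<^sup>2))) sums (1 / (2 * pi) * (pi * c - 1 / y))"
    by (rule sums_mult)
  have B: "1 / (2 * pi) * (2 * y / (y\<^sup>2 + (real (Suc k))\<^sup>2)) = 2 * x / (x\<^sup>2 + (2 * pi * real (Suc k))\<^sup>2)" for k
  proof -
    have "x = 2 * pi * y" by (simp add: y_def)
    then have q: "x\<^sup>2 + (2 * pi * real (Suc k))\<^sup>2 = 4 * pi\<^sup>2 * (y\<^sup>2 + (real (Suc k))\<^sup>2)"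
      by (simp add: power2_eq_square algebra_simps)
    have "y\<^sup>2 + (real (Suc k))\<^sup>2 > 0" using y by (simp add: add_pos_nonneg)
    moreover have "1 / (2 * pi) * (2 * y / Q) = 2 * (2 * pi * y) / (4 * pi\<^sup>2 * Q)" if "Q > 0" for Q
    proof -
      have "4 * pi\<^sup>2 * Q = (4 * pi) * (pi * Q)" by (simp add: power2_eq_square)
      then have "2 * (2 * pi * y) / (4 * pi\<^sup>2 * Q) = (4 * pi) * y / ((4 * pi) * (pi * Q))" by (simp only: mult.assoc)
      also have "\<dots> = y / (pi * Q)" by (rule mult_divide_mult_cancel_left) simp
      finally show ?thesis by simp
    qed
    ultimately have "1 / (2 * pi) * (2 * y / (y\<^sup>2 + (real (Suc k))\<^sup>2)) = 2 * (2 * pi * y) / (4 * pi\<^sup>2 * (y\<^sup>2 + (real (Suc k))\<^sup>2))"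
      by blast
    then show ?thesis unfolding q by (simp only: \<open>x = 2 * pi * y\<close>)
  qed
  have C: "1 / (2 * pi) * (pi * c - 1 / y) = (1 + exp (- x)) / (2 * (1 - exp (- x))) - 1 / x"
  proof -
    have "1 / (2 * pi) * (pi * c - 1 / y) = 1 / (2 * pi) * (pi * c) - 1 / (2 * pi) * (1 / y)"
      by (rule right_diff_distrib)
    also have "1 / (2 * pi) * (pi * c) = c / 2" by simp
    also have "1 / (2 * pi) * (1 / y) = 1 / x" by (simp add: y_def)
    also have "c / 2 = (1 + exp (- x)) / (2 * (1 - exp (- x)))"
      unfolding c by (simp only: divide_divide_eq_left mult.commute[of 2])
    finally show ?thesis .
  qed
  show ?thesis using A unfolding B C .
qed

lemma suminf_ennreal_sums:
  assumes "\<And>n. 0 \<le> f n" "f sums s" shows "(\<Sum>n. ennreal (f n)) = ennreal s"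
  using suminf_ennreal2[OF assms(1) sums_summable[OF assms(2)]] unfolding sums_unique[OF assms(2), symmetric] .

text \<open>Both sides equal the Mellin transform of \<open>coth (x / 2) / 2 - 1 / x\<close>, which is at the same time a
  sum of trapezoidal errors of \<open>exp (- t x)\<close> and a sum of partial fractions.\<close>
lemma trap_powr_suminf:
  assumes \<sigma>: "0 < \<sigma>" "\<sigma> < 1"
  shows "(\<Sum>n. ennreal (Gamma (2 - \<sigma>) * trap_powr \<sigma> n)) =
    (\<Sum>m. ennreal ((2 * pi * real (Suc m)) powr (- \<sigma> - 1) * (Gamma ((1 - \<sigma>) / 2) * Gamma ((1 + \<sigma>) / 2))))"
proof -
  have G: "Gamma (2 - \<sigma>) > 0" using \<sigma> by (intro Gamma_real_pos) simp
  \<comment> \<open>The weight of the Mellin transform at \<open>- \<sigma>\<close>, cut off to the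
    positive half line.\<close>
  define w where "w = (\<lambda>x::real. indicator {0<..} x * x powr (- \<sigma> - 1))"
  have w0: "w x \<ge> 0" for x by (simp add: w_def)
  have [measurable]: "w \<in> borel_measurable borel" unfolding w_def by measurable
  \<comment> \<open>Tonelli for the product of the Peano kernel, the weight and
    \<open>x^2 * exp (- t * x)\<close>: integrating over \<open>x\<close> gives
    \<open>Gamma (2 - \<sigma>) * t powr (\<sigma> - 2)\<close>, integrating over \<open>t\<close>
    gives \<open>trap_exp n x\<close>.\<close>
  have L: "ennreal (Gamma (2 - \<sigma>) * trap_powr \<sigma> n) = (\<integral>\<^sup>+x. ennreal (w x * trap_exp n x) \<partial>lborel)" for n
  proof -
    define f where "f = (\<lambda>t x. trapk n t * w x * (x\<^sup>2 * exp (- (t * x))))"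
    have "ennreal (Gamma (2 - \<sigma>) * trap_powr \<sigma> n) = ennreal (Gamma (2 - \<sigma>)) * (\<integral>\<^sup>+t. ennreal (trapk n t * t powr (\<sigma> - 2)) \<partial>lborel)"
      unfolding nn_integral_trap_powr[OF \<sigma>] using G trap_powr_nonneg[OF \<sigma>] by (intro ennreal_mult) auto
    also have "\<dots> = (\<integral>\<^sup>+t. ennreal (Gamma (2 - \<sigma>)) * ennreal (trapk n t * t powr (\<sigma> - 2)) \<partial>lborel)"
      by (rule nn_integral_cmult[symmetric]) simp
    also have "\<dots> = (\<integral>\<^sup>+t. \<integral>\<^sup>+x. ennreal (f t x) \<partial>lborel \<partial>lborel)"
    proof (rule nn_integral_cong)
      fix t :: real
      show "ennreal (Gamma (2 - \<sigma>)) * ennreal (trapk n t * t powr (\<sigma> - 2)) = (\<integral>\<^sup>+x. ennreal (f t x) \<partial>lborel)"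
      proof (cases "t \<in> {real n<..<real (Suc n)}")
        case True
        then have t: "t > 0" by (auto intro: le_less_trans[of 0 "real n"])
        have "(\<integral>\<^sup>+x. ennreal (f t x) \<partial>lborel) = (\<integral>\<^sup>+x. ennreal (trapk n t) * ennreal (indicator {0<..} x * (x powr ((2 - \<sigma>) - 1) * exp (- (t * x)))) \<partial>lborel)"
        proof (rule nn_integral_cong)
          fix x :: real
          have "x powr (- \<sigma> - 1) * x\<^sup>2 = x powr ((2 - \<sigma>) - 1)" if "x > 0"
          proof -
            have "x powr (- \<sigma> - 1) * x powr 2 = x powr ((2 - \<sigma>) - 1)" unfolding powr_add[symmetric] by simp
            then show ?thesis using that by simp
          qed
          then show "ennreal (f t x) = ennreal (trapk n t) * ennreal (indicator {0<..} x * (x powr ((2 - \<sigma>) - 1) * exp (- (t * x))))"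
            using trapk_nonneg[of n t]
            by (auto simp: f_def w_def indicator_def ennreal_mult[symmetric] mult_ac)
        qed
        also have "\<dots> = ennreal (trapk n t) * ennreal (Gamma (2 - \<sigma>) * t powr - (2 - \<sigma>))"
          by (subst nn_integral_cmult) (use nn_integral_Gamma[of "2 - \<sigma>", OF _ t] \<sigma> in auto)
        also have "\<dots> = ennreal (Gamma (2 - \<sigma>)) * ennreal (trapk n t * t powr (\<sigma> - 2))"
          using G trapk_nonneg[of n t] by (simp add: ennreal_mult[symmetric] mult_ac)
        finally show ?thesis by simp
      qed (simp add: f_def trapk_def)
    qed
    also have "\<dots> = (\<integral>\<^sup>+x. \<integral>\<^sup>+t. ennreal (f t x) \<partial>lborel \<partial>lborel)"
      by (rule lborel_pair.Fubini'[symmetric]) (simp add: f_def)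
    also have "\<dots> = (\<integral>\<^sup>+x. ennreal (w x * trap_exp n x) \<partial>lborel)"
    proof (rule nn_integral_cong)
      fix x :: real
      show "(\<integral>\<^sup>+t. ennreal (f t x) \<partial>lborel) = ennreal (w x * trap_exp n x)"
      proof (cases "x > 0")
        case True
        have "(\<integral>\<^sup>+t. ennreal (f t x) \<partial>lborel) = (\<integral>\<^sup>+t. ennreal (w x) * ennreal (trapk n t * (x\<^sup>2 * exp (- (t * x)))) \<partial>lborel)"
          using w0[of x] trapk_nonneg[of n]
          by (intro nn_integral_cong) (auto simp: f_def ennreal_mult[symmetric] mult_ac)
        also have "\<dots> = ennreal (w x) * ennreal (trap_exp n x)"
          by (subst nn_integral_cmult) (simp_all add: nn_integral_trap_exp[OF True])
        finally show ?thesis using w0[of x] trap_exp_nonneg[OF True] by (simp add: ennreal_mult)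
      qed (simp add: f_def w_def)
    qed
    finally show ?thesis .
  qed
  have R: "ennreal ((2 * pi * real (Suc m)) powr (- \<sigma> - 1) * (Gamma ((1 - \<sigma>) / 2) * Gamma ((1 + \<sigma>) / 2))) =
      (\<integral>\<^sup>+x. ennreal (w x * (2 * x / (x\<^sup>2 + (2 * pi * real (Suc m))\<^sup>2))) \<partial>lborel)" for m
    using nn_integral_partial_fraction[OF \<sigma>, of "2 * pi * real (Suc m)"] by (simp add: w_def mult.assoc)
  have [measurable]: "trap_exp n \<in> borel_measurable borel" for n unfolding trap_exp_def by measurable
  have "(\<Sum>n. ennreal (Gamma (2 - \<sigma>) * trap_powr \<sigma> n)) = (\<integral>\<^sup>+x. (\<Sum>n. ennreal (w x * trap_exp n x)) \<partial>lborel)"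
    unfolding L by (rule nn_integral_suminf[symmetric]) simp
  also have "\<dots> = (\<integral>\<^sup>+x. (\<Sum>m. ennreal (w x * (2 * x / (x\<^sup>2 + (2 * pi * real (Suc m))\<^sup>2)))) \<partial>lborel)"
  proof (rule nn_integral_cong)
    fix x :: real
    show "(\<Sum>n. ennreal (w x * trap_exp n x)) = (\<Sum>m. ennreal (w x * (2 * x / (x\<^sup>2 + (2 * pi * real (Suc m))\<^sup>2))))"
    proof (cases "x > 0")
      case True
      have "(\<Sum>n. ennreal (w x * trap_exp n x)) = ennreal (w x * ((1 + exp (- x)) / (2 * (1 - exp (- x))) - 1 / x))"
        by (intro suminf_ennreal_sums sums_mult trap_exp_sums True mult_nonneg_nonneg w0 trap_exp_nonneg)
      moreover have "(\<Sum>m. ennreal (w x * (2 * x / (x\<^sup>2 + (2 * pi * real (Suc m))\<^sup>2)))) = ennreal (w x * ((1 + exp (- x)) / (2 * (1 - exp (- x))) - 1 / x))"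
        by (intro suminf_ennreal_sums sums_mult coth_partial_fractions True mult_nonneg_nonneg w0) (use True in simp)
      ultimately show ?thesis by simp
    qed (simp add: w_def)
  qed
  also have "\<dots> = (\<Sum>m. ennreal ((2 * pi * real (Suc m)) powr (- \<sigma> - 1) * (Gamma ((1 - \<sigma>) / 2) * Gamma ((1 + \<sigma>) / 2))))"
    unfolding R by (rule nn_integral_suminf) simp
  finally show ?thesis .
qed

text \<open>At \<open>s = - \<sigma>\<close> the interpolated function is
  \<open>t powr \<sigma>\<close>. The constant is the factor \<open>s - 1\<close> of
  \<open>ups\<close> times the divisor \<open>\<sigma> * (\<sigma> - 1)\<close> of
  \<open>trap_powr\<close>.\<close>

lemma ups_trap_powr:
  assumes \<sigma>: "0 < \<sigma>" "\<sigma> < 1"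
  shows "ups (Suc n) (of_real (- \<sigma>)) = of_real (\<sigma> * (1 + \<sigma>) * (1 - \<sigma>) * trap_powr \<sigma> (Suc n))"
proof -
  have p: "of_nat (Suc m) powr complex_of_real y = of_real (real (Suc m) powr y)" for m y
    using powr_of_real[of "real (Suc m)" y] by simp
  define A where "A = real (Suc n) powr \<sigma>"
  define B where "B = real (Suc (Suc n)) powr \<sigma>"
  define A' where "A' = real (Suc n) powr (1 + \<sigma>)"
  define B' where "B' = real (Suc (Suc n)) powr (1 + \<sigma>)"
  have e: "1 - complex_of_real (- \<sigma>) = of_real (1 + \<sigma>)" "- complex_of_real (- \<sigma>) = of_real \<sigma>" by simp_all
  have "ups (Suc n) (of_real (- \<sigma>)) = of_real ((- \<sigma> - 1) * (A + B) / 2 + B' - A')"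
    unfolding ups_def e p A_def B_def A'_def B'_def by simp
  also have "(- \<sigma> - 1) * (A + B) / 2 + B' - A' = \<sigma> * (1 + \<sigma>) * (1 - \<sigma>) * (((A + B) / 2 - (B' - A') / (1 + \<sigma>)) / (\<sigma> * (\<sigma> - 1)))"
  proof -
    have "\<sigma> * (1 + \<sigma>) * (1 - \<sigma>) * (X / (\<sigma> * (\<sigma> - 1))) = - ((1 + \<sigma>) * X)" for X
      using \<sigma> by (simp add: divide_simps) (simp add: algebra_simps)
    moreover have "(1 + \<sigma>) * ((A + B) / 2 - (B' - A') / (1 + \<sigma>)) = (1 + \<sigma>) * (A + B) / 2 - (B' - A')"
    proof -
      have "c * (P / 2 - Q / c) = c * P / 2 - Q" if "c \<noteq> 0" for c P Q :: real
        using that by (simp add: right_diff_distrib)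
      then show ?thesis using \<sigma> by simp
    qed
    moreover have "(- \<sigma> - 1) * (A + B) / 2 + B' - A' = - ((1 + \<sigma>) * (A + B) / 2 - (B' - A'))"
      by (simp add: field_simps)
    ultimately show ?thesis by (simp only:)
  qed
  also have "((A + B) / 2 - (B' - A') / (1 + \<sigma>)) / (\<sigma> * (\<sigma> - 1)) = trap_powr \<sigma> (Suc n)"
    by (simp add: trap_powr_def A_def B_def A'_def B'_def)
  finally show ?thesis .
qed

text \<open>The part \<open>1 + (s - 1) / 2\<close> of \<open>zeta1\<close> outside the series is
  exactly the missing error on \<open>[0, 1]\<close>, so the sum runs over all \<open>n\<close> from
  0.\<close>

lemma zeta1_negative:
  assumes \<sigma>: "0 < \<sigma>" "\<sigma> < 1"
  obtains s where "trap_powr \<sigma> sums s" "zeta1 (of_real (- \<sigma>)) = of_real (\<sigma> * (1 + \<sigma>) * (1 - \<sigma>) * s)"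
proof -
  define k where "k = \<sigma> * (1 + \<sigma>) * (1 - \<sigma>)"
  have k: "k > 0" using \<sigma> by (simp add: k_def)
  have "summable (\<lambda>n. ups (Suc n) (of_real (- \<sigma>)))" using \<sigma> by (intro ups_summable) simp
  then have "summable (\<lambda>n. complex_of_real (k * trap_powr \<sigma> (Suc n)))"
    unfolding ups_trap_powr[OF \<sigma>] k_def .
  then have "summable (\<lambda>n. k * trap_powr \<sigma> (Suc n))" by (simp only: summable_of_real_iff)
  then have sm: "summable (\<lambda>n. trap_powr \<sigma> (Suc n))" using k by (subst (asm) summable_cmult_iff) auto
  define S where "S = (\<Sum>n. trap_powr \<sigma> (Suc n))"
  have s: "trap_powr \<sigma> sums (S + trap_powr \<sigma> 0)"
    using summable_sums[OF sm] unfolding S_def by (rule sums_Suc)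
  have t0: "k * trap_powr \<sigma> 0 = (1 - \<sigma>) / 2"
  proof -
    have "1/2 - 1 / (1 + \<sigma>) = (\<sigma> - 1) / (2 * (1 + \<sigma>))" using \<sigma> by (simp add: field_simps)
    then have "trap_powr \<sigma> 0 = (\<sigma> - 1) / (2 * (1 + \<sigma>)) / (\<sigma> * (\<sigma> - 1))" by (simp add: trap_powr_def)
    also have "\<dots> = 1 / (2 * (\<sigma> * (1 + \<sigma>)))"
    proof -
      have "e / (2 * c) / (s * e) = 1 / (2 * (s * c))" if "e \<noteq> 0" for c e s :: real using that by simp
      then show ?thesis using \<sigma> by simp
    qed
    finally have "trap_powr \<sigma> 0 = 1 / (2 * (\<sigma> * (1 + \<sigma>)))" .
    moreover have "c * d * (1 / (2 * c)) = d / 2" if "c \<noteq> 0" for c d :: real using that by simp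
    moreover have "\<sigma> * (1 + \<sigma>) \<noteq> 0" using \<sigma> by simp
    ultimately show ?thesis unfolding k_def by metis
  qed
  have "zeta1 (of_real (- \<sigma>)) = 1 + (of_real (- \<sigma>) - 1) / 2 + of_real (k * S)"
  proof -
    have "(\<Sum>n. ups (Suc n) (of_real (- \<sigma>))) = (\<Sum>n. complex_of_real (k * trap_powr \<sigma> (Suc n)))"
      unfolding ups_trap_powr[OF \<sigma>] k_def ..
    also have "\<dots> = of_real (\<Sum>n. k * trap_powr \<sigma> (Suc n))"
      using sm by (intro suminf_of_real[symmetric] summable_mult)
    also have "(\<Sum>n. k * trap_powr \<sigma> (Suc n)) = k * S" unfolding S_def by (rule suminf_mult[OF sm])
    finally show ?thesis by (simp add: zeta1_def)
  qed
  also have "\<dots> = of_real ((1 - \<sigma>) / 2 + k * S)" by (simp add: field_simps)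
  also have "(1 - \<sigma>) / 2 + k * S = k * (S + trap_powr \<sigma> 0)" using t0 by (simp add: distrib_left)
  finally show ?thesis using that[OF s] by (simp add: k_def)
qed

lemma pos_not_nonpos_Ints: "x > 0 \<Longrightarrow> x \<notin> \<int>\<^sub>\<le>\<^sub>0" for x :: real
  by (auto elim!: nonpos_Ints_cases)

section \<open>Riemann's xi function and the continuation of zeta\<close>

text \<open>Riemann's \<open>s * (s - 1) / 2 * pi powr (- s / 2) * Gamma (s / 2) * zeta s\<close> on
  the half plane where \<open>zeta1\<close> is available: \<open>s / 2\<close> is absorbed by
  \<open>Gamma (s / 2 + 1)\<close> and \<open>s - 1\<close> by \<open>zeta1\<close>.\<close>

definition xir :: "complex \<Rightarrow> complex" where
  "xir s = of_real pi powr (- s / 2) * Gamma (s / 2 + 1) * zeta1 s"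

text \<open>For \<open>s = - \<sigma>\<close> the two sides of \<open>trap_powr_suminf\<close> are
  zeta at \<open>s\<close> and the Dirichlet series at \<open>1 - s\<close>, up to elementary and
  Gamma factors. What remains is to match these factors by recurrence and duplication.\<close>

lemma xir_functional_real:
  assumes \<sigma>: "0 < \<sigma>" "\<sigma> < 1"
  shows "xir (of_real (- \<sigma>)) = xir (1 - of_real (- \<sigma>))"
proof -
  obtain S where S: "trap_powr \<sigma> sums S" "zeta1 (of_real (- \<sigma>)) = of_real (\<sigma> * (1 + \<sigma>) * (1 - \<sigma>) * S)"
    using zeta1_negative[OF \<sigma>] by blast
  have p: "of_nat (Suc m) powr complex_of_real y = of_real (real (Suc m) powr y)" for m y
    using powr_of_real[of "real (Suc m)" y] by simp
  have ppi: "of_real pi powr complex_of_real y = of_real (pi powr y)" for y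
    using powr_of_real[of pi y] by simp
  define D where "D = (\<Sum>m. real (Suc m) powr (- \<sigma> - 1))"
  have sD: "(\<lambda>m. real (Suc m) powr (- \<sigma> - 1)) sums D"
    unfolding D_def by (intro summable_sums summable_Suc_powr) (use \<sigma> in simp)
  have z1: "zeta1 (of_real (1 + \<sigma>)) = of_real (\<sigma> * D)"
  proof -
    have "(\<lambda>n. of_nat (Suc n) powr - complex_of_real (1 + \<sigma>)) sums (zeta1 (of_real (1 + \<sigma>)) / (of_real (1 + \<sigma>) - 1))"
      by (rule zeta1_sums) (use \<sigma> in simp)
    moreover have "of_nat (Suc n) powr - complex_of_real (1 + \<sigma>) = of_real (real (Suc n) powr (- \<sigma> - 1))" for n
    proof -
      have "- complex_of_real (1 + \<sigma>) = of_real (- \<sigma> - 1)" by simp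
      then show ?thesis by (simp only: p)
    qed
    ultimately have "(\<lambda>n. complex_of_real (real (Suc n) powr (- \<sigma> - 1))) sums (zeta1 (of_real (1 + \<sigma>)) / (of_real (1 + \<sigma>) - 1))"
      by (simp only:)
    moreover have "(\<lambda>n. complex_of_real (real (Suc n) powr (- \<sigma> - 1))) sums of_real D"
      using sD by (rule sums_of_real)
    ultimately have "zeta1 (of_real (1 + \<sigma>)) / (of_real (1 + \<sigma>) - 1) = of_real D" by (rule sums_unique2)
    then show ?thesis using \<sigma> by (simp add: field_simps)
  qed
  define g1 g2 where "g1 = Gamma ((1 - \<sigma>) / 2)" and "g2 = Gamma ((1 + \<sigma>) / 2)"
  have g: "g1 > 0" "g2 > 0" using \<sigma> by (auto simp: g1_def g2_def intro!: Gamma_real_pos)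
  have G: "Gamma (1 - \<sigma>) > 0" "Gamma (1 - \<sigma> / 2) > 0" using \<sigma> by (auto intro!: Gamma_real_pos)
  \<comment> \<open>The equality of extended sums descends to the reals, since both sides are finite
    and nonnegative.\<close>
  have "Gamma (2 - \<sigma>) * S = (2 * pi) powr (- \<sigma> - 1) * D * (g1 * g2)"
  proof -
    have G2: "Gamma (2 - \<sigma>) > 0" using \<sigma> by (intro Gamma_real_pos) simp
    have "ennreal (Gamma (2 - \<sigma>) * S) = (\<Sum>n. ennreal (Gamma (2 - \<sigma>) * trap_powr \<sigma> n))"
      by (intro suminf_ennreal_sums[symmetric] sums_mult S) (use G2 trap_powr_nonneg[OF \<sigma>] in simp)
    also have "\<dots> = (\<Sum>m. ennreal ((2 * pi * real (Suc m)) powr (- \<sigma> - 1) * (g1 * g2)))"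
      unfolding g1_def g2_def by (rule trap_powr_suminf[OF \<sigma>])
    also have "\<dots> = ennreal ((2 * pi) powr (- \<sigma> - 1) * D * (g1 * g2))"
    proof (intro suminf_ennreal_sums sums_mult2)
      have "(\<lambda>m. (2 * pi) powr (- \<sigma> - 1) * real (Suc m) powr (- \<sigma> - 1)) sums ((2 * pi) powr (- \<sigma> - 1) * D)"
        by (rule sums_mult[OF sD])
      then show "(\<lambda>m. (2 * pi * real (Suc m)) powr (- \<sigma> - 1)) sums ((2 * pi) powr (- \<sigma> - 1) * D)"
        by (simp add: powr_mult del: of_nat_Suc)
    qed (use g in simp)
    finally show ?thesis
    proof (rule ennreal_inj[THEN iffD1, rotated 2])
      have "0 \<le> S" using S(1) trap_powr_nonneg[OF \<sigma>] by (auto simp: sums_iff intro: suminf_nonneg)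
      then show "0 \<le> Gamma (2 - \<sigma>) * S" using G2 by simp
      have "0 \<le> D" unfolding D_def using sD by (intro suminf_nonneg) (auto simp: sums_iff)
      then show "0 \<le> (2 * pi) powr (- \<sigma> - 1) * D * (g1 * g2)" using g by simp
    qed
  qed
  moreover have "Gamma (2 - \<sigma>) = (1 - \<sigma>) * Gamma (1 - \<sigma>)"
    using Gamma_plus1[OF pos_not_nonpos_Ints, of "1 - \<sigma>"] \<sigma> by simp
  ultimately have A: "(1 - \<sigma>) * Gamma (1 - \<sigma>) * S = (2 * pi) powr (- \<sigma> - 1) * D * (g1 * g2)" by simp
  \<comment> \<open>Duplication at \<open>(1 - \<sigma>) / 2\<close> trades the factor
    \<open>g1\<close> for \<open>Gamma (1 - \<sigma> / 2)\<close>, the Gamma factor of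
    \<open>xir\<close> at \<open>- \<sigma>\<close>.\<close>
  have dup: "g1 * Gamma (1 - \<sigma> / 2) = 2 powr \<sigma> * sqrt pi * Gamma (1 - \<sigma>)"
  proof -
    define w where "w = complex_of_real ((1 - \<sigma>) / 2)"
    have w: "Re w > 0" "Re (w + 1/2) > 0" using \<sigma> by (auto simp: w_def field_simps)
    have "Gamma w * Gamma (w + 1/2) = exp ((1 - 2 * w) * of_real (ln 2)) * of_real (sqrt pi) * Gamma (2 * w)"
      by (intro Gamma_legendre_duplication not_nonpos_Ints_if_Re_pos w)
    moreover have "w + 1/2 = of_real (1 - \<sigma> / 2)" "2 * w = of_real (1 - \<sigma>)" "1 - 2 * w = of_real \<sigma>"
      by (simp_all add: w_def field_simps)
    ultimately have "complex_of_real (g1 * Gamma (1 - \<sigma> / 2)) = of_real (exp (\<sigma> * ln 2) * sqrt pi * Gamma (1 - \<sigma>))"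
      by (simp only: w_def Gamma_complex_of_real g1_def exp_of_real of_real_mult[symmetric])
    then have "g1 * Gamma (1 - \<sigma> / 2) = exp (\<sigma> * ln 2) * sqrt pi * Gamma (1 - \<sigma>)" by (simp only: of_real_eq_iff)
    then show ?thesis by (simp add: powr_def mult.commute)
  qed
  have "Gamma (1 - \<sigma> / 2) * ((1 - \<sigma>) * S) = g2 / 2 * pi powr (- \<sigma> - 1/2) * D"
  proof -
    have "Gamma (1 - \<sigma>) * (g1 * (Gamma (1 - \<sigma> / 2) * ((1 - \<sigma>) * S))) = (g1 * Gamma (1 - \<sigma> / 2)) * ((1 - \<sigma>) * Gamma (1 - \<sigma>) * S)"
      by (simp only: mult_ac)
    also have "\<dots> = Gamma (1 - \<sigma>) * (g1 * (g2 * D * (2 powr \<sigma> * sqrt pi * (2 * pi) powr (- \<sigma> - 1))))"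
      unfolding A dup by (simp only: mult_ac)
    also have "2 powr \<sigma> * sqrt pi * (2 * pi) powr (- \<sigma> - 1) = pi powr (- \<sigma> - 1/2) / 2"
    proof -
      have "sqrt pi = pi powr (1/2)" by (simp add: powr_half_sqrt)
      then have "2 powr \<sigma> * sqrt pi * (2 * pi) powr (- \<sigma> - 1) = (2 powr \<sigma> * 2 powr (- \<sigma> - 1)) * (pi powr (1/2) * pi powr (- \<sigma> - 1))"
        by (simp add: powr_mult)
      also have "2 powr \<sigma> * 2 powr (- \<sigma> - 1) = (1/2::real)" unfolding powr_add[symmetric] by (simp add: powr_minus)
      also have "pi powr (1/2) * pi powr (- \<sigma> - 1) = pi powr (- \<sigma> - 1/2)"
      proof -
        have "1/2 + (- \<sigma> - 1) = - \<sigma> - 1/2" by (simp add: field_simps)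
        then show ?thesis by (simp only: powr_add[symmetric])
      qed
      finally show ?thesis by simp
    qed
    finally have "Gamma (1 - \<sigma> / 2) * ((1 - \<sigma>) * S) = g2 * D * (pi powr (- \<sigma> - 1/2) / 2)"
      using g G by simp
    then show ?thesis by simp
  qed
  then have B: "\<sigma> * (1 + \<sigma>) * (Gamma (1 - \<sigma> / 2) * ((1 - \<sigma>) * S)) = \<sigma> * (1 + \<sigma>) * (g2 / 2 * pi powr (- \<sigma> - 1/2) * D)"
    by (simp only:)
  have "xir (of_real (- \<sigma>)) = of_real (pi powr (\<sigma> / 2) * Gamma (1 - \<sigma> / 2) * (\<sigma> * (1 + \<sigma>) * (1 - \<sigma>) * S))"
  proof -
    have e: "- complex_of_real (- \<sigma>) / 2 = of_real (\<sigma> / 2)" "complex_of_real (- \<sigma>) / 2 + 1 = of_real (1 - \<sigma> / 2)" by simp_all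
    show ?thesis unfolding xir_def S(2) e ppi Gamma_complex_of_real by simp
  qed
  also have "pi powr (\<sigma> / 2) * Gamma (1 - \<sigma> / 2) * (\<sigma> * (1 + \<sigma>) * (1 - \<sigma>) * S) = pi powr (\<sigma> / 2) * (\<sigma> * (1 + \<sigma>) * (Gamma (1 - \<sigma> / 2) * ((1 - \<sigma>) * S)))"
    by (simp only: mult_ac)
  also have "\<dots> = (pi powr (\<sigma> / 2) * pi powr (- \<sigma> - 1/2)) * ((1 + \<sigma>) / 2 * g2) * (\<sigma> * D)"
    unfolding B by simp
  also have "pi powr (\<sigma> / 2) * pi powr (- \<sigma> - 1/2) = pi powr (- (1 + \<sigma>) / 2)"
  proof -
    have "\<sigma> / 2 + (- \<sigma> - 1/2) = - (1 + \<sigma>) / 2" by (simp add: field_simps)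
    then show ?thesis by (simp only: powr_add[symmetric])
  qed
  also have "(1 + \<sigma>) / 2 * g2 = Gamma ((1 + \<sigma>) / 2 + 1)"
    unfolding g2_def using \<sigma> by (intro Gamma_plus1[symmetric] pos_not_nonpos_Ints) simp
  also have "of_real (pi powr (- (1 + \<sigma>) / 2) * Gamma ((1 + \<sigma>) / 2 + 1) * (\<sigma> * D)) = xir (of_real (1 + \<sigma>))"
  proof -
    have e: "- complex_of_real (1 + \<sigma>) / 2 = of_real (- (1 + \<sigma>) / 2)" "complex_of_real (1 + \<sigma>) / 2 + 1 = of_real ((1 + \<sigma>) / 2 + 1)" by simp_all
    show ?thesis unfolding xir_def z1 e ppi Gamma_complex_of_real by (simp only: of_real_mult)
  qed
  finally show ?thesis by simp
qed

lemma xir_holomorphic: "xir holomorphic_on {s. - 1 < Re s}"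
proof -
  have "s / 2 + 1 \<notin> \<int>\<^sub>\<le>\<^sub>0" if "- 1 < Re s" for s
    using that by (intro not_nonpos_Ints_if_Re_pos) (simp add: field_simps)
  then have g: "(\<lambda>s. Gamma (s / 2 + 1)) holomorphic_on {s. - 1 < Re s}"
    by (intro holomorphic_intros) auto
  have p: "(\<lambda>s. of_real pi powr (- s / 2)) holomorphic_on {s. - 1 < Re s}"
    by (intro holomorphic_intros) auto
  show ?thesis
    using holomorphic_on_mult[OF holomorphic_on_mult[OF p g] zeta1_holomorphic] by (simp only: xir_def[abs_def])
qed

text \<open>Identity theorem: the strip is invariant under \<open>s\<close> to \<open>1 - s\<close>,
  and the real segment from - 1 to 0, where the equation is known, has the limit point - 1/2 in
  it.\<close>

lemma xir_functional:
  assumes s: "- 1 < Re s" "Re s < 2" shows "xir s = xir (1 - s)"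
proof -
  define S where "S = {s. - 1 < Re s \<and> Re s < 2}"
  define U where "U = complex_of_real ` {- 1<..<0}"
  have "(xir \<circ> (\<lambda>s. 1 - s)) holomorphic_on S"
    by (rule holomorphic_on_compose_gen[OF _ xir_holomorphic]) (auto simp: S_def intro!: holomorphic_intros)
  then have h: "(\<lambda>s. xir s - xir (1 - s)) holomorphic_on S"
    by (intro holomorphic_intros holomorphic_on_subset[OF xir_holomorphic]) (auto simp: S_def o_def)
  have "xir s - xir (1 - s) = 0"
  proof (rule analytic_continuation[OF h, of U "- 1/2"])
    show "open S" unfolding S_def by (rule open_vstrip)
    have eq: "S = {s. Re s > - 1} \<inter> {s. Re s < 2}" by (auto simp: S_def)
    show "connected S" unfolding eq
      by (intro convex_connected convex_Int convex_halfspace_Re_gt convex_halfspace_Re_lt)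
    show "U \<subseteq> S" "- 1/2 \<in> S" "s \<in> S" using s by (auto simp: U_def S_def)
    show "- 1/2 islimpt U"
    proof -
      have "(- 1/2 :: real) islimpt {- 1<..<0}" by (intro open_imp_islimpt) auto
      then have "complex_of_real (- 1/2) islimpt U"
        unfolding U_def islimpt_def
      proof (intro allI impI)
        fix T assume *: "\<forall>T. - 1 / 2 \<in> T \<longrightarrow> open T \<longrightarrow> (\<exists>y\<in>{- 1<..<0}. y \<in> T \<and> y \<noteq> (- 1 / 2 :: real))"
          "complex_of_real (- 1 / 2) \<in> T" "open T"
        have "open (complex_of_real -` T)" by (rule open_vimage[OF *(3)]) (intro continuous_intros)
        with * obtain y where "y \<in> {- 1<..<0}" "y \<in> complex_of_real -` T" "y \<noteq> (- 1 / 2 :: real)"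
          by (metis vimageI)
        then show "\<exists>y\<in>complex_of_real ` {- 1<..<0}. y \<in> T \<and> y \<noteq> complex_of_real (- 1 / 2)"
          by (intro bexI[of _ "complex_of_real y"]) (auto simp del: of_real_minus of_real_divide)
      qed
      then show ?thesis by simp
    qed
    fix z assume "z \<in> U"
    then obtain x where x: "z = of_real x" "- 1 < x" "x < 0" by (auto simp: U_def)
    then show "xir z - xir (1 - z) = 0" using xir_functional_real[of "- x"] by simp
  qed
  then show ?thesis by simp
qed

text \<open>On \<open>- 1 < Re s < 2\<close> both formulas agree by the functional equation, so the
  gluing is an entire function.\<close>

definition xi :: "complex \<Rightarrow> complex" where
  "xi s = (if - 1 < Re s then xir s else xir (1 - s))"

lemma xi_eq_xir: "- 1 < Re s \<Longrightarrow> xi s = xir s" by (simp add: xi_def)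

lemma xi_eq_xir': "Re s < 2 \<Longrightarrow> xi s = xir (1 - s)"
  using xir_functional[of s] by (simp add: xi_def)

lemma xi_functional: "xi (1 - s) = xi s"
proof (cases "- 1 < Re s")
  case True
  then have "xi (1 - s) = xir (1 - (1 - s))" by (intro xi_eq_xir') simp
  then show ?thesis using True by (simp add: xi_eq_xir)
next
  case False
  then show ?thesis by (simp add: xi_eq_xir xi_eq_xir')
qed

lemma xi_holomorphic: "xi holomorphic_on UNIV"
proof -
  have "xi holomorphic_on {s. - 1 < Re s}"
    by (rule holomorphic_transform[OF xir_holomorphic]) (simp add: xi_eq_xir)
  moreover have "xi holomorphic_on {s. Re s < 2}"
  proof (rule holomorphic_transform)
    have "(xir \<circ> (\<lambda>s. 1 - s)) holomorphic_on {s. Re s < 2}"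
      by (rule holomorphic_on_compose_gen[OF _ xir_holomorphic]) (auto intro!: holomorphic_intros)
    then show "(\<lambda>s. xir (1 - s)) holomorphic_on {s. Re s < 2}" by (simp only: o_def)
  qed (simp add: xi_eq_xir')
  ultimately have "xi holomorphic_on ({s. - 1 < Re s} \<union> {s. Re s < 2})"
    by (intro holomorphic_on_Un open_halfspace_Re_gt open_halfspace_Re_lt)
  moreover have "{s. - 1 < Re s} \<union> {s. Re s < 2} = UNIV" by auto
  ultimately show ?thesis by simp
qed

text \<open>Division by the Gamma factor is written with the entire \<open>rGamma\<close>, so only
  the pole at 1 remains. There, division by 0 yields 0, the normalisation chosen in
  \<open>riemann_zeta\<close>.\<close>

definition zeta_full :: "complex \<Rightarrow> complex" where
  "zeta_full s = xi s * of_real pi powr (s / 2) * rGamma (s / 2 + 1) / (s - 1)"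

lemma zeta_full_eq:
  assumes "- 1 < Re s" shows "zeta_full s = zeta1 s / (s - 1)"
proof -
  have "Gamma (s / 2 + 1) * rGamma (s / 2 + 1) = 1"
    using assms not_nonpos_Ints_if_Re_pos[of "s / 2 + 1"]
    by (simp add: rGamma_inverse_Gamma Gamma_eq_zero_iff field_simps)
  moreover have "of_real pi powr (- s / 2) * of_real pi powr (s / 2) = (1 :: complex)"
    unfolding powr_add[symmetric] by simp
  moreover have "xi s * of_real pi powr (s / 2) * rGamma (s / 2 + 1) =
      (of_real pi powr (- s / 2) * of_real pi powr (s / 2)) * (Gamma (s / 2 + 1) * rGamma (s / 2 + 1)) * zeta1 s"
    using assms by (simp only: xi_eq_xir xir_def mult_ac)
  ultimately show ?thesis by (simp add: zeta_full_def)
qed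

text \<open>Uniqueness: a second candidate agrees with \<open>zeta_full\<close> where the series
  converges, hence on the connected set \<open>- {1}\<close>, and both are 0 at 1.\<close>

lemma riemann_zeta_eq: "riemann_zeta = zeta_full"
  unfolding riemann_zeta_def
proof (rule the_equality)
  have h: "zeta_full holomorphic_on - {1}"
    unfolding zeta_full_def
    by (intro holomorphic_intros holomorphic_on_subset[OF xi_holomorphic]) auto
  have s: "(\<lambda>n. 1 / of_nat (Suc n) powr s) sums zeta_full s" if "1 < Re s" for s
    using zeta1_sums[OF that] zeta_full_eq[of s] that by (simp add: powr_minus_divide del: of_nat_Suc)
  show "zeta_full holomorphic_on - {1} \<and> (\<forall>s. 1 < Re s \<longrightarrow> (\<lambda>n. 1 / of_nat (Suc n) powr s) sums zeta_full s) \<and> zeta_full 1 = 0"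
    using h s by (simp add: zeta_full_def)
  fix f assume f: "f holomorphic_on - {1} \<and> (\<forall>s. 1 < Re s \<longrightarrow> (\<lambda>n. 1 / of_nat (Suc n) powr s) sums f s) \<and> f 1 = 0"
  show "f = zeta_full"
  proof
    fix z show "f z = zeta_full z"
    proof (cases "z = 1")
      case False
      show ?thesis
      proof (rule analytic_continuation_open[of "{s. 1 < Re s}" "- {1}" f zeta_full])
        show "{s. 1 < Re s} \<noteq> {}" by (auto intro: exI[of _ 2])
        show "connected (- {1 :: complex})" by (intro connected_punctured_universe) simp
        show "f s = zeta_full s" if "s \<in> {s. 1 < Re s}" for s
          using that f s[of s] sums_unique2 by blast
      qed (use f h False in \<open>auto intro: open_halfspace_Re_gt\<close>)
    qed (use f in \<open>simp add: zeta_full_def\<close>)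
  qed
qed

section \<open>Dirichlet series on the half plane of absolute convergence\<close>

text \<open>Growth below every positive power gives absolute convergence for \<open>Re s > 1\<close>
  and is stable under the factor \<open>ln n\<close> that differentiation produces. The shift to
  \<open>Suc n\<close> reflects that Dirichlet series start at 1.\<close>

definition subpoly :: "(nat \<Rightarrow> real) \<Rightarrow> bool" where
  "subpoly a \<longleftrightarrow> (\<forall>\<delta>>0. \<exists>K. \<forall>n. \<bar>a (Suc n)\<bar> \<le> K * real (Suc n) powr \<delta>)"

lemma subpoly_bounded: "(\<And>n. \<bar>a (Suc n)\<bar> \<le> K) \<Longrightarrow> subpoly a"
  unfolding subpoly_def
proof (intro allI impI exI)
  fix \<delta> :: real and n assume a: "\<And>n. \<bar>a (Suc n)\<bar> \<le> K" and "\<delta> > 0"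
  have "K \<ge> 0" using order_trans[OF abs_ge_zero a] .
  moreover have "1 \<le> real (Suc n) powr \<delta>" using \<open>\<delta> > 0\<close> by (intro ge_one_powr_ge_zero) auto
  ultimately have "K * 1 \<le> K * real (Suc n) powr \<delta>" by (intro mult_left_mono)
  then show "\<bar>a (Suc n)\<bar> \<le> K * real (Suc n) powr \<delta>" using a[of n] by simp
qed

lemma subpoly_ln_times:
  assumes "subpoly a" shows "subpoly (\<lambda>n. ln (real n) * a n)"
  unfolding subpoly_def
proof (intro allI impI)
  fix \<delta> :: real assume \<delta>: "\<delta> > 0"
  then obtain K where K: "\<And>n. \<bar>a (Suc n)\<bar> \<le> K * real (Suc n) powr (\<delta> / 2)"
    using assms unfolding subpoly_def by (metis half_gt_zero)
  have "\<bar>ln (real (Suc n)) * a (Suc n)\<bar> \<le> (2 / \<delta> * K) * real (Suc n) powr \<delta>" for n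
  proof -
    have "ln (real (Suc n)) \<le> real (Suc n) powr (\<delta> / 2) / (\<delta> / 2)" using \<delta> by (intro ln_powr_bound) auto
    then have "\<bar>ln (real (Suc n))\<bar> * \<bar>a (Suc n)\<bar> \<le> (real (Suc n) powr (\<delta> / 2) / (\<delta> / 2)) * (K * real (Suc n) powr (\<delta> / 2))"
      using \<delta> by (intro mult_mono K) (auto simp: divide_nonneg_pos)
    also have "\<dots> = 1 / (\<delta> / 2) * K * (real (Suc n) powr (\<delta> / 2) * real (Suc n) powr (\<delta> / 2))" by simp
    also have "real (Suc n) powr (\<delta> / 2) * real (Suc n) powr (\<delta> / 2) = real (Suc n) powr \<delta>"
      unfolding powr_add[symmetric] by simp
    finally show ?thesis by (simp add: abs_mult)
  qed
  then show "\<exists>K. \<forall>n. \<bar>ln (real (Suc n)) * a (Suc n)\<bar> \<le> K * real (Suc n) powr \<delta>" by blast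
qed

lemma subpoly_mono: "subpoly b \<Longrightarrow> (\<And>n. \<bar>a n\<bar> \<le> \<bar>b n\<bar>) \<Longrightarrow> subpoly a"
  unfolding subpoly_def by (meson order_trans)

definition dterm :: "(nat \<Rightarrow> real) \<Rightarrow> nat \<Rightarrow> complex \<Rightarrow> complex" where
  "dterm a n s = of_real (a (Suc n)) * of_nat (Suc n) powr - s"

definition Dser :: "(nat \<Rightarrow> real) \<Rightarrow> complex \<Rightarrow> complex" where
  "Dser a s = (\<Sum>n. dterm a n s)"

lemma norm_dterm: "norm (dterm a n s) = \<bar>a (Suc n)\<bar> * real (Suc n) powr - Re s"
  using norm_powr_real_powr[of "of_nat (Suc n)" "- s"] by (simp add: dterm_def norm_mult)

lemma dterm_majorant:
  assumes a: "subpoly a" and c: "c > 1"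
  obtains M where "summable M" "\<And>n s. Re s \<ge> c \<Longrightarrow> norm (dterm a n s) \<le> M n"
proof -
  define \<delta> where "\<delta> = (c - 1) / 2"
  have \<delta>: "\<delta> > 0" "\<delta> - c < - 1" using c by (auto simp: \<delta>_def field_simps)
  obtain K where K: "\<And>n. \<bar>a (Suc n)\<bar> \<le> K * real (Suc n) powr \<delta>" using a \<delta> unfolding subpoly_def by blast
  have "norm (dterm a n s) \<le> K * real (Suc n) powr (\<delta> - c)" if "Re s \<ge> c" for n s
  proof -
    have "norm (dterm a n s) \<le> (K * real (Suc n) powr \<delta>) * real (Suc n) powr - c"
      unfolding norm_dterm using K[of n] that order_trans[OF abs_ge_zero K[of n]]
      by (intro mult_mono powr_mono) auto
    also have "\<dots> = K * (real (Suc n) powr \<delta> * real (Suc n) powr - c)" by simp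
    also have "real (Suc n) powr \<delta> * real (Suc n) powr - c = real (Suc n) powr (\<delta> - c)"
      unfolding powr_add[symmetric] by simp
    finally show ?thesis .
  qed
  moreover have "summable (\<lambda>n. K * real (Suc n) powr (\<delta> - c))" using \<delta> by (intro summable_mult summable_Suc_powr)
  ultimately show ?thesis using that by blast
qed

lemma dterm_majorant':
  assumes a: "subpoly a" and x: "1 < Re x"
  shows "\<exists>d>0. cball x d \<subseteq> {s. 1 < Re s} \<and> (\<exists>M. summable M \<and> (\<forall>n. \<forall>y\<in>cball x d. norm (dterm a n y) \<le> M n))"
proof -
  define c where "c = (Re x + 1) / 2"
  have c: "c > 1" "Re x - c > 0" using x by (auto simp: c_def field_simps)
  obtain M where M: "summable M" "\<And>n s. Re s \<ge> c \<Longrightarrow> norm (dterm a n s) \<le> M n"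
    using dterm_majorant[OF a c(1)] by blast
  have "Re y \<ge> c" if "y \<in> cball x (Re x - c)" for y
  proof -
    have "norm (x - y) \<le> Re x - c" using that by (simp add: dist_norm)
    then show ?thesis using abs_Re_le_cmod[of "x - y"] by simp
  qed
  then show ?thesis using M c by (intro exI[of _ "Re x - c"]) force
qed

lemma dterm_holomorphic: "dterm a n holomorphic_on A"
  unfolding dterm_def by (intro holomorphic_intros)

lemma Dser_holomorphic: "subpoly a \<Longrightarrow> Dser a holomorphic_on {s. 1 < Re s}"
  unfolding Dser_def
  by (intro holomorphic_suminf open_halfspace_Re_gt dterm_holomorphic dterm_majorant') auto

lemma summable_norm_dterm:
  assumes "subpoly a" "1 < Re s" shows "summable (\<lambda>n. norm (dterm a n s))"
proof -
  obtain M where "summable M" "\<And>n s'. Re s' \<ge> Re s \<Longrightarrow> norm (dterm a n s') \<le> M n"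
    using dterm_majorant[OF assms] by blast
  then have "norm (norm (dterm a n s)) \<le> M n" for n by simp
  then show ?thesis using \<open>summable M\<close> by (metis summable_comparison_test')
qed

lemma Dser_sums: "subpoly a \<Longrightarrow> 1 < Re s \<Longrightarrow> (\<lambda>n. dterm a n s) sums Dser a s"
  unfolding Dser_def by (intro summable_sums summable_norm_cancel[OF summable_norm_dterm])

lemma Dser_deriv:
  assumes a: "subpoly a" and s: "1 < Re s"
  shows "(Dser a has_field_derivative - Dser (\<lambda>n. ln (real n) * a n) s) (at s)"
proof -
  have "(\<lambda>n. deriv (dterm a n) s) sums deriv (\<lambda>s. \<Sum>n. dterm a n s) s"
    by (rule deriv_suminf[of "{s. 1 < Re s}"])
       (use s in \<open>auto intro!: open_halfspace_Re_gt dterm_holomorphic dterm_majorant' a\<close>)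
  moreover have "deriv (dterm a n) s = - dterm (\<lambda>n. ln (real n) * a n) n s" for n
  proof (rule DERIV_imp_deriv)
    have "(dterm a n has_field_derivative of_real (a (Suc n)) * (- (of_nat (Suc n) powr - s * Ln (of_nat (Suc n))))) (at s)"
    proof -
      have nz: "of_nat (Suc n) \<noteq> (0 :: complex)" by (rule of_nat_neq_0)
      show ?thesis unfolding dterm_def[abs_def]
        by (rule DERIV_cong[OF DERIV_cmult[OF DERIV_chain2[OF has_field_derivative_powr_right[OF nz] DERIV_minus[OF DERIV_ident]]]]) simp
    qed
    also have "Ln (of_nat (Suc n)) = complex_of_real (ln (real (Suc n)))"
      using Ln_of_real[of "real (Suc n)"] by simp
    finally show "(dterm a n has_field_derivative - dterm (\<lambda>n. ln (real n) * a n) n s) (at s)"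
      by (simp only: dterm_def[abs_def] of_real_mult mult_ac mult_minus_right)
  qed
  ultimately have "(\<lambda>n. - dterm (\<lambda>n. ln (real n) * a n) n s) sums deriv (Dser a) s"
    by (simp add: Dser_def[abs_def])
  moreover have "(\<lambda>n. - dterm (\<lambda>n. ln (real n) * a n) n s) sums - Dser (\<lambda>n. ln (real n) * a n) s"
    by (intro sums_minus Dser_sums subpoly_ln_times a s)
  ultimately have "deriv (Dser a) s = - Dser (\<lambda>n. ln (real n) * a n) s" by (rule sums_unique2)
  moreover have "(Dser a has_field_derivative deriv (Dser a) s) (at s)"
    using holomorphic_derivI[OF Dser_holomorphic[OF a] open_halfspace_Re_gt] s by simp
  ultimately show ?thesis by simp
qed

lemma subpoly_1: "subpoly (\<lambda>_. 1)" by (rule subpoly_bounded[of _ 1]) simp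
lemma subpoly_ln: "subpoly (\<lambda>n. ln (real n))" using subpoly_ln_times[OF subpoly_1] by simp

lemma mangoldt_le_ln: "\<bar>mangoldt n\<bar> \<le> \<bar>ln (real n)\<bar>"
  by (cases "n = 0") (auto simp: mangoldt_le mangoldt_nonneg intro: order_trans[OF mangoldt_le])

lemma subpoly_mangoldt: "subpoly mangoldt"
  by (rule subpoly_mono[OF subpoly_ln]) (rule mangoldt_le_ln)

lemma Dser_1: "1 < Re s \<Longrightarrow> Dser (\<lambda>_. 1) s = zeta1 s / (s - 1)"
  using zeta1_sums[of s] by (simp add: Dser_def dterm_def sums_iff del: of_nat_Suc)

text \<open>\<open>ln n\<close> is the sum of the von Mangoldt function over the divisors of
  \<open>n\<close>. The absolutely summable double series over \<open>(d, k)\<close> is regrouped by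
  the product \<open>n = d * k\<close>.\<close>

lemma Dser_ln_eq:
  assumes s: "1 < Re s"
  shows "Dser (\<lambda>n. ln (real n)) s = Dser (\<lambda>_. 1) s * Dser mangoldt s"
proof -
  define A where "A = ({1..} :: nat set)"
  define c where "c = (\<lambda>n::nat. mangoldt n * of_nat n powr - s :: complex)"
  define b where "b = (\<lambda>n::nat. of_nat n powr - s :: complex)"
  have bij: "bij_betw Suc UNIV A" unfolding A_def
    by (rule bij_betwI[of _ _ _ "\<lambda>n. n - 1"]) auto
  have hs: "(f has_sum Dser a s) A" "(\<lambda>n. norm (f n)) summable_on A"
    if a: "subpoly a" and f: "\<And>n. f (Suc n) = dterm a n s" for f a
  proof -
    have "((\<lambda>n. f (Suc n)) has_sum Dser a s) UNIV"
      unfolding f by (intro norm_summable_imp_has_sum summable_norm_dterm Dser_sums a s)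
    then show "(f has_sum Dser a s) A" by (subst (asm) has_sum_reindex_bij_betw[OF bij])
    have "(\<lambda>n. norm (f (Suc n))) summable_on UNIV"
      unfolding f by (intro norm_summable_imp_summable_on) (simp add: summable_norm_dterm a s)
    then show "(\<lambda>n. norm (f n)) summable_on A" by (subst (asm) summable_on_reindex_bij_betw[OF bij])
  qed
  have c: "(c has_sum Dser mangoldt s) A" "(\<lambda>n. norm (c n)) summable_on A"
    by (auto intro!: hs subpoly_mangoldt simp: c_def dterm_def)
  have b: "(b has_sum Dser (\<lambda>_. 1) s) A" "(\<lambda>n. norm (b n)) summable_on A"
    by (auto intro!: hs subpoly_1 simp: b_def dterm_def)
  have "(\<lambda>x. norm (case x of (d, k) \<Rightarrow> c d * b k)) summable_on A \<times> A"
  proof (subst Infinite_Sum.abs_summable_on_Sigma_iff, intro conjI ballI)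
    fix d show "(\<lambda>k. norm (case (d, k) of (d, k) \<Rightarrow> c d * b k)) summable_on A"
      using summable_on_cmult_right[OF b(2), of "norm (c d)"] by (simp add: norm_mult)
  next
    have "(\<lambda>d. norm (c d) * infsum (\<lambda>k. norm (b k)) A) summable_on A"
      by (rule summable_on_cmult_left[OF c(2)])
    moreover have "norm (infsum (\<lambda>k. norm (case (d, k) of (d, k) \<Rightarrow> c d * b k)) A) = norm (c d) * infsum (\<lambda>k. norm (b k)) A" for d
      by (simp add: norm_mult infsum_cmult_right' infsum_nonneg)
    ultimately show "(\<lambda>d. norm (infsum (\<lambda>k. norm (case (d, k) of (d, k) \<Rightarrow> c d * b k)) A)) summable_on A"
      by simp
  qed
  then have sm: "(\<lambda>(d, k). c d * b k) summable_on A \<times> A" by (rule Infinite_Sum.abs_summable_summable)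
  \<comment> \<open>Pairs \<open>(n, d)\<close> with \<open>d\<close> dividing \<open>n\<close>: the
    index set after regrouping, reached from the pairs \<open>(d, k)\<close> through
    \<open>h\<close>.\<close>
  define B where "B = Sigma A (\<lambda>n. {d. d dvd n})"
  define h where "h = (\<lambda>(d, k). (d * k, d :: nat))"
  have bijh: "bij_betw h (A \<times> A) B"
    by (rule bij_betwI[of _ _ _ "\<lambda>(n, d). (d, n div d)"])
       (auto simp: h_def A_def B_def Suc_le_eq intro: dvd_pos_nat elim!: dvdE)
  define F where "F = (\<lambda>(n, d). c d * b (n div d))"
  have Fh: "F (h x) = (case x of (d, k) \<Rightarrow> c d * b k)" if "x \<in> A \<times> A" for x
    using that by (auto simp: F_def h_def A_def)
  have smF: "F summable_on B"
    using summable_on_reindex_bij_betw[OF bijh, of F] sm summable_on_cong[OF Fh, of "A \<times> A"] by simp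
  have "Dser (\<lambda>_. 1) s * Dser mangoldt s = infsum c A * infsum b A"
    using infsumI[OF c(1)] infsumI[OF b(1)] by simp
  also have "\<dots> = infsum (\<lambda>d. infsum (\<lambda>k. c d * b k) A) A"
    by (simp add: infsum_cmult_right' infsum_cmult_left')
  also have "\<dots> = infsum (\<lambda>(d, k). c d * b k) (A \<times> A)"
    by (rule infsum_Sigma'_banach[OF sm])
  also have "\<dots> = infsum (\<lambda>x. F (h x)) (A \<times> A)" by (rule infsum_cong[symmetric]) (rule Fh)
  also have "\<dots> = infsum F B" by (rule infsum_reindex_bij_betw[OF bijh])
  also have "\<dots> = infsum (\<lambda>n. infsum (\<lambda>d. F (n, d)) {d. d dvd n}) A"
    unfolding B_def by (rule infsum_Sigma_banach[symmetric]) (use smF in \<open>simp add: B_def\<close>)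
  also have "\<dots> = infsum (\<lambda>n. of_real (ln (real n)) * of_nat n powr - s) A"
  proof (rule infsum_cong)
    fix n assume "n \<in> A"
    then have n: "n > 0" by (simp add: A_def)
    have "infsum (\<lambda>d. F (n, d)) {d. d dvd n} = (\<Sum>d | d dvd n. F (n, d))"
      using n by (intro infsum_finite) simp
    also have "\<dots> = (\<Sum>d | d dvd n. mangoldt d * of_nat n powr - s)"
    proof (rule sum.cong[OF refl])
      fix d assume "d \<in> {d. d dvd n}"
      then obtain k where k: "n = d * k" by auto
      then have "d > 0" "k > 0" using n by auto
      then show "F (n, d) = mangoldt d * of_nat n powr - s"
        using k by (simp add: F_def c_def b_def powr_times_real)
    qed
    also have "\<dots> = (\<Sum>d | d dvd n. mangoldt d) * of_nat n powr - s" by (simp add: sum_distrib_right)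
    also have "(\<Sum>d | d dvd n. mangoldt d :: complex) = of_real (ln (real n))"
      using n by (intro mangoldt_sum) simp
    finally show "infsum (\<lambda>d. F (n, d)) {d. d dvd n} = of_real (ln (real n)) * of_nat n powr - s" .
  qed
  also have "\<dots> = Dser (\<lambda>n. ln (real n)) s"
    by (intro infsumI hs(1) subpoly_ln) (simp add: dterm_def)
  finally show ?thesis by simp
qed

section \<open>Zeros of zeta\<close>

text \<open>The coefficients of \<open>log zeta\<close>. At \<open>n = 1\<close>, where
  \<open>ln\<close> vanishes, the quotient is 0 by the convention for division.\<close>

definition mangoldt_ln :: "nat \<Rightarrow> real" where
  "mangoldt_ln n = mangoldt n / ln (real n)"

lemma mangoldt_ln_bounds: "0 \<le> mangoldt_ln n" "mangoldt_ln n \<le> 1"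
proof -
  show "0 \<le> mangoldt_ln n" by (cases "n = 0") (simp_all add: mangoldt_ln_def mangoldt_nonneg)
  show "mangoldt_ln n \<le> 1"
  proof (cases "n \<le> 1")
    case True
    then have "mangoldt n = (0 :: real)" by (cases n) auto
    then show ?thesis by (simp add: mangoldt_ln_def)
  next
    case False
    then have "ln (real n) > 0" "mangoldt n \<le> ln (real n)" by (auto intro: mangoldt_le)
    then show ?thesis by (simp add: mangoldt_ln_def)
  qed
qed

lemma ln_times_mangoldt_ln: "(\<lambda>n. ln (real n) * mangoldt_ln n) = mangoldt"
proof
  fix n show "ln (real n) * mangoldt_ln n = mangoldt n"
  proof (cases "n \<le> 1")
    case True
    then have "mangoldt n = (0 :: real)" by (cases n) auto
    then show ?thesis by (simp add: mangoldt_ln_def)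
  next
    case False
    then have "ln (real n) > 0" by simp
    then show ?thesis by (simp add: mangoldt_ln_def)
  qed
qed

lemma subpoly_mangoldt_ln: "subpoly mangoldt_ln"
  by (rule subpoly_bounded[of _ 1]) (use mangoldt_ln_bounds in auto)

lemma Dser_1_deriv: "1 < Re s \<Longrightarrow> (Dser (\<lambda>_. 1) has_field_derivative - (Dser (\<lambda>_. 1) s * Dser mangoldt s)) (at s)"
  using Dser_deriv[OF subpoly_1, of s] Dser_ln_eq[of s] by simp

lemma Dser_mangoldt_ln_deriv: "1 < Re s \<Longrightarrow> (Dser mangoldt_ln has_field_derivative - Dser mangoldt s) (at s)"
  using Dser_deriv[OF subpoly_mangoldt_ln, of s] unfolding ln_times_mangoldt_ln .

text \<open>One point where zeta is visibly nonzero, which shows that the constant in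
  \<open>Dser_1_exp\<close> is nonzero.\<close>

lemma zeta1_2: "zeta1 2 = of_real (pi\<^sup>2 / 6)"
proof -
  have "(\<lambda>n. 1 / (real (Suc n))\<^sup>2) sums (pi\<^sup>2 / 6)" using inverse_squares_sums by (simp add: add.commute)
  then have "(\<lambda>n. complex_of_real (1 / (real (Suc n))\<^sup>2)) sums of_real (pi\<^sup>2 / 6)" by (rule sums_of_real)
  moreover have "complex_of_real (1 / (real (Suc n))\<^sup>2) = of_nat (Suc n) powr - 2" for n
  proof -
    have "of_nat (Suc n) powr - 2 = inverse ((of_nat (Suc n) :: complex) powr 2)" by (rule powr_minus)
    also have "(of_nat (Suc n) :: complex) powr 2 = of_nat (Suc n) ^ 2"
      using of_nat_neq_0[of n, where 'a = complex] by (simp add: powr_numeral del: of_nat_Suc)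
    finally show ?thesis by (simp add: inverse_eq_divide del: of_nat_Suc)
  qed
  ultimately have "(\<lambda>n. of_nat (Suc n) powr - 2) sums complex_of_real (pi\<^sup>2 / 6)" by (simp only:)
  moreover have "(\<lambda>n. of_nat (Suc n) powr - 2) sums (zeta1 2 / (2 - 1))" by (rule zeta1_sums) simp
  ultimately have "zeta1 2 / (2 - 1) = of_real (pi\<^sup>2 / 6)" by (rule sums_unique2[rotated])
  then show ?thesis by simp
qed

text \<open>Since \<open>zeta' = - zeta * Dser mangoldt\<close>, the quotient of zeta by \<open>exp (Dser mangoldt_ln)\<close> is constant.\<close>
lemma Dser_1_exp:
  obtains c where "c \<noteq> 0" "\<And>s. 1 < Re s \<Longrightarrow> Dser (\<lambda>_. 1) s = c * exp (Dser mangoldt_ln s)"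
proof -
  have "\<exists>c. \<forall>s\<in>{s. 1 < Re s}. Dser (\<lambda>_. 1) s * exp (- Dser mangoldt_ln s) = c"
  proof (rule has_field_derivative_zero_constant)
    show "convex {s. 1 < Re s}" by (rule convex_halfspace_Re_gt)
    fix s assume s: "s \<in> {s. 1 < Re s}"
    have e: "((\<lambda>s. exp (- Dser mangoldt_ln s)) has_field_derivative exp (- Dser mangoldt_ln s) * - (- Dser mangoldt s)) (at s)"
      by (rule DERIV_chain2[OF DERIV_exp DERIV_minus[OF Dser_mangoldt_ln_deriv]]) (use s in simp)
    have "((\<lambda>s. Dser (\<lambda>_. 1) s * exp (- Dser mangoldt_ln s)) has_field_derivative 0) (at s)"
      by (rule DERIV_cong[OF DERIV_mult[OF Dser_1_deriv e]]) (use s in \<open>simp_all add: algebra_simps\<close>)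
    then show "((\<lambda>s. Dser (\<lambda>_. 1) s * exp (- Dser mangoldt_ln s)) has_field_derivative 0) (at s within {s. 1 < Re s})"
      by (rule has_field_derivative_at_within)
  qed
  then obtain c where c: "\<And>s. 1 < Re s \<Longrightarrow> Dser (\<lambda>_. 1) s * exp (- Dser mangoldt_ln s) = c" by auto
  have "Dser (\<lambda>_. 1) s = c * exp (Dser mangoldt_ln s)" if "1 < Re s" for s
  proof -
    have "c * exp (Dser mangoldt_ln s) = Dser (\<lambda>_. 1) s * (exp (- Dser mangoldt_ln s) * exp (Dser mangoldt_ln s))"
      using c[OF that] by (simp only: mult.assoc[symmetric])
    then show ?thesis by (simp add: exp_add[symmetric])
  qed
  moreover have "c \<noteq> 0"
  proof
    assume "c = 0"
    then have "Dser (\<lambda>_. 1) 2 = 0" using c[of 2] by simp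
    then show False by (simp add: Dser_1 zeta1_2)
  qed
  ultimately show ?thesis using that by blast
qed

lemma zeta1_nonzero_gt_1:
  assumes "1 < Re s" shows "zeta1 s \<noteq> 0"
proof -
  obtain c where "c \<noteq> 0" "\<And>s. 1 < Re s \<Longrightarrow> Dser (\<lambda>_. 1) s = c * exp (Dser mangoldt_ln s)"
    using Dser_1_exp by blast
  then have "Dser (\<lambda>_. 1) s \<noteq> 0" using assms by simp
  then show ?thesis using assms by (auto simp: Dser_1)
qed

lemma zeta1_logderiv:
  assumes s: "1 < Re s"
  shows "deriv zeta1 s / zeta1 s = 1 / (s - 1) - Dser mangoldt s"
proof -
  have s1: "s - 1 \<noteq> 0" using s by auto
  have "((\<lambda>s. (s - 1) * Dser (\<lambda>_. 1) s) has_field_derivative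
      (1 - 0) * Dser (\<lambda>_. 1) s + - (Dser (\<lambda>_. 1) s * Dser mangoldt s) * (s - 1)) (at s)"
    by (rule DERIV_mult[OF DERIV_diff[OF DERIV_ident DERIV_const] Dser_1_deriv[OF s]])
  then have "(zeta1 has_field_derivative (1 - 0) * Dser (\<lambda>_. 1) s + - (Dser (\<lambda>_. 1) s * Dser mangoldt s) * (s - 1)) (at s)"
  proof (rule has_field_derivative_transform_within_open[where S = "{s. 1 < Re s}"])
    fix z assume z: "z \<in> {s. 1 < Re s}"
    then have "z - 1 \<noteq> 0" by auto
    then show "(z - 1) * Dser (\<lambda>_. 1) z = zeta1 z" using z by (simp add: Dser_1)
  qed (use s in \<open>auto intro: open_halfspace_Re_gt\<close>)
  then have "deriv zeta1 s = Dser (\<lambda>_. 1) s * (1 - (s - 1) * Dser mangoldt s)"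
    by (simp add: DERIV_imp_deriv algebra_simps)
  moreover have "zeta1 s = (s - 1) * Dser (\<lambda>_. 1) s" using s1 s by (simp add: Dser_1)
  moreover have "Dser (\<lambda>_. 1) s \<noteq> 0" using zeta1_nonzero_gt_1[OF s] s1 s by (simp add: Dser_1)
  moreover have "D * (1 - k * m) / (k * D) = 1 / k - m" if "D \<noteq> 0" "k \<noteq> 0" for D k m :: complex
    using that by (simp add: field_simps)
  ultimately show ?thesis using s1 by simp
qed

section \<open>Nonvanishing of zeta on the line of real part 1\<close>

lemma three_four_one: "0 \<le> 3 + 4 * cos x + cos (2 * x :: real)"
proof -
  have "3 + 4 * cos x + cos (2 * x) = 2 * (1 + cos x) ^ 2"
    unfolding cos_double_cos by (simp add: power2_eq_square algebra_simps)
  then show ?thesis by simp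
qed

lemma Re_dterm: "Re (dterm a n (Complex \<sigma> t)) = a (Suc n) * real (Suc n) powr - \<sigma> * cos (t * ln (real (Suc n)))"
proof -
  have "of_nat (Suc n) powr - Complex \<sigma> t = exp (- Complex \<sigma> t * of_real (ln (real (Suc n))))"
  proof -
    have L: "Ln (of_nat (Suc n)) = complex_of_real (ln (real (Suc n)))" using Ln_of_real[of "real (Suc n)"] by simp
    show ?thesis unfolding powr_def L using of_nat_neq_0[of n, where 'a = complex] by (simp del: of_nat_Suc)
  qed
  also have "Re \<dots> = exp (- \<sigma> * ln (real (Suc n))) * cos (- t * ln (real (Suc n)))"
    by (simp add: Re_exp)
  finally show ?thesis by (simp add: dterm_def powr_def)
qed

text \<open>The cosine inequality is applied to each term of \<open>log zeta\<close>, whose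
  coefficients are nonnegative. The bound is the eighth power, 8 = 3 + 4 + 1, of the modulus of the
  constant in \<open>Dser_1_exp\<close>, whose value is left open.\<close>

lemma zeta_product_lower_bound:
  obtains c where "c > 0" "\<And>\<sigma> t. \<sigma> > 1 \<Longrightarrow>
    c \<le> norm (Dser (\<lambda>_. 1) (Complex \<sigma> 0)) ^ 3 * norm (Dser (\<lambda>_. 1) (Complex \<sigma> t)) ^ 4 * norm (Dser (\<lambda>_. 1) (Complex \<sigma> (2 * t)))"
proof -
  obtain c where c: "c \<noteq> 0" "\<And>s. 1 < Re s \<Longrightarrow> Dser (\<lambda>_. 1) s = c * exp (Dser mangoldt_ln s)"
    using Dser_1_exp by blast
  have "norm c ^ 8 \<le> norm (Dser (\<lambda>_. 1) (Complex \<sigma> 0)) ^ 3 * norm (Dser (\<lambda>_. 1) (Complex \<sigma> t)) ^ 4 * norm (Dser (\<lambda>_. 1) (Complex \<sigma> (2 * t)))"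
    if \<sigma>: "\<sigma> > 1" for \<sigma> t
  proof -
    define M where "M = (\<lambda>t. Re (Dser mangoldt_ln (Complex \<sigma> t)))"
    have sM: "(\<lambda>n. Re (dterm mangoldt_ln n (Complex \<sigma> t))) sums M t" for t
      unfolding M_def by (intro sums_Re Dser_sums subpoly_mangoldt_ln) (use \<sigma> in simp)
    have "(\<lambda>n. 3 * Re (dterm mangoldt_ln n (Complex \<sigma> 0)) + 4 * Re (dterm mangoldt_ln n (Complex \<sigma> t)) + Re (dterm mangoldt_ln n (Complex \<sigma> (2 * t))))
       sums (3 * M 0 + 4 * M t + M (2 * t))"
      by (intro sums_add sums_mult sM)
    moreover have "0 \<le> 3 * Re (dterm mangoldt_ln n (Complex \<sigma> 0)) + 4 * Re (dterm mangoldt_ln n (Complex \<sigma> t)) + Re (dterm mangoldt_ln n (Complex \<sigma> (2 * t)))" for n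
    proof -
      define w where "w = mangoldt_ln (Suc n) * real (Suc n) powr - \<sigma>"
      have "0 \<le> w * (3 + 4 * cos (t * ln (real (Suc n))) + cos (2 * (t * ln (real (Suc n)))))"
        unfolding w_def by (intro mult_nonneg_nonneg three_four_one mangoldt_ln_bounds) auto
      also have "\<dots> = 3 * Re (dterm mangoldt_ln n (Complex \<sigma> 0)) + 4 * Re (dterm mangoldt_ln n (Complex \<sigma> t)) + Re (dterm mangoldt_ln n (Complex \<sigma> (2 * t)))"
        unfolding Re_dterm w_def[symmetric] by (simp add: algebra_simps del: of_nat_Suc)
      finally show ?thesis .
    qed
    ultimately have nonneg: "0 \<le> 3 * M 0 + 4 * M t + M (2 * t)" by (rule sums_le[OF _ sums_zero, rotated])
    have nZ: "norm (Dser (\<lambda>_. 1) (Complex \<sigma> t)) = norm c * exp (M t)" for t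
      using c(2)[of "Complex \<sigma> t"] \<sigma> by (simp add: norm_mult M_def)
    have "norm (Dser (\<lambda>_. 1) (Complex \<sigma> 0)) ^ 3 * norm (Dser (\<lambda>_. 1) (Complex \<sigma> t)) ^ 4 * norm (Dser (\<lambda>_. 1) (Complex \<sigma> (2 * t)))
       = norm c ^ 8 * exp (3 * M 0 + 4 * M t + M (2 * t))"
    proof -
      have "exp (3 * M 0 + 4 * M t + M (2 * t)) = exp (M 0) ^ 3 * exp (M t) ^ 4 * exp (M (2 * t))"
        unfolding exp_of_nat_mult[symmetric] exp_add[symmetric] by simp
      moreover have "(k * a) ^ 3 * (k * b) ^ 4 * (k * d) = k ^ 8 * (a ^ 3 * b ^ 4 * d)" for k a b d :: real
        by (simp add: power_mult_distrib eval_nat_numeral mult_ac)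
      ultimately show ?thesis unfolding nZ by (simp only:)
    qed
    moreover have "norm c ^ 8 * 1 \<le> norm c ^ 8 * exp (3 * M 0 + 4 * M t + M (2 * t))"
      using nonneg by (intro mult_left_mono) auto
    ultimately show ?thesis by simp
  qed
  then show ?thesis using that[of "norm c ^ 8"] c(1) by simp
qed

text \<open>If there were a zero, then at distance \<open>h\<close> to the right of the line the
  product in \<open>zeta_product_lower_bound\<close> would contain the cube of a simple pole against
  the fourth power of a zero, and tend to 0 like \<open>h\<close>. This keeps the zeros of xi off
  the boundary of the strip.\<close>

lemma zeta1_nonzero_line:
  "zeta1 (Complex 1 t) \<noteq> 0"
proof (cases "t = 0")
  case True
  then have "Complex 1 t = 1" by (simp add: complex_eq_iff)
  then show ?thesis by (simp add: zeta1_1)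
next
  case t: False
  show ?thesis
  proof
    assume z: "zeta1 (Complex 1 t) = 0"
    obtain c where c: "c > 0" "\<And>\<sigma> t. \<sigma> > 1 \<Longrightarrow>
      c \<le> norm (Dser (\<lambda>_. 1) (Complex \<sigma> 0)) ^ 3 * norm (Dser (\<lambda>_. 1) (Complex \<sigma> t)) ^ 4 * norm (Dser (\<lambda>_. 1) (Complex \<sigma> (2 * t)))"
      using zeta_product_lower_bound by blast
    define h where "h = (\<lambda>n. 1 / real (Suc n))"
    have h0: "h n > 0" for n by (simp add: h_def)
    have hlim: "h \<longlonglongrightarrow> 0" unfolding h_def by (rule LIMSEQ_Suc[OF lim_1_over_n])
    define s where "s = (\<lambda>n u. Complex (1 + h n) u)"
    have s_eq: "s n u = Complex 1 u + of_real (h n)" for n u by (simp add: s_def complex_eq_iff)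
    have s_lim: "(\<lambda>n. s n u) \<longlonglongrightarrow> Complex 1 u" for u
      unfolding s_eq using tendsto_add[OF tendsto_const tendsto_of_real[OF hlim], of "Complex 1 u"] by simp
    have isc: "isCont zeta1 (Complex 1 u)" for u
      using zeta1_holomorphic open_Re_gt_minus1 holomorphic_on_imp_continuous_on
      by (intro continuous_on_interior[of "{s. - 1 < Re s}"]) (auto simp: interior_open)
    have zl: "(\<lambda>n. zeta1 (s n u)) \<longlonglongrightarrow> zeta1 (Complex 1 u)" for u
      by (rule isCont_tendsto_compose[OF isc s_lim])
    have "(zeta1 has_field_derivative deriv zeta1 (Complex 1 t)) (at (Complex 1 t))"
      by (rule holomorphic_derivI[OF zeta1_holomorphic open_Re_gt_minus1]) simp
    then have "((\<lambda>k. (zeta1 (Complex 1 t + k) - zeta1 (Complex 1 t)) / k) \<longlongrightarrow> deriv zeta1 (Complex 1 t)) (at 0)"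
      by (simp add: DERIV_def)
    then have "(\<lambda>n. (zeta1 (Complex 1 t + of_real (h n)) - zeta1 (Complex 1 t)) / of_real (h n)) \<longlonglongrightarrow> deriv zeta1 (Complex 1 t)"
    proof (rule filterlim_compose)
      have "(\<lambda>n. complex_of_real (h n)) \<longlonglongrightarrow> 0" using tendsto_of_real[OF hlim] by simp
      then show "filterlim (\<lambda>n. complex_of_real (h n)) (at 0) sequentially"
        using h0 by (intro filterlim_atI) (auto simp: less_imp_neq[symmetric] intro!: always_eventually)
    qed
    then have dl: "(\<lambda>n. zeta1 (s n t) / of_real (h n)) \<longlonglongrightarrow> deriv zeta1 (Complex 1 t)"
      by (simp add: z s_eq)
    have nz: "Complex 1 u - 1 \<noteq> 0" if "u \<noteq> 0" for u using that by (simp add: complex_eq_iff)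
    \<comment> \<open>The same product, regrouped: \<open>h n\<close> to the power - 3 from the pole
      is written as \<open>h n\<close> to the power - 4, absorbed by the difference quotients at the
      zero, times \<open>h n\<close>. All other factors converge.\<close>
    define G where "G = (\<lambda>n. norm (zeta1 (s n 0)) ^ 3 * norm (zeta1 (s n t) / of_real (h n) / (s n t - 1)) ^ 4 * norm (zeta1 (s n (2 * t)) / (s n (2 * t) - 1)) * h n)"
    have "G \<longlonglongrightarrow> norm (zeta1 (Complex 1 0)) ^ 3 * norm (deriv zeta1 (Complex 1 t) / (Complex 1 t - 1)) ^ 4 * norm (zeta1 (Complex 1 (2 * t)) / (Complex 1 (2 * t) - 1)) * 0"
      unfolding G_def using t
      by (intro tendsto_mult tendsto_power tendsto_norm tendsto_divide zl dl hlim tendsto_diff s_lim tendsto_const nz) auto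
    then have "G \<longlonglongrightarrow> 0" by simp
    moreover have "c \<le> G n" for n
    proof -
      have gt: "1 < Re (s n u)" for u using h0[of n] by (simp add: s_def)
      have s0: "s n 0 - 1 = of_real (h n)" by (simp add: s_def complex_eq_iff)
      have "c \<le> norm (zeta1 (s n 0) / of_real (h n)) ^ 3 * norm (zeta1 (s n t) / (s n t - 1)) ^ 4 * norm (zeta1 (s n (2 * t)) / (s n (2 * t) - 1))"
      proof -
        have "c \<le> norm (Dser (\<lambda>_. 1) (s n 0)) ^ 3 * norm (Dser (\<lambda>_. 1) (s n t)) ^ 4 * norm (Dser (\<lambda>_. 1) (s n (2 * t)))"
          unfolding s_def using h0[of n] by (intro c(2)) simp
        then show ?thesis unfolding Dser_1[OF gt] s0 .
      qed
      also have "\<dots> = G n"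
      proof -
        have gen: "(a / k) ^ 3 * (b / d) ^ 4 * e = a ^ 3 * (b / k / d) ^ 4 * e * k" if "k > 0" for a b d e k :: real
        proof -
          have "k ^ 4 = k ^ 3 * k" by (simp add: eval_nat_numeral)
          then show ?thesis unfolding power_divide using that by simp
        qed
        have nh: "norm (complex_of_real (h n)) = h n" using h0[of n] by simp
        show ?thesis unfolding G_def norm_divide nh by (rule gen[OF h0])
      qed
      finally show ?thesis .
    qed
    ultimately have "c \<le> 0" by (intro LIMSEQ_le_const[of G 0]) auto
    with c(1) show False by simp
  qed
qed

lemma zeta1_nonzero: "1 \<le> Re s \<Longrightarrow> zeta1 s \<noteq> 0"
  using zeta1_nonzero_gt_1[of s] zeta1_nonzero_line[of "Im s"] complex_surj[of s]
  by (cases "Re s = 1") force+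

section \<open>Zeros of xi and nontrivial zeros of zeta\<close>

lemma xi_zero_iff: "- 1 < Re s \<Longrightarrow> xi s = 0 \<longleftrightarrow> zeta1 s = 0"
  using not_nonpos_Ints_if_Re_pos[of "s / 2 + 1"]
  by (auto simp: xi_eq_xir xir_def Gamma_eq_zero_iff)

lemma xi_zero_strip:
  assumes "xi s = 0" shows "0 < Re s" "Re s < 1"
proof -
  have a: "Re s < 1" if "xi s = 0" for s
  proof (rule ccontr)
    assume "\<not> Re s < 1"
    then show False using that zeta1_nonzero[of s] xi_zero_iff[of s] by simp
  qed
  from a[OF assms] show "Re s < 1" .
  from a[of "1 - s"] assms show "0 < Re s" by (simp add: xi_functional)
qed

lemma xi_zero_Im:
  assumes "xi s = 0" shows "Im s \<noteq> 0"
proof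
  assume "Im s = 0"
  then have "s = of_real (Re s)" by (simp add: complex_eq_iff)
  then show False using zeta1_real_pos[of "Re s"] xi_zero_strip[OF assms] xi_zero_iff[of s] assms by simp
qed

lemma riemann_zeta_xi:
  "riemann_zeta s = xi s * (of_real pi powr (s / 2) * rGamma (s / 2 + 1) / (s - 1))"
  by (simp add: riemann_zeta_eq zeta_full_def)

lemma nontrivial_zeta_zero_iff: "nontrivial_zeta_zero s \<longleftrightarrow> xi s = 0"
proof
  assume "xi s = 0"
  then show "nontrivial_zeta_zero s"
    using xi_zero_strip[of s] by (simp add: nontrivial_zeta_zero_def riemann_zeta_xi)
next
  assume s: "nontrivial_zeta_zero s"
  then have "s - 1 \<noteq> 0" by (auto simp: nontrivial_zeta_zero_def)
  moreover have "rGamma (s / 2 + 1) \<noteq> 0"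
    using s not_nonpos_Ints_if_Re_pos[of "s / 2 + 1"] by (simp add: nontrivial_zeta_zero_def rGamma_eq_zero_iff)
  ultimately show "xi s = 0" using s by (simp add: nontrivial_zeta_zero_def riemann_zeta_xi)
qed

text \<open>Zeta is xi times the factor \<open>H\<close>, which is holomorphic off 1 and nonzero at
  points of the open strip, so the cofactor changes but the order does not.\<close>

lemma zeta_zero_mult_eq:
  assumes "xi s = 0" shows "zeta_zero_mult s = nat (zorder xi s)"
proof -
  have sr: "0 < Re s" "Re s < 1" using xi_zero_strip[OF assms] by auto
  have all: "(if xi s = 0 then zorder xi s > 0 else zorder xi s = 0) \<and>
      (\<exists>r>0. cball s r \<subseteq> UNIV \<and> zor_poly xi s holomorphic_on cball s r \<and>
      (\<forall>u\<in>cball s r. xi u = zor_poly xi s u * (u - s) ^ nat (zorder xi s) \<and> zor_poly xi s u \<noteq> 0))"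
  proof (rule zorder_exist_zero[OF xi_holomorphic])
    show "\<exists>w\<in>UNIV. xi w \<noteq> 0"
      using zeta1_nonzero[of 2] xi_zero_iff[of 2] by auto
  qed auto
  then have nn: "zorder xi s \<ge> 0" by (auto split: if_splits)
  from all obtain r where r: "r > 0" "zor_poly xi s holomorphic_on cball s r"
    and fac: "\<And>u. u \<in> cball s r \<Longrightarrow> xi u = zor_poly xi s u * (u - s) ^ nat (zorder xi s)"
    and nz: "\<And>u. u \<in> cball s r \<Longrightarrow> zor_poly xi s u \<noteq> 0" by blast
  define H where "H = (\<lambda>s::complex. of_real pi powr (s / 2) * rGamma (s / 2 + 1) / (s - 1))"
  have Hh: "H holomorphic_on - {1}"
    unfolding H_def by (intro holomorphic_intros) auto
  have "zorder riemann_zeta s = zorder xi s"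
  proof (rule zorder_eqI[where S = "ball s r - {1}" and g = "\<lambda>u. zor_poly xi s u * H u"])
    show "open (ball s r - {1})" by (intro open_Diff) auto
    show "s \<in> ball s r - {1}" using r sr by auto
    show "(\<lambda>u. zor_poly xi s u * H u) holomorphic_on ball s r - {1}"
      by (intro holomorphic_on_mult holomorphic_on_subset[OF r(2)] holomorphic_on_subset[OF Hh]) auto
    have "H s \<noteq> 0"
      using sr not_nonpos_Ints_if_Re_pos[of "s / 2 + 1"] by (auto simp: H_def rGamma_eq_zero_iff)
    then show "zor_poly xi s s * H s \<noteq> 0" using nz[of s] r by simp
    fix u assume "u \<in> ball s r - {1}" "u \<noteq> s"
    then show "riemann_zeta u = zor_poly xi s u * H u * (u - s) powi zorder xi s"
      using fac[of u] nn by (simp add: riemann_zeta_xi H_def power_int_def)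
  qed
  then show ?thesis by (simp add: zeta_zero_mult_def)
qed

section \<open>The logarithmic derivative of xi\<close>

lemma norm_Gamma_le:
  assumes z: "Re z > 0" shows "norm (Gamma z) \<le> Gamma (Re z)"
proof -
  have a: "((\<lambda>t. of_real t powr (z - 1) / of_real (exp t)) has_integral Gamma z) {0<..}"
    by (rule Gamma_integral_complex'[OF z])
  have b: "((\<lambda>x. x powr (Re z - 1) * exp (- (1 * x))) has_integral (Gamma (Re z) * 1 powr - Re z)) {0<..}"
    by (rule has_integral_Gamma[OF z]) simp
  have "norm (integral {0<..} (\<lambda>t. of_real t powr (z - 1) / of_real (exp t))) \<le> integral {0<..} (\<lambda>x. x powr (Re z - 1) * exp (- (1 * x)))"
  proof (rule integral_norm_bound_integral)
    fix x :: real assume "x \<in> {0<..}"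
    then show "norm (of_real x powr (z - 1) / of_real (exp x)) \<le> x powr (Re z - 1) * exp (- (1 * x))"
      by (simp add: norm_divide norm_powr_real_powr exp_minus field_simps)
  qed (use a b in \<open>auto simp: integrable_on_def\<close>)
  then show ?thesis using integral_unique[OF a] integral_unique[OF b] by simp
qed

text \<open>Rounding up to a factorial bounds \<open>Gamma x\<close> by \<open>y powr y\<close> for
  an integer \<open>y \<le> x + 2\<close>. Then \<open>ln y \<le> 2 * y powr (1/2)\<close> turns
  \<open>y * ln y\<close> into the exponent 3/2 of \<open>even_entire\<close>.\<close>

lemma Gamma_real_le:
  assumes x: "x \<ge> (1 :: real)" shows "Gamma x \<le> exp (2 * (x + 2) powr (3/2))"
proof -
  define N where "N = nat \<lceil>x\<rceil>"
  have N: "x \<le> real N" "real N \<le> x + 1" using x by (auto simp: N_def)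
  define y where "y = real (Suc N)"
  have y: "y \<ge> 1" "y \<le> x + 2" using N by (auto simp: y_def)
  have "Gamma (x + 1) = x * Gamma x" using x by (intro Gamma_plus1 pos_not_nonpos_Ints) simp
  moreover have "1 * Gamma x \<le> x * Gamma x" using x by (intro mult_right_mono) (auto intro: less_imp_le)
  ultimately have "Gamma x \<le> Gamma (x + 1)" by simp
  also have "\<dots> \<le> Gamma (1 + real (Suc N))"
    using N x by (intro less_imp_le Gamma_real_strict_mono) auto
  also have "\<dots> = fact (Suc N)" by (rule Gamma_fact)
  also have "\<dots> \<le> real (Suc N ^ Suc N)" by (rule fact_le_power)
  also have "\<dots> = y ^ Suc N" by (simp only: y_def of_nat_power)
  also have "\<dots> = exp (y * ln y)"
    using y exp_of_nat_mult[of "Suc N" "ln y"] by (simp add: y_def del: of_nat_Suc power_Suc)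
  also have "\<dots> \<le> exp (2 * (x + 2) powr (3/2))"
  proof -
    have "ln y \<le> y powr (1/2) / (1/2)" using y by (intro ln_powr_bound) auto
    then have "y * ln y \<le> y * (2 * y powr (1/2))" using y by (intro mult_left_mono) auto
    also have "\<dots> = 2 * (y powr 1 * y powr (1/2))" using y by simp
    also have "y powr 1 * y powr (1/2) = y powr (3/2)" unfolding powr_add[symmetric] by simp
    also have "y powr (3/2) \<le> (x + 2) powr (3/2)" using y by (intro powr_mono2) auto
    finally show ?thesis by simp
  qed
  finally show ?thesis .
qed

definition Xi :: "complex \<Rightarrow> complex" where "Xi w = xi (1/2 + w)"

lemma Xi_even: "Xi (- w) = Xi w"
proof -
  have "1/2 + - w = 1 - (1/2 + w)" by simp
  then show ?thesis by (simp only: Xi_def xi_functional)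
qed

lemma Xi_holomorphic: "Xi holomorphic_on UNIV"
proof -
  have "(xi \<circ> (\<lambda>w. 1/2 + w)) holomorphic_on UNIV"
    by (rule holomorphic_on_compose_gen[OF _ xi_holomorphic]) (auto intro!: holomorphic_intros)
  then show ?thesis by (simp only: o_def Xi_def[abs_def])
qed

text \<open>The growth is estimated factor by factor for \<open>Re w \<ge> 0\<close> only; evenness
  carries it to the other half plane.\<close>

lemma Xi_even_entire: obtains C where "even_entire Xi C"
proof -
  obtain K where K: "K > 0" "\<And>s. Re s \<ge> 1/2 \<Longrightarrow> norm (zeta1 s) \<le> K * (1 + norm s) ^ 3"
    using norm_zeta1_le by blast
  \<comment> \<open>In 19, the Gamma factor contributes 16 = 2 * 8 with 8 =
    \<open>4 powr (3/2)\<close>, and the cubic growth of \<open>zeta1\<close> contributes 3;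
    \<open>8 * K\<close> comes from \<open>K * (2 * m) ^ 3\<close>. The power of \<open>pi\<close>
    is at most 1.\<close>
  define C where "C = 19 + 8 * K"
  have half: "norm (Xi w) \<le> exp (C * (1 + norm w) powr (3/2))" if w: "Re w \<ge> 0" for w
  proof -
    define m where "m = 1 + norm w"
    have m: "m \<ge> 1" by (simp add: m_def)
    define M where "M = m powr (3/2)"
    have M: "M \<ge> 1" "m \<le> M"
    proof -
      show "M \<ge> 1" unfolding M_def using m by (intro ge_one_powr_ge_zero) auto
      have "m powr 1 \<le> m powr (3/2)" using m by (intro powr_mono) auto
      then show "m \<le> M" using m by (simp add: M_def)
    qed
    define s where "s = 1/2 + w"
    have s: "Re s \<ge> 1/2" using w by (simp add: s_def)
    have p: "norm (of_real pi powr (- s / 2)) \<le> 1"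
    proof -
      have "norm (of_real pi powr (- s / 2)) = pi powr (- Re s / 2)" by (simp add: norm_powr_real_powr)
      also have "\<dots> \<le> pi powr 0" using s pi_gt3 by (intro powr_mono) auto
      finally show ?thesis by simp
    qed
    have G: "norm (Gamma (s / 2 + 1)) \<le> exp (16 * M)"
    proof -
      have r: "Re (s / 2 + 1) \<ge> 1" using s by simp
      have le: "Re (s / 2 + 1) + 2 \<le> 4 * m"
        using complex_Re_le_cmod[of w] norm_ge_zero[of w] by (simp add: s_def m_def field_simps del: norm_ge_zero)
      have "norm (Gamma (s / 2 + 1)) \<le> Gamma (Re (s / 2 + 1))" using r by (intro norm_Gamma_le) simp
      also have "\<dots> \<le> exp (2 * (Re (s / 2 + 1) + 2) powr (3/2))" by (rule Gamma_real_le[OF r])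
      also have "\<dots> \<le> exp (2 * (4 * m) powr (3/2))"
      proof -
        have "(Re (s / 2 + 1) + 2) powr (3/2) \<le> (4 * m) powr (3/2)" using r by (intro powr_mono2 le) auto
        then show ?thesis by simp
      qed
      also have "(4 * m) powr (3/2) = 4 powr (3/2) * M" using m by (simp add: powr_mult M_def)
      also have "(4::real) powr (3/2) = (2 powr 2) powr (3/2)" by simp
      also have "\<dots> = 8" by (subst powr_powr) (simp add: powr_numeral)
      finally show ?thesis by simp
    qed
    have Z: "norm (zeta1 s) \<le> exp (8 * K) * exp (3 * M)"
    proof -
      have "norm s \<le> norm (1/2 :: complex) + norm w" unfolding s_def by (rule norm_triangle_ineq)
      then have "1 + norm s \<le> 2 * m" using norm_ge_zero[of w] by (simp add: m_def field_simps del: norm_ge_zero)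
      then have "(1 + norm s) ^ 3 \<le> (2 * m) ^ 3" by (intro power_mono) auto
      then have "K * (1 + norm s) ^ 3 \<le> K * (2 * m) ^ 3" using K(1) by (intro mult_left_mono) auto
      with K(2)[OF s] have "norm (zeta1 s) \<le> K * (2 * m) ^ 3" by linarith
      also have "\<dots> = (8 * K) * m ^ 3" by (simp add: power_mult_distrib)
      also have "\<dots> \<le> exp (8 * K) * exp (3 * M)"
      proof (rule mult_mono)
        show "8 * K \<le> exp (8 * K)" using exp_ge_add_one_self[of "8 * K"] by linarith
        have "m \<le> exp M" using exp_ge_add_one_self[of M] M by linarith
        then have "m ^ 3 \<le> exp M ^ 3" using m by (intro power_mono) auto
        also have "\<dots> = exp (3 * M)" by (simp flip: exp_of_nat_mult)
        finally show "m ^ 3 \<le> exp (3 * M)" .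
      qed (use m in auto)
      finally show ?thesis .
    qed
    have "norm (Xi w) = norm (of_real pi powr (- s / 2)) * norm (Gamma (s / 2 + 1)) * norm (zeta1 s)"
      using s by (simp add: Xi_def s_def[symmetric] xi_eq_xir xir_def norm_mult)
    also have "\<dots> \<le> 1 * exp (16 * M) * (exp (8 * K) * exp (3 * M))"
      using p G Z by (intro mult_mono mult_nonneg_nonneg) auto
    also have "\<dots> = exp (19 * M + 8 * K)" by (simp add: exp_add[symmetric])
    also have "\<dots> \<le> exp (C * M)"
    proof -
      have "8 * K * 1 \<le> 8 * K * M" using K M by (intro mult_left_mono) auto
      then show ?thesis by (simp add: C_def algebra_simps)
    qed
    finally show ?thesis by (simp add: M_def m_def)
  qed
  have "even_entire Xi C"
  proof
    show "Xi holomorphic_on UNIV" by (rule Xi_holomorphic)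
    show "Xi (- w) = Xi w" for w by (rule Xi_even)
    show "Xi 0 \<noteq> 0" using zeta1_real_pos[of "1/2"] xi_zero_iff[of "1/2"] by (simp add: Xi_def)
    show "C > 0" using K by (simp add: C_def)
    fix w show "norm (Xi w) \<le> exp (C * (1 + norm w) powr (3/2))"
      using half[of w] half[of "- w"] by (cases "Re w \<ge> 0") (auto simp: Xi_even)
  qed
  then show ?thesis using that by blast
qed

text \<open>The logarithmic derivative of
  \<open>s * (s - 1) * pi powr (- s / 2) * Gamma (s / 2)\<close> at \<open>s = 1/2 + v\<close>; the
  two fractions are \<open>1 / s\<close> and \<open>1 / (s - 1)\<close>.\<close>

definition arch :: "complex \<Rightarrow> complex" where
  "arch v = - of_real (ln pi / 2) + psi_half v + 1 / (v + 1/2) + 1 / (v - 1/2)"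

lemma Xi_logderiv:
  assumes v: "Re v > 1/2"
  shows "Xi v \<noteq> 0" "deriv Xi v / Xi v = arch v - Dser mangoldt (1/2 + v)"
proof -
  define s where "s = 1/2 + v"
  have s: "Re s > 1" using v by (simp add: s_def)
  have nz: "s / 2 + 1 \<notin> \<int>\<^sub>\<le>\<^sub>0" using s by (intro not_nonpos_Ints_if_Re_pos) simp
  have z0: "zeta1 s \<noteq> 0" by (rule zeta1_nonzero_gt_1[OF s])
  have X: "Xi v = xir s" using s by (simp add: Xi_def s_def[symmetric] xi_eq_xir)
  have "xi s \<noteq> 0" using z0 xi_zero_iff[of s] s by simp
  then show X0: "Xi v \<noteq> 0" by (simp add: Xi_def s_def)
  define P where "P = (\<lambda>s::complex. of_real pi powr (- s / 2))"
  define G where "G = (\<lambda>s::complex. Gamma (s / 2 + 1))"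
  have dP: "(P has_field_derivative P s * (- of_real (ln pi / 2))) (at s)"
  proof -
    have "Ln (complex_of_real pi) = of_real (ln pi)" by (rule Ln_of_real) simp
    moreover have "((\<lambda>s::complex. - s / 2) has_field_derivative - 1 / 2) (at s)"
      by (auto intro!: derivative_eq_intros)
    moreover have "of_real pi \<noteq> (0 :: complex)" by simp
    ultimately show ?thesis unfolding P_def
      by (intro DERIV_cong[OF DERIV_chain2[OF has_field_derivative_powr_right]]) auto
  qed
  have dG: "(G has_field_derivative G s * (Digamma (s / 2 + 1) / 2)) (at s)"
    unfolding G_def using nz by (auto intro!: derivative_eq_intros)
  have dZ: "(zeta1 has_field_derivative deriv zeta1 s) (at s)"
    by (rule holomorphic_derivI[OF zeta1_holomorphic open_Re_gt_minus1]) (use s in simp)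
  have "(xir has_field_derivative xir s * (- of_real (ln pi / 2) + Digamma (s / 2 + 1) / 2 + deriv zeta1 s / zeta1 s)) (at s)"
  proof -
    have "xir = (\<lambda>s. P s * G s * zeta1 s)" by (rule ext) (simp add: xir_def P_def G_def)
    note eqf = this
    have val: "xir s = P s * G s * zeta1 s" by (simp only: eqf)
    have D: "((\<lambda>s. P s * G s * zeta1 s) has_field_derivative
        P s * G s * zeta1 s * (- of_real (ln pi / 2) + Digamma (s / 2 + 1) / 2 + deriv zeta1 s / zeta1 s)) (at s)"
      by (rule DERIV_cong[OF DERIV_mult[OF DERIV_mult[OF dP dG] dZ]]) (use z0 in \<open>simp add: algebra_simps\<close>)
    show ?thesis unfolding val by (subst eqf) (rule D)
  qed
  then have "(xi has_field_derivative xir s * (- of_real (ln pi / 2) + Digamma (s / 2 + 1) / 2 + deriv zeta1 s / zeta1 s)) (at s)"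
    by (rule has_field_derivative_transform_within_open[OF _ open_Re_gt_minus1]) (use s in \<open>auto simp: xi_eq_xir\<close>)
  then have "((\<lambda>w. xi (1/2 + w)) has_field_derivative
      xir s * (- of_real (ln pi / 2) + Digamma (s / 2 + 1) / 2 + deriv zeta1 s / zeta1 s) * (0 + 1)) (at v)"
    unfolding s_def by (rule DERIV_chain2[OF _ DERIV_add[OF DERIV_const DERIV_ident]])
  then have "(Xi has_field_derivative Xi v * (- of_real (ln pi / 2) + Digamma (s / 2 + 1) / 2 + deriv zeta1 s / zeta1 s)) (at v)"
    by (simp add: Xi_def[abs_def, symmetric] X)
  then have "deriv Xi v = Xi v * (- of_real (ln pi / 2) + Digamma (s / 2 + 1) / 2 + deriv zeta1 s / zeta1 s)"
    by (rule DERIV_imp_deriv)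
  then have "deriv Xi v / Xi v = - of_real (ln pi / 2) + Digamma (s / 2 + 1) / 2 + (1 / (s - 1) - Dser mangoldt s)"
    using X0 zeta1_logderiv[OF s] by simp
  also have "Digamma (s / 2 + 1) / 2 = psi_half v + 1 / (v + 1/2)"
  proof -
    have s0: "s \<noteq> 0" using s by auto
    then have "Digamma (s / 2 + 1) = Digamma (s / 2) + 1 / (s / 2)" by (intro Digamma_plus1) simp
    moreover have "s / 2 = 1/4 + v / 2" by (simp add: s_def field_simps)
    moreover have "1 / (s / 2) / 2 = 1 / (v + 1/2)"
    proof -
      have "s = v + 1/2" by (simp only: s_def add.commute)
      moreover have "1 / (s / 2) / 2 = 1 / s" by simp
      ultimately show ?thesis by (simp only:)
    qed
    ultimately show ?thesis by (simp add: psi_half_def add_divide_distrib)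
  qed
  also have "s - 1 = v - 1/2" by (simp add: s_def)
  finally show "deriv Xi v / Xi v = arch v - Dser mangoldt (1/2 + v)"
    by (simp add: arch_def s_def)
qed

text \<open>Translates the \<open>Arctan\<close> of the kernel integrals into the logarithm of
  \<open>f_rhs\<close>. The argument \<open>x\<close> of that logarithm has positive real part
  because \<open>Re u > 0\<close>, so \<open>Im (Ln x)\<close> is smaller than \<open>pi / 2\<close>
  in modulus and the quarter turns \<open>- \<i> / x\<close> and \<open>- \<i> * x\<close> stay on
  the principal branch.\<close>

lemma Arctan_exp:
  assumes z: "\<bar>Re z\<bar> < pi"
  defines "L \<equiv> Ln ((1 - tan (z / 4)) / (1 + tan (z / 4)))"
  shows "Arctan (exp (\<i> * z / 2)) = of_real (pi / 4) - \<i> / 2 * L"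
    "Arctan (exp (\<i> * (- z) / 2)) = of_real (pi / 4) + \<i> / 2 * L"
    "tan (z / 4) = - \<i> * (exp (\<i> * z / 2) - 1) / (exp (\<i> * z / 2) + 1)"
proof -
  define u where "u = exp (\<i> * z / 2)"
  have u: "Re u > 0" using exp_half_Re_pos[OF z] by (simp add: u_def)
  then have nz: "u \<noteq> 0" "u + 1 \<noteq> 0" "u + \<i> \<noteq> 0" "u - \<i> \<noteq> 0" by (auto simp: complex_eq_iff)
  define p where "p = exp (\<i> * (z / 4))"
  have p: "p \<noteq> 0" "u = p * p" by (auto simp: p_def u_def exp_add[symmetric])
  have sinp: "sin (z / 4) = (p - 1 / p) / (2 * \<i>)" by (simp add: sin_exp_eq p_def exp_minus inverse_eq_divide)
  have cosp: "cos (z / 4) = (p + 1 / p) / 2" by (simp add: cos_exp_eq p_def exp_minus inverse_eq_divide)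
  have "tan (z / 4) = ((p - 1 / p) / (2 * \<i>)) / ((p + 1 / p) / 2)" by (simp only: tan_def sinp cosp)
  also have "\<dots> = - \<i> * ((p - 1 / p) / (p + 1 / p))"
  proof -
    have "a / (2 * \<i>) / (b / 2) = - \<i> * (a / b)" for a b :: complex
      by (cases "b = 0") (simp_all add: field_simps)
    then show ?thesis .
  qed
  also have "(p - 1 / p) / (p + 1 / p) = (p * (p - 1 / p)) / (p * (p + 1 / p))" using p by simp
  also have "\<dots> = (u - 1) / (u + 1)" using p by (simp add: right_diff_distrib distrib_left)
  finally have t: "tan (z / 4) = - \<i> * ((u - 1) / (u + 1))" .
  then show "tan (z / 4) = - \<i> * (exp (\<i> * z / 2) - 1) / (exp (\<i> * z / 2) + 1)" by (simp add: u_def)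
  have ut: "(u + 1) * tan (z / 4) = - \<i> * (u - 1)" using nz unfolding t by simp
  define x where "x = \<i> * (u - \<i>) / (u + \<i>)"
  have tx: "(1 - tan (z / 4)) / (1 + tan (z / 4)) = x"
  proof -
    have "(1 - tan (z / 4)) / (1 + tan (z / 4)) = ((u + 1) * (1 - tan (z / 4))) / ((u + 1) * (1 + tan (z / 4)))"
      using nz by simp
    also have "(u + 1) * (1 - tan (z / 4)) = (1 + \<i>) * (u - \<i>)"
      unfolding right_diff_distrib[of "u + 1"] ut by (simp add: algebra_simps)
    also have "(u + 1) * (1 + tan (z / 4)) = (1 - \<i>) * (u + \<i>)"
      unfolding distrib_left[of "u + 1"] ut by (simp add: algebra_simps)
    also have "(1 + \<i>) * (u - \<i>) / ((1 - \<i>) * (u + \<i>)) = ((1 + \<i>) / (1 - \<i>)) * ((u - \<i>) / (u + \<i>))" by simp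
    also have "(1 + \<i>) / (1 - \<i>) = \<i>" by (simp add: complex_eq_iff Re_divide Im_divide)
    finally show ?thesis by (simp add: x_def)
  qed
  have x0: "x \<noteq> 0" using nz by (simp add: x_def)
  have Rex: "Re x > 0"
  proof -
    have "Re x = 2 * Re u / ((Re u)\<^sup>2 + (Im u + 1)\<^sup>2)"
      by (simp add: x_def Re_divide) (simp add: algebra_simps power2_eq_square)
    then show ?thesis using u by (simp add: add_pos_nonneg)
  qed
  have Lx: "L = Ln x" by (simp add: L_def tx)
  have ImL: "\<bar>Im (Ln x)\<bar> < pi / 2" using Rex x0 Re_Ln_pos_lt by blast
  have A: "Arctan u = \<i> / 2 * Ln (- \<i> / x)"
  proof -
    have "(1 - \<i> * u) / (1 + \<i> * u) = - \<i> / x"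
    proof -
      have "1 - \<i> * u = - \<i> * (u + \<i>)" "1 + \<i> * u = \<i> * (u - \<i>)" by (simp_all add: algebra_simps)
      then show ?thesis using nz by (simp add: x_def field_simps)
    qed
    then show ?thesis by (simp add: Arctan_def)
  qed
  have "exp (\<i> * of_real (pi / 2)) = \<i>" using cis_conv_exp[of "pi / 2"] by simp
  then have e: "exp (- \<i> * of_real (pi / 2)) = - \<i>"
    unfolding mult_minus_left exp_minus by simp
  have "Ln (- \<i> / x) = - \<i> * of_real (pi / 2) - Ln x"
  proof (rule Ln_unique)
    show "exp (- \<i> * of_real (pi / 2) - Ln x) = - \<i> / x"
      by (simp only: exp_diff e exp_Ln[OF x0])
  qed (use ImL in auto)
  with A have "Arctan u = \<i> / 2 * (- \<i> * of_real (pi / 2) - L)" by (simp only: Lx)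
  also have "\<dots> = of_real (pi / 4) - \<i> / 2 * L"
    unfolding right_diff_distrib by simp
  finally show "Arctan (exp (\<i> * z / 2)) = of_real (pi / 4) - \<i> / 2 * L"
    unfolding u_def .
  have B: "Arctan (1 / u) = \<i> / 2 * Ln (- \<i> * x)"
  proof -
    have "(1 - \<i> * (1 / u)) / (1 + \<i> * (1 / u)) = (u * (1 - \<i> * (1 / u))) / (u * (1 + \<i> * (1 / u)))" using nz by simp
    also have "\<dots> = (u - \<i>) / (u + \<i>)" using nz by (simp add: right_diff_distrib distrib_left)
    also have "\<dots> = - \<i> * x" by (simp add: x_def)
    finally show ?thesis by (simp add: Arctan_def)
  qed
  have "Ln (- \<i> * x) = - \<i> * of_real (pi / 2) + Ln x"
  proof (rule Ln_unique)
    show "exp (- \<i> * of_real (pi / 2) + Ln x) = - \<i> * x"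
      by (simp only: exp_add e exp_Ln[OF x0])
  qed (use ImL in auto)
  with B have "Arctan (1 / u) = \<i> / 2 * (- \<i> * of_real (pi / 2) + L)" by (simp only: Lx)
  also have "\<dots> = of_real (pi / 4) + \<i> / 2 * L"
    unfolding distrib_left by simp
  finally have "Arctan (1 / u) = of_real (pi / 4) + \<i> / 2 * L" .
  moreover have "exp (\<i> * (- z) / 2) = 1 / u" by (simp add: u_def exp_minus inverse_eq_divide)
  ultimately show "Arctan (exp (\<i> * (- z) / 2)) = of_real (pi / 4) + \<i> / 2 * L"
    by (simp only:)
qed

section \<open>Sums over zeros\<close>

lemma sker_line_continuous: "c \<notin> \<int> \<Longrightarrow> continuous_on {s. Re s = c} (sker z)"
  using ker_line_continuous[of c z] ker_line_continuous[of c "- z"]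
  unfolding sker_eq by (auto intro!: continuous_intros)

lemma sker_line_integrable:
  assumes "\<bar>Re z\<bar> < pi" "polyb G c c" "c \<notin> \<int>" "continuous_on {s. Re s = c} G"
  shows "integrable lborel (\<lambda>t. sker z (Complex c t) * G (Complex c t))"
  using vdecay_integrable[OF vdecay_sker_times[OF assms(1,2)]] assms(4) sker_line_continuous[OF assms(3)]
  by (auto intro: continuous_on_mult)

lemma sker_power_integrable:
  assumes "\<bar>Re z\<bar> < pi" "c \<notin> \<int>"
  shows "integrable lborel (\<lambda>t. sker z (Complex c t) * of_real (D * (1 + norm (Complex c t)) ^ k))"
proof (rule sker_line_integrable[OF assms(1) _ assms(2)])
  show "polyb (\<lambda>v. of_real (D * (1 + norm v) ^ k)) c c"
    unfolding polyb_def by (rule exI[of _ "\<bar>D\<bar>"], rule exI[of _ k]) (auto simp: abs_mult simp del: of_real_mult of_real_add of_real_power)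
qed (auto intro!: continuous_intros)

text \<open>Dominated convergence: a polynomial bound uniform in \<open>n\<close> is integrable
  against the exponentially decaying kernel.\<close>

lemma vint_sker_limit:
  assumes z: "\<bar>Re z\<bar> < pi" and c: "c \<notin> \<int>"
    and cont: "\<And>n. continuous_on {s. Re s = c} (G n)"
    and bound: "\<And>n v. Re v = c \<Longrightarrow> norm (G n v) \<le> D * (1 + norm v) ^ k"
    and lim: "\<And>v. Re v = c \<Longrightarrow> (\<lambda>n. G n v) \<longlonglongrightarrow> L v"
  shows "(\<lambda>n. vint (\<lambda>v. sker z v * G n v) c) \<longlonglongrightarrow> vint (\<lambda>v. sker z v * L v) c"
proof -
  have meas: "(\<lambda>t. sker z (Complex c t) * G n (Complex c t)) \<in> borel_measurable borel" for n
    using vline_measurable[of c "\<lambda>v. sker z v * G n v"] cont sker_line_continuous[OF c]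
    by (auto intro: continuous_on_mult)
  have conv: "(\<lambda>n. sker z (Complex c t) * G n (Complex c t)) \<longlonglongrightarrow> sker z (Complex c t) * L (Complex c t)" for t
    by (intro tendsto_mult tendsto_const lim) simp
  have "(\<lambda>n. LINT t|lborel. sker z (Complex c t) * G n (Complex c t))
      \<longlonglongrightarrow> (LINT t|lborel. sker z (Complex c t) * L (Complex c t))"
  proof (rule integral_dominated_convergence)
    show "(\<lambda>t. sker z (Complex c t) * L (Complex c t)) \<in> borel_measurable lborel"
      using borel_measurable_LIMSEQ_metric[OF meas conv] by simp
    show "(\<lambda>t. sker z (Complex c t) * G n (Complex c t)) \<in> borel_measurable lborel" for n
      using meas by simp
    show "integrable lborel (\<lambda>t. norm (sker z (Complex c t) * of_real (D * (1 + norm (Complex c t)) ^ k)))"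
      by (rule integrable_norm[OF sker_power_integrable[OF z c]])
    show "AE t in lborel. (\<lambda>n. sker z (Complex c t) * G n (Complex c t)) \<longlonglongrightarrow> sker z (Complex c t) * L (Complex c t)"
      using conv by simp
    have "norm (sker z (Complex c t) * G n (Complex c t)) \<le> norm (sker z (Complex c t) * of_real (D * (1 + norm (Complex c t)) ^ k))" for n t
      unfolding norm_mult norm_of_real
      using bound[of "Complex c t" n] by (intro mult_left_mono) auto
    then show "AE t in lborel. norm (sker z (Complex c t) * G n (Complex c t)) \<le> norm (sker z (Complex c t) * of_real (D * (1 + norm (Complex c t)) ^ k))" for n
      by simp
  qed
  then show ?thesis unfolding vint_def by (intro tendsto_divide tendsto_const) auto
qed

text \<open>The constant is independent of \<open>G\<close> and \<open>D\<close>. Applied to the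
  fractions of a pair of zeros, it bounds \<open>sker z w\<close> uniformly in the zero
  \<open>w\<close>.\<close>

lemma norm_vint_sker_le:
  assumes z: "\<bar>Re z\<bar> < pi" and c: "c \<notin> \<int>"
  obtains K where "\<And>G D. continuous_on {s. Re s = c} G \<Longrightarrow> (\<And>v. Re v = c \<Longrightarrow> norm (G v) \<le> D * (1 + norm v) ^ k) \<Longrightarrow>
    norm (vint (\<lambda>v. sker z v * G v) c) \<le> D * K"
proof
  fix G :: "complex \<Rightarrow> complex" and D
  assume G: "continuous_on {s. Re s = c} G" and b: "\<And>v. Re v = c \<Longrightarrow> norm (G v) \<le> D * (1 + norm v) ^ k"
  let ?w = "\<lambda>t. norm (sker z (Complex c t)) * (1 + norm (Complex c t)) ^ k"
  have w: "integrable lborel ?w"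
    using integrable_norm[OF sker_power_integrable[OF z c, of 1 k]]
    by (simp add: norm_mult del: of_real_mult of_real_add of_real_power)
  have G': "polyb G c c" unfolding polyb_def using b by (intro exI[of _ D] exI[of _ k]) auto
  have "norm (LINT t|lborel. sker z (Complex c t) * G (Complex c t)) \<le> (LINT t|lborel. D * ?w t)"
  proof (rule Bochner_Integration.integral_norm_bound_integral)
    show "integrable lborel (\<lambda>t. sker z (Complex c t) * G (Complex c t))"
      by (rule sker_line_integrable[OF z G' c G])
    show "integrable lborel (\<lambda>t. D * ?w t)"
      by (rule integrable_mult_right[OF w])
    fix t
    have "norm (sker z (Complex c t)) * norm (G (Complex c t)) \<le> norm (sker z (Complex c t)) * (D * (1 + norm (Complex c t)) ^ k)"
      using b[of "Complex c t"] by (intro mult_left_mono) auto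
    then show "norm (sker z (Complex c t) * G (Complex c t)) \<le> D * ?w t"
      by (simp add: norm_mult mult.left_commute)
  qed
  then have "norm (vint (\<lambda>v. sker z v * G v) c) \<le> (D * (LINT t|lborel. ?w t)) / (2 * pi)"
    unfolding vint_def norm_divide by (simp add: divide_right_mono)
  then show "norm (vint (\<lambda>v. sker z v * G v) c) \<le> D * ((LINT t|lborel. ?w t) / (2 * pi))"
    by (simp only: times_divide_eq_right)
qed

lemma vint_sker_sum:
  assumes z: "\<bar>Re z\<bar> < pi" and c: "c \<notin> \<int>" and fin: "finite I"
    and G: "\<And>i. i \<in> I \<Longrightarrow> continuous_on {s. Re s = c} (G i)" "\<And>i. i \<in> I \<Longrightarrow> polyb (G i) c c"
  shows "vint (\<lambda>v. sker z v * (\<Sum>i\<in>I. a i * G i v)) c = (\<Sum>i\<in>I. a i * vint (\<lambda>v. sker z v * G i v) c)"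
proof -
  have int: "integrable lborel (\<lambda>t. a i * (sker z (Complex c t) * G i (Complex c t)))" if "i \<in> I" for i
    using sker_line_integrable[OF z G(2)[OF that] c G(1)[OF that]] by (rule integrable_mult_right)
  have "(LINT t|lborel. sker z (Complex c t) * (\<Sum>i\<in>I. a i * G i (Complex c t)))
      = (LINT t|lborel. (\<Sum>i\<in>I. a i * (sker z (Complex c t) * G i (Complex c t))))"
    by (simp only: sum_distrib_left mult.left_commute)
  also have "\<dots> = (\<Sum>i\<in>I. LINT t|lborel. a i * (sker z (Complex c t) * G i (Complex c t)))"
    by (rule Bochner_Integration.integral_sum[OF int])
  also have "\<dots> = (\<Sum>i\<in>I. a i * (LINT t|lborel. sker z (Complex c t) * G i (Complex c t)))"
    by (simp only: integral_mult_right_zero)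
  finally show ?thesis unfolding vint_def
    by (simp only: sum_divide_distrib times_divide_eq_right)
qed

text \<open>Pairing \<open>w\<close> with \<open>- w\<close> gives
  \<open>2 * v / ((v - w) * (v + w))\<close>, which decays quadratically in \<open>w\<close>. Each
  denominator is at least 3/4 - 1/2 = 1/4 in modulus, hence at least
  \<open>norm w / (4 * (1 + norm v))\<close> by the triangle inequality; 32 is
  \<open>2 * 4 ^ 2\<close>.\<close>

lemma norm_pair_fraction_le:
  fixes v w :: complex
  assumes v: "Re v = 3/4" and w: "\<bar>Re w\<bar> < 1/2" "w \<noteq> 0"
  shows "norm (1 / (v - w) + 1 / (v + w)) \<le> (32 / norm w ^ 2) * (1 + norm v) ^ 3"
proof -
  define A B where "A = norm (v - w)" and "B = norm (v + w)"
  have A4: "A \<ge> 1/4" using norm_ge_Re_diff[of v w] v w by (simp add: A_def abs_less_iff)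
  have B4: "B \<ge> 1/4" using norm_ge_Re_diff[of v "- w"] v w by (simp add: B_def abs_less_iff)
  have nz: "v - w \<noteq> 0" "v + w \<noteq> 0" using A4 B4 by (auto simp: A_def B_def)
  have wA: "norm w \<le> A + norm v" using norm_triangle_ineq4[of v "v - w"] by (simp add: A_def add.commute)
  have wB: "norm w \<le> B + norm v" using norm_triangle_ineq4[of "v + w" v] by (simp add: B_def)
  have "norm v \<le> 4 * A * norm v" "norm v \<le> 4 * B * norm v"
    using A4 B4 by (auto intro!: mult_left_le_one_le mult_right_mono[of 1 _ "norm v", simplified])
  then have "norm w \<le> A * (4 * (1 + norm v))" "norm w \<le> B * (4 * (1 + norm v))"
    using wA wB A4 B4 by (auto simp: algebra_simps)
  then have "norm w * norm w \<le> (A * (4 * (1 + norm v))) * (B * (4 * (1 + norm v)))"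
    using A4 by (intro mult_mono) auto
  then have ww: "norm w ^ 2 \<le> 16 * (1 + norm v) ^ 2 * (A * B)" by (simp add: power2_eq_square algebra_simps)
  have eq: "1 / (v - w) + 1 / (v + w) = 2 * v / ((v - w) * (v + w))"
    using nz by (simp add: field_simps)
  have AB: "A * B > 0" using A4 B4 by (intro mult_pos_pos) auto
  have w0: "norm w ^ 2 > 0" using w by simp
  have "norm (1 / (v - w) + 1 / (v + w)) = 2 * norm v / (A * B)"
    unfolding eq by (simp add: norm_mult norm_divide A_def B_def)
  also have "\<dots> \<le> 2 * (1 + norm v) / (A * B)" using AB by (intro divide_right_mono) auto
  also have "\<dots> \<le> (32 / norm w ^ 2) * (1 + norm v) ^ 3"
  proof -
    have "2 * (1 + norm v) * norm w ^ 2 \<le> 2 * (1 + norm v) * (16 * (1 + norm v) ^ 2 * (A * B))"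
      using ww by (intro mult_left_mono) auto
    then have "2 * (1 + norm v) * norm w ^ 2 \<le> 32 * (1 + norm v) ^ 3 * (A * B)"
      by (simp add: power2_eq_square power3_eq_cube algebra_simps)
    then show ?thesis using AB w0 by (simp add: divide_simps mult.commute mult.left_commute)
  qed
  finally show ?thesis .
qed

text \<open>No zero is real, so the zeros in a disc are those in the upper half plane together with
  their negatives, of equal multiplicity.\<close>

lemma (in even_entire) logderiv_upper:
  assumes im: "\<And>w. X w = 0 \<Longrightarrow> Im w \<noteq> 0" and v: "X v \<noteq> 0"
  shows "(\<lambda>n. \<Sum>w\<in>{w. X w = 0 \<and> Im w > 0} \<inter> cball 0 (real n). of_nat (mult w) * (1 / (v - w) + 1 / (v + w)))
    \<longlonglongrightarrow> deriv X v / X v"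
proof -
  have "(\<Sum>w\<in>Z \<inter> cball 0 r. of_nat (mult w) / (v - w)) =
      (\<Sum>w\<in>{w. X w = 0 \<and> Im w > 0} \<inter> cball 0 r. of_nat (mult w) * (1 / (v - w) + 1 / (v + w)))" for r
  proof -
    define P where "P = {w. X w = 0 \<and> Im w > 0} \<inter> cball 0 r"
    have PZ: "Z \<inter> cball 0 r = P \<union> uminus ` P"
    proof (intro equalityI subsetI)
      fix w assume w: "w \<in> Z \<inter> cball 0 r"
      then have "Im w > 0 \<or> Im w < 0" using im[of w] by (auto simp: Z_def)
      then show "w \<in> P \<union> uminus ` P"
      proof
        assume "Im w < 0"
        then have "- w \<in> P" using w by (simp add: P_def Z_def even)
        then show ?thesis by (metis UnI2 imageI minus_minus)
      qed (use w in \<open>simp add: P_def Z_def\<close>)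
    qed (auto simp: P_def Z_def even)
    have fin: "finite P" using finite_zeros[of r] PZ by (metis finite_Un)
    have disj: "P \<inter> uminus ` P = {}" by (auto simp: P_def)
    have inj: "inj_on uminus P" by (rule inj_onI) simp
    have "(\<Sum>w\<in>Z \<inter> cball 0 r. of_nat (mult w) / (v - w)) =
      (\<Sum>w\<in>P. of_nat (mult w) / (v - w)) + (\<Sum>w\<in>P. of_nat (mult (- w)) / (v - (- w)))"
      unfolding PZ by (simp only: sum.union_disjoint[OF fin finite_imageI[OF fin] disj] sum.reindex[OF inj] o_def)
    also have "\<dots> = (\<Sum>w\<in>P. of_nat (mult w) * (1 / (v - w) + 1 / (v + w)))"
      unfolding sum.distrib[symmetric] mult_uminus by (intro sum.cong) (simp_all add: distrib_left)
    finally show ?thesis by (simp only: P_def)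
  qed
  then show ?thesis using logderiv_limit[OF v] by (simp only:)
qed

text \<open>By \<open>sker_Cauchy\<close> each summand is a line integral, of size at most a
  constant times \<open>mult w / norm w ^ 2\<close>. Hence the sum converges unconditionally, and
  its value may be computed along growing discs, where \<open>logderiv_upper\<close> gives the limit
  under the integral.\<close>

lemma (in even_entire) sker_zero_sum:
  assumes z: "\<bar>Re z\<bar> < pi" and zeros: "\<And>w. X w = 0 \<Longrightarrow> \<bar>Re w\<bar> < 1/2" "\<And>w. X w = 0 \<Longrightarrow> Im w \<noteq> 0"
  shows "((\<lambda>w. of_nat (mult w) * sker z w) has_sum
    vint (\<lambda>v. sker z v * (deriv X v / X v)) (3/4)) {w. X w = 0 \<and> Im w > 0}"
proof -
  define P where "P = {w. X w = 0 \<and> Im w > 0}"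
  define f where "f = (\<lambda>w. of_nat (mult w) * sker z w)"
  define G where "G = (\<lambda>w v :: complex. 1 / (v - w) + 1 / (v + w))"
  have PZ: "P \<subseteq> Z" by (auto simp: P_def Z_def)
  have PD: "\<bar>Re w\<bar> < 1/2" "w \<noteq> 0" if "w \<in> P" for w using that zeros by (auto simp: P_def)
  have cZ: "(3/4::real) \<notin> \<int>" by (rule unit_interval_not_Ints) auto
  have Gle: "norm (G w v) \<le> (32 / norm w ^ 2) * (1 + norm v) ^ 3" if "w \<in> P" "Re v = 3/4" for w v
    unfolding G_def by (rule norm_pair_fraction_le[OF that(2) PD[OF that(1)]])
  have Gcont: "continuous_on {s. Re s = 3/4} (G w)" if "w \<in> P" for w
  proof -
    have "s - w \<noteq> 0" "s + w \<noteq> 0" if "Re s = 3/4" for s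
      using PD[OF \<open>w \<in> P\<close>] that by (auto simp: complex_eq_iff abs_less_iff)
    then show ?thesis unfolding G_def by (intro continuous_intros) auto
  qed
  have Gpoly: "polyb (G w) (3/4) (3/4)" if "w \<in> P" for w
    unfolding polyb_def using Gle[OF that] by (intro exI[of _ "32 / norm w ^ 2"] exI[of _ 3]) auto
  have Cauchy: "sker z w = vint (\<lambda>v. sker z v * G w v) (3/4)" if "w \<in> P" for w
    unfolding G_def using PD[OF that] by (intro sker_Cauchy[OF z]) auto
  obtain K where K: "\<And>G D. continuous_on {s. Re s = 3/4} G \<Longrightarrow> (\<And>v. Re v = 3/4 \<Longrightarrow> norm (G v) \<le> D * (1 + norm v) ^ 3) \<Longrightarrow>
    norm (vint (\<lambda>v. sker z v * G v) (3/4)) \<le> D * K"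
    using norm_vint_sker_le[OF z cZ] by blast
  have fle: "norm (f w) \<le> 32 * K * (real (mult w) / norm w ^ 2)" if "w \<in> P" for w
  proof -
    have "norm (sker z w) \<le> (32 / norm w ^ 2) * K"
      unfolding Cauchy[OF that] by (rule K[OF Gcont[OF that] Gle[OF that]])
    then have "real (mult w) * norm (sker z w) \<le> real (mult w) * ((32 / norm w ^ 2) * K)"
      by (rule mult_left_mono) simp
    then show ?thesis unfolding f_def by (simp add: norm_mult mult.commute mult.left_commute)
  qed
  have sq: "(\<lambda>w. real (mult w) / norm w ^ 2) summable_on P"
    by (rule summable_on_subset_banach[OF inverse_square_summable PZ])
  have "(\<lambda>w. norm (f w)) summable_on P"
    by (rule summable_on_comparison_test[OF summable_on_cmult_right[OF sq, of "32 * K"]]) (use fle in auto)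
  then have "f summable_on P" by (rule abs_summable_summable)
  then have hs: "(f has_sum infsum f P) P" by (rule has_sum_infsum)
  define Pn where "Pn = (\<lambda>n. P \<inter> cball 0 (real n))"
  have fin: "finite (Pn n)" for n
    by (rule finite_subset[OF _ finite_zeros[of "real n"]]) (use PZ in \<open>auto simp: Pn_def\<close>)
  have PnP: "Pn n \<subseteq> P" for n by (auto simp: Pn_def)
  \<comment> \<open>The discs exhaust the zeros: every finite set of zeros lies in all large
    ones.\<close>
  have "filterlim Pn (finite_subsets_at_top P) sequentially"
    unfolding filterlim_finite_subsets_at_top
  proof (intro allI impI)
    fix A assume A: "finite A \<and> A \<subseteq> P"
    then have "bounded A" using finite_imp_bounded by blast
    then obtain b where b: "\<And>x. x \<in> A \<Longrightarrow> norm x \<le> b" unfolding bounded_iff by blast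
    obtain n0 where n0: "b \<le> real n0" using real_arch_simple by blast
    have "finite (Pn n) \<and> A \<subseteq> Pn n \<and> Pn n \<subseteq> P" if "n \<ge> n0" for n
    proof -
      have "real n0 \<le> real n" using that by simp
      then have "A \<subseteq> Pn n" using A order_trans[OF b order_trans[OF n0]] unfolding Pn_def by (auto simp: dist_norm)
      then show ?thesis using fin PnP by blast
    qed
    then show "\<forall>\<^sub>F n in sequentially. finite (Pn n) \<and> A \<subseteq> Pn n \<and> Pn n \<subseteq> P"
      unfolding eventually_sequentially by blast
  qed
  then have lim1: "(\<lambda>n. sum f (Pn n)) \<longlonglongrightarrow> infsum f P"
    using hs unfolding has_sum_def by (rule filterlim_compose[rotated])
  have sumf: "sum f (Pn n) = vint (\<lambda>v. sker z v * (\<Sum>w\<in>Pn n. of_nat (mult w) * G w v)) (3/4)" for n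
  proof -
    have "vint (\<lambda>v. sker z v * (\<Sum>w\<in>Pn n. of_nat (mult w) * G w v)) (3/4) =
      (\<Sum>w\<in>Pn n. of_nat (mult w) * vint (\<lambda>v. sker z v * G w v) (3/4))"
      by (rule vint_sker_sum[OF z cZ fin]) (use PnP Gcont Gpoly in auto)
    also have "\<dots> = sum f (Pn n)"
    proof (rule sum.cong[OF refl])
      fix w assume "w \<in> Pn n"
      then have "w \<in> P" using PnP by auto
      then show "of_nat (mult w) * vint (\<lambda>v. sker z v * G w v) (3/4) = f w"
        unfolding f_def by (simp only: Cauchy)
    qed
    finally show ?thesis by simp
  qed
  \<comment> \<open>One constant for all partial sums over discs, as dominated convergence
    requires.\<close>
  define D where "D = 32 * infsum (\<lambda>w. real (mult w) / norm w ^ 2) P"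
  have "(\<lambda>n. vint (\<lambda>v. sker z v * (\<Sum>w\<in>Pn n. of_nat (mult w) * G w v)) (3/4)) \<longlonglongrightarrow> vint (\<lambda>v. sker z v * (deriv X v / X v)) (3/4)"
  proof (rule vint_sker_limit[OF z cZ])
    show "continuous_on {s. Re s = 3/4} (\<lambda>v. \<Sum>w\<in>Pn n. of_nat (mult w) * G w v)" for n
      using PnP Gcont by (intro continuous_intros) auto
  next
    fix n and v :: complex assume v: "Re v = 3/4"
    have "norm (\<Sum>w\<in>Pn n. of_nat (mult w) * G w v) \<le> (\<Sum>w\<in>Pn n. real (mult w) / norm w ^ 2 * (32 * (1 + norm v) ^ 3))"
    proof (rule sum_norm_le)
      fix w assume "w \<in> Pn n"
      then have "norm (G w v) \<le> (32 / norm w ^ 2) * (1 + norm v) ^ 3" using Gle[OF _ v] PnP by blast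
      then have "real (mult w) * norm (G w v) \<le> real (mult w) * ((32 / norm w ^ 2) * (1 + norm v) ^ 3)"
        by (rule mult_left_mono) simp
      then show "norm (of_nat (mult w) * G w v) \<le> real (mult w) / norm w ^ 2 * (32 * (1 + norm v) ^ 3)"
        by (simp add: norm_mult mult.commute mult.left_commute)
    qed
    also have "\<dots> = (\<Sum>w\<in>Pn n. real (mult w) / norm w ^ 2) * (32 * (1 + norm v) ^ 3)"
      by (simp only: sum_distrib_right)
    also have "\<dots> \<le> infsum (\<lambda>w. real (mult w) / norm w ^ 2) P * (32 * (1 + norm v) ^ 3)"
      by (intro mult_right_mono finite_sum_le_infsum sq fin PnP) auto
    finally show "norm (\<Sum>w\<in>Pn n. of_nat (mult w) * G w v) \<le> D * (1 + norm v) ^ 3"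
      by (simp add: D_def mult.commute mult.left_commute)
  next
    fix v :: complex assume v: "Re v = 3/4"
    then have "X v \<noteq> 0" using zeros(1)[of v] by auto
    then show "(\<lambda>n. \<Sum>w\<in>Pn n. of_nat (mult w) * G w v) \<longlonglongrightarrow> deriv X v / X v"
      unfolding Pn_def P_def G_def using zeros(2) by (intro logderiv_upper) auto
  qed
  then have "(\<lambda>n. sum f (Pn n)) \<longlonglongrightarrow> vint (\<lambda>v. sker z v * (deriv X v / X v)) (3/4)"
    by (simp only: sumf)
  then have "infsum f P = vint (\<lambda>v. sker z v * (deriv X v / X v)) (3/4)"
    using lim1 by (rule LIMSEQ_unique[rotated])
  then show ?thesis using hs unfolding f_def P_def by (simp only:)
qed

section \<open>Sums over prime powers\<close>

lemma vint_sker: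
  assumes z: "\<bar>Re z\<bar> < pi" and G: "polyb G c c" "c \<notin> \<int>" "continuous_on {s. Re s = c} G"
  shows "vint (\<lambda>v. sker z v * G v) c = (vint (\<lambda>v. ker z v * G v) c - vint (\<lambda>v. ker (- z) v * G v) c) / (2 * \<i>)"
proof -
  have z': "\<bar>Re (- z)\<bar> < pi" using z by simp
  note int = ker_line_integrable[OF z G] ker_line_integrable[OF z' G]
  have "sker z v * G v = (ker z v * G v - ker (- z) v * G v) / (2 * \<i>)" for v
    by (simp only: sker_eq times_divide_eq_left left_diff_distrib)
  then have "vint (\<lambda>v. sker z v * G v) c =
      ((LINT t|lborel. ker z (Complex c t) * G (Complex c t)) - (LINT t|lborel. ker (- z) (Complex c t) * G (Complex c t))) / (2 * \<i>) / (2 * of_real pi)"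
    using int by (simp only: vint_def integral_divide_zero Bochner_Integration.integral_diff)
  also have "\<dots> = (vint (\<lambda>v. ker z v * G v) c - vint (\<lambda>v. ker (- z) v * G v) c) / (2 * \<i>)"
  proof -
    have "(a - b) / k / l = (a / l - b / l) / k" for a b k l :: complex
      by (simp add: diff_divide_distrib mult.commute)
    then show ?thesis by (simp only: vint_def)
  qed
  finally show ?thesis .
qed

lemma polyb_dterm: "polyb (\<lambda>v. dterm a n (1/2 + v)) c c"
  by (rule polyb_bounded[where D = "\<bar>a (Suc n)\<bar> * real (Suc n) powr - (1/2 + c)"]) (simp add: norm_dterm del: of_nat_Suc)

lemma dterm_vline_continuous: "continuous_on {s. Re s = c} (\<lambda>v. dterm a n (1/2 + v))"
  unfolding dterm_def by (intro continuous_intros) (auto simp del: of_nat_Suc)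

lemma vint_ker_dterm:
  assumes z: "\<bar>Re z\<bar> < pi" and c: "0 < c" "c < 1"
  shows "vint (\<lambda>v. ker z v * dterm a n (1/2 + v)) c =
    of_real (a (Suc n)) / (of_real pi * of_real (sqrt (real (Suc n)))) * (exp (\<i> * z) / (exp (\<i> * z) + of_nat (Suc n)))"
proof -
  define N l where "N = Suc n" and "l = complex_of_real (ln (real N))"
  define M where "M = z + \<i> * l"
  have N0: "of_nat N \<noteq> (0 :: complex)" by (simp add: N_def del: of_nat_Suc)
  have M: "\<bar>Re M\<bar> < pi" using z by (simp add: M_def l_def)
  have Ln: "Ln (of_nat N) = l" using Ln_of_real[of "real N"] by (simp add: l_def N_def)
  have el: "exp l = of_nat N" using exp_Ln[OF N0] by (simp only: Ln)
  have eM: "exp (\<i> * M) = exp (\<i> * z) / of_nat N"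
  proof -
    have "\<i> * M = \<i> * z - l" unfolding M_def by (simp add: distrib_left mult.assoc[symmetric])
    then show ?thesis by (simp only: exp_diff el)
  qed
  \<comment> \<open>The 1/2 in the argument \<open>1/2 + v\<close> is the source of the weight
    \<open>1 / sqrt n\<close> in the sum over prime powers.\<close>
  have half: "exp (- l / 2) = 1 / of_real (sqrt (real N))"
  proof -
    have "sqrt (real N) = exp (ln (real N) / 2)" 
      using powr_half_sqrt[of "real N"] by (simp add: powr_def N_def del: of_nat_Suc)
    then have "complex_of_real (sqrt (real N)) = exp (of_real (ln (real N) / 2))" by (simp only: exp_of_real)
    also have "of_real (ln (real N) / 2) = l / 2" by (simp only: l_def of_real_divide of_real_numeral)
    finally show ?thesis by (simp only: minus_divide_left[symmetric] exp_minus inverse_eq_divide)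
  qed
  have "ker z v * dterm a n (1/2 + v) = (of_real (a N) * (1 / of_real (sqrt (real N)))) * ker M v" for v
  proof -
    have "of_nat N powr - (1/2 + v) = exp (- (1/2 + v) * l)" using N0 by (simp only: powr_def Ln if_False)
    also have "- (1/2 + v) * l = - l / 2 + \<i> * (\<i> * l) * v"
      by (simp add: algebra_simps)
    finally have 1: "of_nat N powr - (1/2 + v) = 1 / of_real (sqrt (real N)) * exp (\<i> * (\<i> * l) * v)"
      by (simp only: exp_add half)
    have "\<i> * M * v = \<i> * z * v + \<i> * (\<i> * l) * v" by (simp only: M_def ring_distribs)
    then have 2: "exp (\<i> * M * v) = exp (\<i> * z * v) * exp (\<i> * (\<i> * l) * v)" by (simp only: exp_add)
    have gen: "(e / s) * (A * (h * E)) = (A * h) * (e * E / s)" for e s A h E :: complex by simp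
    show ?thesis unfolding dterm_def N_def[symmetric] ker_def 1 2 by (rule gen)
  qed
  then have "vint (\<lambda>v. ker z v * dterm a n (1/2 + v)) c = (of_real (a N) * (1 / of_real (sqrt (real N)))) * (exp (\<i> * M) / (of_real pi * (1 + exp (\<i> * M))))"
    by (simp only: vint_cmult vint_ker[OF M c])
  also have "exp (\<i> * M) / (of_real pi * (1 + exp (\<i> * M))) = exp (\<i> * z) / (of_real pi * (exp (\<i> * z) + of_nat N))"
  proof -
    have "1 + exp (\<i> * z) / of_nat N = (exp (\<i> * z) + of_nat N) / of_nat N" using N0 by (simp add: add_divide_distrib)
    moreover have "(e / m) / (p * (s / m)) = e / (p * s)" if "m \<noteq> 0" for e m p s :: complex using that by simp
    ultimately show ?thesis unfolding eM using N0 by (simp only:)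
  qed
  finally show ?thesis by (simp add: N_def del: of_nat_Suc)
qed

text \<open>Division by \<open>2 * \<i>\<close> moves the imaginary unit into the numerators at the
  cost of a sign: the integral is minus the \<open>n\<close>-th term in the theorem.\<close>

lemma vint_sker_dterm:
  assumes z: "\<bar>Re z\<bar> < pi" and c: "0 < c" "c < 1"
  shows "vint (\<lambda>v. sker z v * dterm a n (1/2 + v)) c =
    - (of_real (a (Suc n)) / (2 * of_real pi * of_real (sqrt (real (Suc n)))) *
        (\<i> * exp (\<i> * z) / (exp (\<i> * z) + of_nat (Suc n))
         - \<i> * exp (- \<i> * z) / (exp (- \<i> * z) + of_nat (Suc n))))"
proof -
  have z': "\<bar>Re (- z)\<bar> < pi" using z by simp
  have e: "exp (\<i> * - z) = exp (- \<i> * z)" by simp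
  have gen: "(A / (p * s) * (e / d) - A / (p * s) * (e' / d')) / (2 * \<i>) = - (A / (2 * p * s) * (\<i> * e / d - \<i> * e' / d'))"
    for A p s e d e' d' :: complex
  proof -
    have "1 / (2 * \<i>) = - \<i> / 2" by (simp add: complex_eq_iff)
    then have k: "x / (2 * \<i>) = - (x * (\<i> / 2))" for x by (simp only: divide_inverse[of x] inverse_eq_divide) (simp only: mult_minus_right minus_divide_left[symmetric] times_divide_eq_right)
    show ?thesis unfolding k by (simp add: algebra_simps diff_divide_distrib)
  qed
  show ?thesis
    unfolding vint_sker[OF z polyb_dterm unit_interval_not_Ints[OF c] dterm_vline_continuous]
      vint_ker_dterm[OF z c] vint_ker_dterm[OF z' c] e
    by (rule gen)
qed

text \<open>A common bound for the partial sums and for their limit: the former dominate the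
  termwise integration, the latter makes the series integrable against the kernel.\<close>

lemma Dser_vline:
  assumes a: "subpoly a" and c: "c > 1/2"
  shows "\<exists>D. (\<forall>n v. Re v = c \<longrightarrow> norm (\<Sum>i<n. dterm a i (1/2 + v)) \<le> D) \<and>
    (\<forall>v. Re v = c \<longrightarrow> norm (Dser a (1/2 + v)) \<le> D)"
proof -
  have c': "1/2 + c > 1" using c by simp
  obtain M where M: "summable M" "\<And>n s. Re s \<ge> 1/2 + c \<Longrightarrow> norm (dterm a n s) \<le> M n"
    using dterm_majorant[OF a c'] by blast
  have M0: "M n \<ge> 0" for n using order_trans[OF norm_ge_zero M(2)[of "of_real (1/2 + c)" n]] by simp
  have 1: "norm (\<Sum>i<n. dterm a i (1/2 + v)) \<le> suminf M" if "Re v = c" for n v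
  proof -
    have "norm (\<Sum>i<n. dterm a i (1/2 + v)) \<le> sum M {..<n}"
      by (rule sum_norm_le) (rule M(2), simp add: that)
    also have "\<dots> \<le> suminf M" by (rule sum_le_suminf[OF M(1)]) (auto simp: M0)
    finally show ?thesis .
  qed
  have 2: "norm (Dser a (1/2 + v)) \<le> suminf M" if v: "Re v = c" for v
  proof (rule LIMSEQ_le_const2[OF tendsto_norm])
    show "(\<lambda>n. \<Sum>i<n. dterm a i (1/2 + v)) \<longlonglongrightarrow> Dser a (1/2 + v)"
      using Dser_sums[OF a, of "1/2 + v"] v c unfolding sums_def by simp
  qed (use 1[OF v] in auto)
  show ?thesis using 1 2 by (intro exI[of _ "suminf M"] conjI) auto
qed

lemma Dser_vline_continuous:
  assumes a: "subpoly a" and c: "c > 1/2"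
  shows "continuous_on {s. Re s = c} (\<lambda>v. Dser a (1/2 + v))"
  by (rule continuous_on_compose2[OF holomorphic_on_imp_continuous_on[OF Dser_holomorphic[OF a]]])
     (use c in \<open>auto intro!: continuous_intros\<close>)

lemma polyb_Dser:
  assumes a: "subpoly a" and c: "c > 1/2"
  shows "polyb (\<lambda>v. Dser a (1/2 + v)) c c"
proof -
  obtain D where D: "\<forall>v. Re v = c \<longrightarrow> norm (Dser a (1/2 + v)) \<le> D" using Dser_vline[OF assms] by blast
  show ?thesis by (rule polyb_bounded[where D = D]) (use D in simp)
qed

lemma vint_sker_dterm_sums:
  assumes z: "\<bar>Re z\<bar> < pi" and a: "subpoly a" and c: "1/2 < c" "c < 1"
  shows "(\<lambda>n. vint (\<lambda>v. sker z v * dterm a n (1/2 + v)) c) sums vint (\<lambda>v. sker z v * Dser a (1/2 + v)) c"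
proof -
  have c0: "0 < c" using c by simp
  note cZ = unit_interval_not_Ints[OF c0 c(2)]
  obtain D where D: "\<forall>n v. Re v = c \<longrightarrow> norm (\<Sum>i<n. dterm a i (1/2 + v)) \<le> D" using Dser_vline[OF a c(1)] by blast
  have "(\<lambda>n. vint (\<lambda>v. sker z v * (\<Sum>i<n. dterm a i (1/2 + v))) c) \<longlonglongrightarrow> vint (\<lambda>v. sker z v * Dser a (1/2 + v)) c"
  proof (rule vint_sker_limit[OF z cZ])
    show "continuous_on {s. Re s = c} (\<lambda>v. \<Sum>i<n. dterm a i (1/2 + v))" for n
      by (rule continuous_on_sum) (rule dterm_vline_continuous)
    show "norm (\<Sum>i<n. dterm a i (1/2 + v)) \<le> D * (1 + norm v) ^ 0" if "Re v = c" for n v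
      using D that by simp
    show "(\<lambda>n. \<Sum>i<n. dterm a i (1/2 + v)) \<longlonglongrightarrow> Dser a (1/2 + v)" if "Re v = c" for v
      using Dser_sums[OF a, of "1/2 + v"] that c unfolding sums_def by simp
  qed
  moreover have "vint (\<lambda>v. sker z v * (\<Sum>i<n. dterm a i (1/2 + v))) c = (\<Sum>i<n. vint (\<lambda>v. sker z v * dterm a i (1/2 + v)) c)" for n
    using vint_sker_sum[OF z cZ finite_lessThan, of n "\<lambda>i v. dterm a i (1/2 + v)" "\<lambda>_. 1"] dterm_vline_continuous polyb_dterm by simp
  ultimately show ?thesis unfolding sums_def by (simp only:)
qed

section \<open>The archimedean contribution\<close>

lemma polyb_add:
  assumes "polyb F a b" "polyb G a b" shows "polyb (\<lambda>v. F v + G v) a b"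
proof -
  obtain D k where D: "\<And>v. a \<le> Re v \<Longrightarrow> Re v \<le> b \<Longrightarrow> norm (F v) \<le> D * (1 + norm v) ^ k"
    using assms(1) unfolding polyb_def by blast
  obtain D' k' where D': "\<And>v. a \<le> Re v \<Longrightarrow> Re v \<le> b \<Longrightarrow> norm (G v) \<le> D' * (1 + norm v) ^ k'"
    using assms(2) unfolding polyb_def by blast
  have gen: "x \<le> \<bar>E\<bar> * (1 + norm v) ^ (m + n)" if "x \<le> E * (1 + norm v) ^ m" for x E m n and v :: complex
  proof -
    have "E * (1 + norm v) ^ m \<le> \<bar>E\<bar> * (1 + norm v) ^ (m + n)"
      by (intro mult_mono power_increasing) auto
    then show ?thesis using that by (rule order_trans[rotated])
  qed
  have "norm (F v + G v) \<le> (\<bar>D\<bar> + \<bar>D'\<bar>) * (1 + norm v) ^ (k + k')" if "a \<le> Re v" "Re v \<le> b" for v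
    using norm_triangle_ineq[of "F v" "G v"] gen[OF D[OF that], of k'] gen[OF D'[OF that], of k]
    by (simp only: distrib_right add.commute[of k'])
  then show ?thesis unfolding polyb_def by blast
qed

lemma vint_ker_arch:
  assumes z: "\<bar>Re z\<bar> < pi" and c: "1/2 < c" "c < 1"
  shows "vint (\<lambda>v. ker z v * arch v) c = - of_real (ln pi / 2) * vint (ker z) c + vint (\<lambda>v. ker z v * psi_half v) c
    + vint (\<lambda>v. ker z v * (1 / (v + 1/2))) c + vint (\<lambda>v. ker z v * (1 / (v - 1/2))) c"
    "polyb arch c c" "continuous_on {s. Re s = c} arch"
proof -
  have c0: "0 < c" using c by simp
  note cZ = unit_interval_not_Ints[OF c0 c(2)]
  have nz: "s + 1/2 \<noteq> 0" "s - 1/2 \<noteq> 0" if "Re s = c" for s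
    using that c by (auto simp: complex_eq_iff)
  have p1: "polyb (\<lambda>v. - of_real (ln pi / 2)) c c" by (rule polyb_const)
  have p2: "polyb psi_half c c" using c0 by (intro psi_half_polyb) simp
  have p3: "polyb (\<lambda>v. 1 / (v + 1/2)) c c" using polyb_inverse[of "-1/2" c c] c0 by simp
  have p4: "polyb (\<lambda>v. 1 / (v - 1/2)) c c" using polyb_inverse[of "1/2" c c] c by simp
  have k1: "continuous_on {s. Re s = c} (\<lambda>v. - complex_of_real (ln pi / 2))" by (rule continuous_on_const)
  have k2: "continuous_on {s. Re s = c} psi_half"
    by (rule holomorphic_vline_continuous[OF psi_half_holomorphic[of 1]]) (use c c0 in auto)
  have k3: "continuous_on {s. Re s = c} (\<lambda>v. 1 / (v + 1/2))" and k4: "continuous_on {s. Re s = c} (\<lambda>v. 1 / (v - 1/2))"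
    by (intro continuous_on_divide continuous_on_add continuous_on_diff continuous_on_const continuous_on_id ballI,
        (rule nz, simp))+
  show arch_cont: "continuous_on {s. Re s = c} arch"
    unfolding arch_def[abs_def] by (intro continuous_on_add k1 k2 k3 k4)
  show "polyb arch c c"
    unfolding arch_def[abs_def] by (intro polyb_add p1 p2 p3 p4)
  note i1 = ker_line_integrable[OF z p1 cZ k1] and i2 = ker_line_integrable[OF z p2 cZ k2]
    and i3 = ker_line_integrable[OF z p3 cZ k3] and i4 = ker_line_integrable[OF z p4 cZ k4]
  have "vint (\<lambda>v. ker z v * arch v) c = vint (\<lambda>v. ker z v * (- of_real (ln pi / 2)) + ker z v * psi_half v
    + ker z v * (1 / (v + 1/2)) + ker z v * (1 / (v - 1/2))) c"
    by (simp only: arch_def distrib_left)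
  also have "\<dots> = vint (\<lambda>v. ker z v * (- of_real (ln pi / 2))) c + vint (\<lambda>v. ker z v * psi_half v) c
    + vint (\<lambda>v. ker z v * (1 / (v + 1/2))) c + vint (\<lambda>v. ker z v * (1 / (v - 1/2))) c"
    using vint_add[OF i1 i2] vint_add[OF Bochner_Integration.integrable_add[OF i1 i2] i3]
      vint_add[OF Bochner_Integration.integrable_add[OF Bochner_Integration.integrable_add[OF i1 i2] i3] i4]
    by (simp only:)
  also have "vint (\<lambda>v. ker z v * (- of_real (ln pi / 2))) c = - of_real (ln pi / 2) * vint (ker z) c"
    using vint_cmult[of "- of_real (ln pi / 2)" "ker z" c] by (simp only: mult.commute)
  finally show "vint (\<lambda>v. ker z v * arch v) c = - of_real (ln pi / 2) * vint (ker z) c + vint (\<lambda>v. ker z v * psi_half v) c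
    + vint (\<lambda>v. ker z v * (1 / (v + 1/2))) c + vint (\<lambda>v. ker z v * (1 / (v - 1/2))) c" .
qed

text \<open>The values entering the residues at 1 and 2, scaled by 4 to clear denominators for
  \<open>arch_algebra\<close>. The 8 comes from the recurrence
  \<open>Digamma (1/4 + 1) = Digamma (1/4) + 4\<close>.\<close>

lemma psi_half_1_2:
  "4 * psi_half 1 = 2 * (- euler_mascheroni - 3 * of_real (ln 2)) + of_real pi"
  "4 * psi_half 2 = 2 * (- euler_mascheroni - 3 * of_real (ln 2)) - of_real pi + 8"
proof -
  have e: "1/4 + 1/2 = (3/4 :: complex)" "1/4 + 2/2 = (1/4 + 1 :: complex)" by (simp_all add: complex_eq_iff)
  show "4 * psi_half 1 = 2 * (- euler_mascheroni - 3 * of_real (ln 2)) + of_real pi"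
    unfolding psi_half_def e Digamma_quarters by (simp add: field_simps)
  have "Digamma (1/4 + 1 :: complex) = Digamma (1/4) + 1 / (1/4)" by (rule Digamma_plus1) simp
  then show "4 * psi_half 2 = 2 * (- euler_mascheroni - 3 * of_real (ln 2)) - of_real pi + 8"
    unfolding psi_half_def e Digamma_quarters by (simp add: field_simps)
qed

text \<open>Here \<open>u = exp (\<i> * z / 2)\<close>, \<open>U = 1 / u\<close>, \<open>P\<close>
  and \<open>p\<close> are \<open>pi\<close> and its inverse, \<open>\<phi>\<close> and
  \<open>\<phi>'\<close> the two \<open>Arctan\<close> values, and \<open>A\<close>,
  \<open>B\<close> the values of \<open>psi_half\<close> at 1 and 2. The equations for
  \<open>J\<close> and \<open>J'\<close> are the shift equations for \<open>z\<close> and for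
  \<open>- z\<close>, the latter multiplied by \<open>q^2\<close>. With free variables only a
  polynomial identity is left.\<close>

lemma arch_algebra:
  fixes u U P p L D q K K' J J' \<phi> \<phi>' A B I :: complex
  assumes "u * U = 1" "P * p = 1" "q = u * u" "I * I = -1"
    and "4 * \<phi> = P - 2 * I * L" "4 * \<phi>' = P + 2 * I * L"
    and "4 * A = 2 * D + P" "4 * B = 2 * D - P + 8"
    and "K = 2 * p * (1 - \<phi> * U)" "K' = 2 * p * (1 - \<phi>' * u)"
    and "(q * q - 1) * J = (q * q * B - q * A) * p - q * q * K"
    and "(1 - q * q) * J' = (B - q * A) * p - K'"
  shows "4 * ((q * q - 1) * (J - J')) = 2 * D * p * (q - 1) * (q - 1) - (u - 1) * (u - 1) * (q + 1) - 4 * I * u * L * p * (q - 1)"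
proof -
  have "4 * ((q * q - 1) * (J - J')) = 4 * ((q * q - 1) * J + (1 - q * q) * J')" by (simp add: algebra_simps)
  also have "\<dots> = p * (q * q + 1) * (4 * B) - 2 * p * q * (4 * A) - q * q * 2 * p * (4 - (4 * \<phi>) * U) - 2 * p * (4 - (4 * \<phi>') * u)"
    unfolding assms(11,12) assms(9,10) by (simp add: algebra_simps)
  also have "\<dots> = 2 * D * p * (q - 1) * (q - 1) - (P * p) * (q + 1) * (q + 1)
     + 2 * (P * p) * u * (q * (u * U) + 1) - 4 * I * u * L * p * (q * (u * U) - 1)"
    unfolding assms(5-8) unfolding assms(3) by (simp add: algebra_simps)
  also have "\<dots> = 2 * D * p * (q - 1) * (q - 1) - (u - 1) * (u - 1) * (q + 1) - 4 * I * u * L * p * (q - 1)"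
    unfolding assms(1,2) unfolding assms(3) by (simp add: algebra_simps)
  finally show ?thesis .
qed

text \<open>A root would make \<open>z\<close> an integer multiple of \<open>pi\<close>. Thus the
  coefficient \<open>q^2 - 1\<close> in \<open>vint_ker_psi_half\<close> is invertible except at
  \<open>z = 0\<close>.\<close>

lemma exp_ne_one:
  assumes "\<bar>Re z\<bar> < pi" "z \<noteq> 0" shows "exp (\<i> * z) ^ 2 \<noteq> 1"
proof
  assume "exp (\<i> * z) ^ 2 = 1"
  then have "sin (of_real pi * (z / of_real pi)) = 0"
    by (simp add: sin_exp_eq exp_minus divide_simps power2_eq_square)
  then obtain n :: int where "z / of_real pi = of_int n" unfolding sin_pi_eq_0_iff by blast
  then have n: "z = of_int n * of_real pi" by (simp add: divide_simps)
  then have "Re z = of_int n * pi" by simp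
  then have "\<bar>real_of_int n\<bar> * pi < 1 * pi" using assms by (simp add: abs_mult)
  then have "n = 0" by (simp only: mult_less_cancel_right_pos[OF pi_gt_zero])
  then show False using n assms by simp
qed

text \<open>All parts become rational in \<open>u = exp (\<i> * z / 2)\<close>, apart from constants
  and the logarithm \<open>L\<close>. The fractions \<open>1 / (v + 1/2)\<close> and
  \<open>1 / (v - 1/2)\<close> together give \<open>sin (z / 2)\<close>; the digamma term gives
  \<open>tan (z / 4)\<close>, the logarithm and a part of the coefficient of
  \<open>tan (z / 2)\<close>; the constant \<open>- ln pi / 2\<close> supplies the rest of that
  coefficient.\<close>

lemma vint_sker_arch:
  assumes z: "\<bar>Re z\<bar> < pi"
  shows "vint (\<lambda>v. sker z v * arch v) (3/4) = f_rhs z"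
proof (cases "z = 0")
  case True
  \<comment> \<open>At \<open>z = 0\<close> the kernel vanishes, and so do the sine, the tangents
    and \<open>Ln 1\<close> on the right.\<close>
  then show ?thesis by (simp add: sker_def vint_def f_rhs_def)
next
  case False
  have c: "1/2 < (3/4::real)" "(3/4::real) < 1" "0 < (3/4::real)" by auto
  have z': "\<bar>Re (- z)\<bar> < pi" using z by simp
  define u U where "u = exp (\<i> * z / 2)" and "U = exp (\<i> * (- z) / 2)"
  define q where "q = u * u"
  define L where "L = Ln ((1 - tan (z / 4)) / (1 + tan (z / 4)))"
  define P p where "P = complex_of_real pi" and "p = 1 / complex_of_real pi"
  define \<phi> \<phi>' where "\<phi> = Arctan u" and "\<phi>' = Arctan U"
  define D where "D = - euler_mascheroni - 3 * complex_of_real (ln 2)"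
  define K K' where "K = vint (\<lambda>v. ker z v * (1 / (v + 1/2))) (3/4)" and "K' = vint (\<lambda>v. ker (- z) v * (1 / (v + 1/2))) (3/4)"
  define M M' where "M = vint (\<lambda>v. ker z v * (1 / (v - 1/2))) (3/4)" and "M' = vint (\<lambda>v. ker (- z) v * (1 / (v - 1/2))) (3/4)"
  define J J' where "J = vint (\<lambda>v. ker z v * psi_half v) (3/4)" and "J' = vint (\<lambda>v. ker (- z) v * psi_half v) (3/4)"
  define E E' where "E = vint (ker z) (3/4)" and "E' = vint (ker (- z)) (3/4)"
  have uU: "u * U = 1" by (simp add: u_def U_def flip: exp_add)
  have u0: "u \<noteq> 0" and U: "U = 1 / u" using uU by (auto simp: divide_simps mult.commute)
  have Pp: "P * p = 1" by (simp add: P_def p_def)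
  have P0: "P \<noteq> 0" and pP: "p = 1 / P" by (simp_all add: P_def p_def)
  have q: "exp (\<i> * z) = q" unfolding q_def u_def exp_add[symmetric] by simp
  have q0: "q \<noteq> 0" using u0 by (simp add: q_def)
  have q': "exp (\<i> * (- z)) = 1 / q" using q by (simp add: exp_minus inverse_eq_divide)
  have q1: "q + 1 \<noteq> 0" using exp_ne_minus_one[OF z] unfolding q by (simp add: add.commute)
  have qq: "q * q \<noteq> 1" using exp_ne_one[OF z False] unfolding q by (simp add: power2_eq_square)
  have "Re u > 0" unfolding u_def by (rule exp_half_Re_pos[OF z])
  then have u1: "u + 1 \<noteq> 0" by (auto simp: complex_eq_iff)
  have um1: "u - 1 \<noteq> 0" using qq by (auto simp: q_def)
  have phi: "4 * \<phi> = P - 2 * \<i> * L" "4 * \<phi>' = P + 2 * \<i> * L"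
    unfolding \<phi>_def \<phi>'_def u_def U_def Arctan_exp(1,2)[OF z] L_def P_def by (simp_all add: field_simps)
  have Kv: "K = 2 * p * (1 - \<phi> * U)" "K' = 2 * p * (1 - \<phi>' * u)"
    unfolding K_def K'_def vint_ker_plus_half[OF z c(3,2)] vint_ker_plus_half[OF z' c(3,2)]
      u_def[symmetric] U_def[symmetric] \<phi>_def[symmetric] \<phi>'_def[symmetric]
    using u0 by (simp_all add: U p_def)
  have Mv: "M = 2 * p * (u * \<phi>)" "M' = 2 * p * (U * \<phi>')"
    unfolding M_def M'_def vint_ker_minus_half[OF z c(1,2)] vint_ker_minus_half[OF z' c(1,2)]
      u_def[symmetric] U_def[symmetric] \<phi>_def[symmetric] \<phi>'_def[symmetric] by (simp_all add: p_def)
  have Ev: "E - E' = p * ((q - 1) / (q + 1))"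
  proof -
    have b: "1 + 1 / q = (q + 1) / q" using q0 by (simp add: field_simps)
    have "(1 / q) / (P * (b / q)) = 1 / (P * b)" for b using q0 by simp
    moreover have "a / (P * b) - 1 / (P * b) = 1 / P * ((a - 1) / b)" for a b
      by (simp only: diff_divide_distrib[symmetric] times_divide_times_eq mult_1_left)
    ultimately show ?thesis
      unfolding E_def E'_def vint_ker[OF z c(3,2)] vint_ker[OF z' c(3,2)] q q' P_def[symmetric] pP b
      by (simp only: add.commute[of 1])
  qed
  have J1: "(q * q - 1) * J = (q * q * psi_half 2 - q * psi_half 1) * p - q * q * K"
    using vint_ker_psi_half[OF z c(3,2)] unfolding q J_def[symmetric] K_def[symmetric]
    by (simp add: power2_eq_square p_def)
  \<comment> \<open>The equation for \<open>- z\<close> has \<open>1 / q\<close> in place of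
    \<open>q\<close>; multiplying by \<open>q * q\<close> clears the denominators.\<close>
  have J2: "(1 - q * q) * J' = (psi_half 2 - q * psi_half 1) * p - K'"
  proof -
    have "((1 / q) ^ 2 - 1) * J' = ((1 / q) ^ 2 * psi_half 2 - 1 / q * psi_half 1) * p - (1 / q) ^ 2 * K'"
      using vint_ker_psi_half[OF z' c(3,2)] unfolding q' J'_def[symmetric] K'_def[symmetric]
      by (simp add: p_def)
    then have "q * q * (((1 / q) ^ 2 - 1) * J') = q * q * (((1 / q) ^ 2 * psi_half 2 - 1 / q * psi_half 1) * p - (1 / q) ^ 2 * K')"
      by (simp only:)
    then show ?thesis using q0 by (simp add: power2_eq_square algebra_simps)
  qed
  have "4 * ((q * q - 1) * (J - J')) = 2 * D * p * (q - 1) * (q - 1) - (u - 1) * (u - 1) * (q + 1) - 4 * \<i> * u * L * p * (q - 1)"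
    by (rule arch_algebra[OF uU Pp q_def _ phi psi_half_1_2[folded D_def P_def] Kv J1 J2]) simp
  also have "\<dots> = 4 * ((q * q - 1) * (D * p / 2 * ((q - 1) / (q + 1)) - (u - 1) / (u + 1) / 4 - \<i> * u * L * p / (q + 1)))"
  proof -
    have a: "4 * ((q * q - 1) * (D * p / 2 * ((q - 1) / (q + 1)))) = 2 * D * p * (q - 1) * (q - 1)"
    proof -
      have "4 * ((b * d) * (D * p / 2 * (d / b))) = 2 * D * p * d * d" if "b \<noteq> 0" for b d using that by (simp add: field_simps)
      moreover have "q * q - 1 = (q + 1) * (q - 1)" by (simp add: algebra_simps)
      ultimately show ?thesis using q1 by (simp only:)
    qed
    have "q * q - 1 = (u - 1) * (u + 1) * (q + 1)" by (simp add: q_def algebra_simps)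
    moreover have "4 * ((a * b * e) * (a / b / 4)) = a * a * e" if "b \<noteq> 0" for a b e :: complex
      using that by simp
    ultimately have b: "4 * ((q * q - 1) * ((u - 1) / (u + 1) / 4)) = (u - 1) * (u - 1) * (q + 1)"
      using u1 by (simp only:)
    have c: "4 * ((q * q - 1) * (\<i> * u * L * p / (q + 1))) = 4 * \<i> * u * L * p * (q - 1)"
      using q1 by (simp add: divide_simps) (simp add: algebra_simps)
    show ?thesis unfolding right_diff_distrib a b c ..
  qed
  finally have JJ: "J - J' = D * p / 2 * ((q - 1) / (q + 1)) - (u - 1) / (u + 1) / 4 - \<i> * u * L * p / (q + 1)"
    using qq by simp
  \<comment> \<open>The two \<open>Arctan\<close> values add up to \<open>pi / 2\<close>, so the
    logarithm cancels and only \<open>u - U\<close>, that is \<open>2 * \<i> * sin (z / 2)\<close>,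
    remains.\<close>
  have KM: "K + M - (K' + M') = u - U"
  proof -
    have "2 * (K + M - (K' + M')) = p * (u - U) * (4 * \<phi> + 4 * \<phi>')"
      unfolding Kv Mv by (simp add: algebra_simps)
    also have "\<dots> = 2 * ((P * p) * (u - U))" unfolding phi by (simp add: algebra_simps)
    finally have "2 * (K + M - (K' + M')) = 2 * (u - U)" by (simp only: Pp mult_1_left)
    then show ?thesis by (simp only: mult_cancel_left) simp
  qed
  have sinz: "sin (z / 2) = (u - U) / (2 * \<i>)"
    unfolding sin_exp_eq u_def U_def by simp
  have cosz: "cos (z / 2) = (u + U) / 2"
    unfolding cos_exp_eq u_def U_def by simp
  have tan4: "tan (z / 4) = - \<i> * ((u - 1) / (u + 1))" unfolding Arctan_exp(3)[OF z] u_def by simp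
  have uUq: "u - U = (q - 1) / u" "u + U = (q + 1) / u" using u0 by (simp_all add: U q_def field_simps)
  have tan2: "tan (z / 2) = - \<i> * ((q - 1) / (q + 1))"
  proof -
    have "(a / u) / (2 * \<i>) / ((b / u) / 2) = - \<i> * (a / b)" for a b :: complex
      using u0 by (cases "b = 0") (simp_all add: field_simps)
    then show ?thesis unfolding tan_def sinz cosz uUq by (simp only:)
  qed
  have icos: "1 / (4 * P * cos (z / 2)) = u * p / (2 * (q + 1))"
  proof -
    have gen: "1 / (4 * P * (b / u / 2)) = u * (1 / P) / (2 * b)" if "b \<noteq> 0" for b using that u0 P0 by (simp add: field_simps)
    show ?thesis unfolding cosz uUq pP by (rule gen[OF q1])
  qed
  \<comment> \<open>The \<open>3 * ln 2\<close> of the digamma values and the \<open>ln pi\<close>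
    of the power of \<open>pi\<close> in xi combine to \<open>ln (8 * pi)\<close>.\<close>
  have C8: "euler_mascheroni + of_real (ln (8 * pi)) = of_real (ln pi) - D"
  proof -
    have "ln (8 * pi) = 3 * ln 2 + ln pi"
      using ln_realpow[of 2 3] by (simp add: ln_mult)
    then show ?thesis by (simp add: D_def)
  qed
  have half: "x / (2 * \<i>) = - (\<i> / 2) * x" for x :: complex by (simp add: field_simps)
  have "vint (\<lambda>v. sker z v * arch v) (3/4) =
      ((- of_real (ln pi / 2) * E + J + K + M) - (- of_real (ln pi / 2) * E' + J' + K' + M')) / (2 * \<i>)"
    unfolding vint_sker[OF z vint_ker_arch(2)[OF z c(1,2)] unit_interval_not_Ints[OF c(3,2)] vint_ker_arch(3)[OF z c(1,2)]]
      vint_ker_arch(1)[OF z c(1,2)] vint_ker_arch(1)[OF z' c(1,2)]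
      E_def E'_def J_def J'_def K_def K'_def M_def M'_def ..
  also have "(- of_real (ln pi / 2) * E + J + K + M) - (- of_real (ln pi / 2) * E' + J' + K' + M') =
      - of_real (ln pi / 2) * (E - E') + (J - J') + (K + M - (K' + M'))"
  proof -
    have "(k * E + J + K + M) - (k * E' + J' + K' + M') = k * (E - E') + (J - J') + (K + M - (K' + M'))" for k
      by (simp add: algebra_simps)
    then show ?thesis .
  qed
  also have "\<dots> / (2 * \<i>) = (u - U) / (2 * \<i>) + (- (\<i> / 2)) * (- of_real (ln pi / 2) * (E - E') + (J - J'))"
    unfolding KM half[symmetric] by (simp only: add_divide_distrib add.commute)
  also have "\<dots> = f_rhs z"
  proof -
    define x y where "x = (q - 1) / (q + 1)" and "y = (u - 1) / (u + 1)"
    define r where "r = u * p / (2 * (q + 1))"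
    have r: "\<i> * u * L * p / (q + 1) = 2 * (\<i> * L * r)"
    proof -
      have "\<i> * u * L * p / b = 2 * (\<i> * L * (u * p / (2 * b)))" if "b \<noteq> 0" for b using that by simp
      then show ?thesis using q1 by (simp only: r_def)
    qed
    have d: "(of_real (ln pi) - D) / (4 * P) = (of_real (ln pi) - D) * p / 4" by (simp add: pP)
    have lp: "complex_of_real (ln pi / 2) = of_real (ln pi) / 2" by simp
    have fin: "s + (- (\<i> / 2)) * (- (l / 2) * (p * x) + (D * p / 2 * x - y / 4 - 2 * (\<i> * L * r)))
        = s - 1 / 8 * (- \<i> * y) - (l - D) * p / 4 * (- \<i> * x) - r * L" for s l :: complex
    proof -
      define k :: complex where "k = 1 / 8"
      have k: "t / 2 = 4 * k * t" "t / 4 = 2 * k * t" "1 / 8 = k" for t by (simp_all add: k_def)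
      have "(8 * k) * (8 * k) = 1" by (simp add: k_def)
      then have kk: "k * (k * (t * 64)) = t" for t by (simp add: algebra_simps)
      have k16: "16 * k = 2" "8 * k = 1" by (simp_all add: k_def)
      have "(4 * k * \<i>) * (4 * k * l * (p * x)) = (16 * k) * (k * \<i> * l * p * x)"
        "(4 * k * \<i>) * (4 * k * (D * p) * x) = (16 * k) * (k * \<i> * D * p * x)"
        "(4 * k * \<i>) * (2 * k * y) = (8 * k) * (k * \<i> * y)"
        "(4 * k * \<i>) * (2 * (\<i> * L * r)) = (8 * k) * (- (r * L))"
        by (simp_all add: algebra_simps)
      note e = this[unfolded k16]
      show ?thesis unfolding k right_diff_distrib distrib_left mult_minus_left mult_minus_right e
        by (simp add: algebra_simps)
    qed
    show ?thesis
      unfolding f_rhs_def L_def[symmetric] P_def[symmetric]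
      unfolding icos C8 tan4 tan2 sinz[symmetric] Ev JJ r_def[symmetric]
        r x_def[symmetric] y_def[symmetric] d lp
      by (rule fin)
  qed
  finally show ?thesis .
qed

section \<open>The identity between zeros, prime powers and the elementary function\<close>

theorem theorem2:
  fixes z :: complex
  assumes "\<bar>Re z\<bar> < pi"
  shows "\<exists>S T.
    ((\<lambda>\<rho>. of_nat (zeta_zero_mult \<rho>) * (sinh (z * zero_alpha \<rho>) / sinh (of_real pi * zero_alpha \<rho>)))
        has_sum S) {\<rho>. nontrivial_zeta_zero \<rho> \<and> Im \<rho> > 0} \<and>
    (\<lambda>n. mangoldt (Suc n) / (2 * of_real pi * of_real (sqrt (real (Suc n)))) *
        (\<i> * exp (\<i> * z) / (exp (\<i> * z) + of_nat (Suc n))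
         - \<i> * exp (- \<i> * z) / (exp (- \<i> * z) + of_nat (Suc n)))) sums T \<and>
    S - T = f_rhs z"
proof -
  obtain C where "even_entire Xi C" by (rule Xi_even_entire)
  then interpret even_entire Xi C .
  have c: "1/2 < (3/4::real)" "(3/4::real) < 1" "0 < (3/4::real)" by auto
  note cZ = unit_interval_not_Ints[OF c(3,2)]
  define S where "S = vint (\<lambda>v. sker z v * (deriv Xi v / Xi v)) (3/4)"
  \<comment> \<open>By the sign in \<open>vint_sker_dterm\<close> this is minus the sum over
    \<open>n\<close>, which is why the witness below is \<open>- T\<close>.\<close>
  define T where "T = vint (\<lambda>v. sker z v * Dser mangoldt (1/2 + v)) (3/4)"
  have zeros: "\<bar>Re w\<bar> < 1/2" "Im w \<noteq> 0" if "Xi w = 0" for w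
  proof -
    have x: "xi (1/2 + w) = 0" using that by (simp add: Xi_def)
    show "\<bar>Re w\<bar> < 1/2" using xi_zero_strip[OF x] by (simp add: abs_less_iff field_simps)
    show "Im w \<noteq> 0" using xi_zero_Im[OF x] by simp
  qed
  have "((\<lambda>w. of_nat (mult w) * sker z w) has_sum S) {w. Xi w = 0 \<and> Im w > 0}"
    unfolding S_def by (rule sker_zero_sum[OF assms]) (use zeros in auto)
  moreover have "of_nat (mult w) * sker z w = (of_nat (zeta_zero_mult (1/2 + w)) *
      (sinh (z * zero_alpha (1/2 + w)) / sinh (of_real pi * zero_alpha (1/2 + w))))" if "Xi w = 0" for w
  proof -
    have x: "xi (1/2 + w) = 0" using that by (simp add: Xi_def)
    \<comment> \<open>Orders are invariant under translation: both sides are the order at 0 of the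
      same translated function.\<close>
    have "zorder Xi w = zorder xi (1/2 + w)"
      unfolding zorder_shift[of Xi w] zorder_shift[of xi "1/2 + w"] Xi_def by (simp only: add.left_commute)
    then have m: "zeta_zero_mult (1/2 + w) = mult w" by (simp add: zeta_zero_mult_eq[OF x] mult_def)
    \<comment> \<open>The rotation to \<open>zero_alpha\<close> turns sines into hyperbolic sines;
      the factors \<open>- \<i>\<close> cancel in the quotient.\<close>
    have sinh: "sinh (a * (- \<i> * w)) = - \<i> * sin (a * w)" for a
    proof -
      have e: "a * (- \<i> * w) = - (\<i> * (a * w))" by simp
      show ?thesis unfolding e sinh_def sin_exp_eq
        by (simp add: scaleR_conv_of_real field_simps)
    qed
    have "zero_alpha (1/2 + w) = - \<i> * w" by (simp add: zero_alpha_def)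
    then show ?thesis unfolding m sker_def by (simp only: sinh) simp
  qed
  ultimately have "((\<lambda>\<rho>. of_nat (zeta_zero_mult \<rho>) * (sinh (z * zero_alpha \<rho>) / sinh (of_real pi * zero_alpha \<rho>)))
      \<circ> (\<lambda>w. 1/2 + w) has_sum S) {w. Xi w = 0 \<and> Im w > 0}"
    by (subst has_sum_cong) (auto simp: o_def)
  then have "((\<lambda>\<rho>. of_nat (zeta_zero_mult \<rho>) * (sinh (z * zero_alpha \<rho>) / sinh (of_real pi * zero_alpha \<rho>)))
      has_sum S) ((\<lambda>w. 1/2 + w) ` {w. Xi w = 0 \<and> Im w > 0})"
    by (subst has_sum_reindex) (simp_all add: inj_on_def)
  moreover have "(\<lambda>w. 1/2 + w) ` {w. Xi w = 0 \<and> Im w > 0} = {\<rho>. nontrivial_zeta_zero \<rho> \<and> Im \<rho> > 0}"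
  proof (intro equalityI subsetI)
    fix \<rho> assume "\<rho> \<in> {\<rho>. nontrivial_zeta_zero \<rho> \<and> Im \<rho> > 0}"
    then have "\<rho> = 1/2 + (\<rho> - 1/2)" "\<rho> - 1/2 \<in> {w. Xi w = 0 \<and> Im w > 0}"
      by (auto simp: nontrivial_zeta_zero_iff Xi_def)
    then show "\<rho> \<in> (\<lambda>w. 1/2 + w) ` {w. Xi w = 0 \<and> Im w > 0}" by (rule image_eqI)
  qed (auto simp: nontrivial_zeta_zero_iff Xi_def)
  ultimately have "((\<lambda>\<rho>. of_nat (zeta_zero_mult \<rho>) * (sinh (z * zero_alpha \<rho>) / sinh (of_real pi * zero_alpha \<rho>)))
      has_sum S) {\<rho>. nontrivial_zeta_zero \<rho> \<and> Im \<rho> > 0}" by (simp only:)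
  moreover have "(\<lambda>n. mangoldt (Suc n) / (2 * of_real pi * of_real (sqrt (real (Suc n)))) *
        (\<i> * exp (\<i> * z) / (exp (\<i> * z) + of_nat (Suc n))
         - \<i> * exp (- \<i> * z) / (exp (- \<i> * z) + of_nat (Suc n)))) sums (- T)"
    using sums_minus[OF vint_sker_dterm_sums[OF assms subpoly_mangoldt c(1,2)]]
    unfolding vint_sker_dterm[OF assms c(3,2)] minus_minus of_real_mangoldt T_def .
  moreover have "S - (- T) = f_rhs z"
  proof -
    note int = sker_line_integrable[OF assms vint_ker_arch(2)[OF assms c(1,2)] cZ vint_ker_arch(3)[OF assms c(1,2)]]
      sker_line_integrable[OF assms polyb_Dser[OF subpoly_mangoldt c(1)] cZ Dser_vline_continuous[OF subpoly_mangoldt c(1)]]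
    have "sker z v * (deriv Xi v / Xi v) + sker z v * Dser mangoldt (1/2 + v) = sker z v * arch v" if "Re v = 3/4" for v
    proof -
      have "Re v > 1/2" using that by simp
      then show ?thesis unfolding Xi_logderiv(2)[OF \<open>Re v > 1/2\<close>] by (simp add: algebra_simps)
    qed
    then have eq: "sker z (Complex (3/4) t) * (deriv Xi (Complex (3/4) t) / Xi (Complex (3/4) t)) =
        sker z (Complex (3/4) t) * arch (Complex (3/4) t) - sker z (Complex (3/4) t) * Dser mangoldt (1/2 + Complex (3/4) t)" for t
      by (simp add: eq_diff_eq)
    have "S = vint (\<lambda>v. sker z v * arch v) (3/4) - T"
      unfolding S_def T_def vint_def eq Bochner_Integration.integral_diff[OF int] by (rule diff_divide_distrib)
    then show ?thesis by (simp add: vint_sker_arch[OF assms])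
  qed
  ultimately show ?thesis by blast
qed

end
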